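(* Fix $\gamma>1$, $\mu>0$, $\kappa>0$, $M_+>0$ and consider the stationary problem (S) stated in the context, with boundary data $(u_b,\theta_b)$ and $\delta:=|(u_b+1,\theta_b-1)|$. There exists a constant $\varepsilon_0>0$ such that, with $$\mathcal M^+:=\{(u,\theta)\in\mathbb R^2:\ |(u+1,\theta-1)|<\varepsilon_0\}$$ and with $\mathcal M^0,\mathcal M^-\subset\mathcal M^+$ the sets defined in the context, the following hold whenever $(u_b,\theta_b)\in\mathcal M^+$ (equivalently $\delta<\varepsilon_0$). (i) (Supersonic case) If $M_+>1$, there exists a unique smooth solution $(\tilde\rho,\tilde u,\tilde\theta)$ of (S), and it satisfies, for $k=0,1,2,\dots$ and all $x>0$, $$|\partial_x^k(\tilde\rho(x)-1,\tilde u(x)+1,\tilde\theta(x)-1)|\le C\delta e^{-cx}.\qquad( * )$$ (ii) (Transonic case) If $M_+=1$ and $(u_b,\theta_b)\in\mathcal M^0$, there exists a unique smooth solution $(\tilde\rho,\tilde u,\tilde\theta)$ of (S), and it satisfies, for $k=0,1,2,\dots$ and all $x>0$, $$|\partial_x^k(\tilde\rho(x)-1,\tilde u(x)+1,\tilde\theta(x)-1)|\le C\frac{\delta^{k+1}}{(1+\delta x)^{k+1}}+C\delta e^{-cx}.$$ (iii) (Subsonic case) If $M_+<1$ and $(u_b,\theta_b)\in\mathcal M^-$, there exists a unique smooth solution $(\tilde\rho,\tilde u,\tilde\theta)$ of (S), and it satisfies $( * )$. Here $C$ (possibly depending on $k$) and $c$ are positive constants independent of $x$ and of $(u_b,\t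heta_b)$.
   Context: Constants: $c_v=\frac1{\gamma(\gamma-1)}$; pressure $p(\rho,\theta)=\frac1\gamma\rho\theta$; $\tilde p=p(\tilde\rho,\tilde\theta)$. Stationary problem (S) on $\mathbb R_+=(0,\infty)$ (dimensionless stationary compressible Navier--Stokes equations, outflow boundary condition $u_b<0$, $\theta_b>0$): $$(\tilde\rho\tilde u)_x=0,\qquad \Bigl(\tilde\rho\tilde u^2+\tfrac1{M_+^2}\tilde p\Bigr)_x=\mu\tilde u_{xx},$$ $$\Bigl\{\tilde\rho\tilde u\Bigl(\tfrac{c_v}{M_+^2}\tilde\theta+\tfrac{\tilde u^2}2\Bigr)+\tfrac1{M_+^2}\tilde p\tilde u\Bigr\}_x=(\mu\tilde u\tilde u_x+\kappa\tilde\theta_x)_x,$$ $$(\tilde u,\tilde\theta)(0)=(u_b,\theta_b),\qquad \lim_{x\to\infty}(\tilde\rho,\tilde u,\tilde\theta)(x)=(1,-1,1).$$ Definition of $\mathcal M^0,\mathcal M^-$. Integrating (S) gives $\tilde\rho\tilde u=-1$ and, for $(\bar u,\bar\theta)=(\tilde u+1,\tilde\theta-1)$, the autonomous system $\frac{d}{dx}(\bar u,\bar\theta)^{\top}=J(\bar u,\bar\theta)^{\top}+(\bar f,\bar g)^{\top}$ with $$J=\begin{pmatrix}\frac1\mu\bigl(\frac1{M_+^2\gamma}-1\bigr)&\frac1{\mu M_+^2\gamma}\\ \frac1{\kappa M_+^2\gamma}&-\frac{c_v}{\kappa M_+^2}\end{pmatrix},\quad \bar f=-\frac{\bar u(\bar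 u+\bar\theta)}{\mu M_+^2\gamma(\bar u-1)},\quad \bar g=\frac{\bar u^2}{2\kappa}.$$ $J$ has real eigenvalues $\lambda_1\ge\lambda_2$ with eigenvectors $r_1,r_2$; $P=(r_1,r_2)$. For $M_+=1$: with $d=\mu+\kappa(\gamma-1)^2$, $\lambda_1=0$, $\lambda_2=-c_vd/(\mu\kappa)<0$, $r_1=(-1,1-\gamma)^\top$, $r_2=(\kappa(1-\gamma),\mu)^\top$. For $M_+<1$: $\lambda_1>0>\lambda_2$. Put $(\hat U(u,\theta),\hat\Theta(u,\theta))^\top:=P^{-1}(u+1,\theta-1)^\top$. In the coordinates $(U,\Theta)^\top=P^{-1}(\bar u,\bar\theta)^\top$ the system is diagonal at linear order, and for $M_+\le1$, $U=h^{s}(\Theta)$ denotes the local stable manifold of the origin corresponding to the eigenvalue $\lambda_2$ (the local invariant curve through the origin tangent to the $\Theta$-axis). Then $$\mathcal M^0:=\{(u,\theta)\in\mathcal M^+:\hat U(u,\theta)\ge h^{s}(\hat\Theta(u,\theta))\}\ (M_+=1),\qquad \mathcal M^-:=\{(u,\theta)\in\mathcal M^+:\hat U(u,\theta)=h^{s}(\hat\Theta(u,\theta))\}\ (M_+<1).$$ *)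

theory Defs
  imports "HOL-Analysis.Analysis"
begin

definition c_v :: "real \<Rightarrow> real" where
  "c_v \<gamma> = 1 / (\<gamma> * (\<gamma> - 1))"

definition pressure :: "real \<Rightarrow> real \<Rightarrow> real \<Rightarrow> real" where
  "pressure \<gamma> \<rho> \<theta> = \<rho> * \<theta> / \<gamma>"

definition smooth_on_halfline :: "(real \<Rightarrow> real) \<Rightarrow> bool" where
  "smooth_on_halfline f \<longleftrightarrow> (\<forall>k. \<forall>x>0. (deriv ^^ k) f differentiable (at x))"

(* Smooth solution of (S): the equations hold on the open half line, and continuity up to
   x = 0 gives the boundary condition its meaning. Values at x < 0 are irrelevant. *)
definition stationary_solution ::
  "real \<Rightarrow> real \<Rightarrow> real \<Rightarrow> real \<Rightarrow> real \<Rightarrow> real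
    \<Rightarrow> (real \<Rightarrow> real) \<Rightarrow> (real \<Rightarrow> real) \<Rightarrow> (real \<Rightarrow> real) \<Rightarrow> bool" where
  "stationary_solution \<gamma> \<mu> \<kappa> M ub \<theta>b \<rho> u \<theta> \<longleftrightarrow>
     smooth_on_halfline \<rho> \<and> smooth_on_halfline u \<and> smooth_on_halfline \<theta> \<and>
     continuous_on {0..} \<rho> \<and> continuous_on {0..} u \<and> continuous_on {0..} \<theta> \<and>
     (\<forall>x>0. deriv (\<lambda>x. \<rho> x * u x) x = 0) \<and>
     (\<forall>x>0. deriv (\<lambda>x. \<rho> x * (u x)\<^sup>2 + 1 / M\<^sup>2 * pressure \<gamma> (\<rho> x) (\<theta> x)) x
            = \<mu> * deriv (deriv u) x) \<and>
     (\<forall>x>0. deriv (\<lambda>x. \<rho> x * u x * (c_v \<gamma> / M\<^sup>2 * \<theta> x + (u x)\<^sup>2 / 2)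
                        + 1 / M\<^sup>2 * pressure \<gamma> (\<rho> x) (\<theta> x) * u x) x
            = deriv (\<lambda>x. \<mu> * u x * deriv u x + \<kappa> * deriv \<theta> x) x) \<and>
     u 0 = ub \<and> \<theta> 0 = \<theta>b \<and>
     (\<rho> \<longlongrightarrow> 1) at_top \<and> (u \<longlongrightarrow> -1) at_top \<and> (\<theta> \<longlongrightarrow> 1) at_top"

definition unique_stationary_solution ::
  "real \<Rightarrow> real \<Rightarrow> real \<Rightarrow> real \<Rightarrow> real \<Rightarrow> real
    \<Rightarrow> (real \<Rightarrow> real) \<Rightarrow> (real \<Rightarrow> real) \<Rightarrow> (real \<Rightarrow> real) \<Rightarrow> bool" where
  "unique_stationary_solution \<gamma> \<mu> \<kappa> M ub \<theta>b \<rho> u \<theta> \<longleftrightarrow>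
     stationary_solution \<gamma> \<mu> \<kappa> M ub \<theta>b \<rho> u \<theta> \<and>
     (\<forall>\<rho>' u' \<theta>'. stationary_solution \<gamma> \<mu> \<kappa> M ub \<theta>b \<rho>' u' \<theta>' \<longrightarrow>
        (\<forall>x\<ge>0. \<rho>' x = \<rho> x \<and> u' x = u x \<and> \<theta>' x = \<theta> x))"

definition perturbation_deriv ::
  "nat \<Rightarrow> (real \<Rightarrow> real) \<Rightarrow> (real \<Rightarrow> real) \<Rightarrow> (real \<Rightarrow> real) \<Rightarrow> real \<Rightarrow> real \<times> real \<times> real" where
  "perturbation_deriv k \<rho> u \<theta> x =
     ((deriv ^^ k) (\<lambda>x. \<rho> x - 1) x, (deriv ^^ k) (\<lambda>x. u x + 1) x, (deriv ^^ k) (\<lambda>x. \<theta> x - 1) x)"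

definition linear_part :: "real \<Rightarrow> real \<Rightarrow> real \<Rightarrow> real \<Rightarrow> real^2^2" where
  "linear_part \<gamma> \<mu> \<kappa> M = vector
     [vector [1 / \<mu> * (1 / (M\<^sup>2 * \<gamma>) - 1), 1 / (\<mu> * M\<^sup>2 * \<gamma>)],
      vector [1 / (\<kappa> * M\<^sup>2 * \<gamma>), - c_v \<gamma> / (\<kappa> * M\<^sup>2)]]"

definition nonlinear_part :: "real \<Rightarrow> real \<Rightarrow> real \<Rightarrow> real \<Rightarrow> real^2 \<Rightarrow> real^2" where
  "nonlinear_part \<gamma> \<mu> \<kappa> M w = vector
     [- (w $ 1 * (w $ 1 + w $ 2) / (\<mu> * M\<^sup>2 * \<gamma> * (w $ 1 - 1))), (w $ 1)\<^sup>2 / (2 * \<kappa>)]"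

(* The columns of P are the eigenvectors r1, r2. Their scaling is left free, except for M = 1
   where they are prescribed: there the sign of r1 decides on which side of the stable
   manifold the set M_zero lies. *)
definition eigenvector_matrix :: "real \<Rightarrow> real \<Rightarrow> real \<Rightarrow> real \<Rightarrow> real^2^2 \<Rightarrow> bool" where
  "eigenvector_matrix \<gamma> \<mu> \<kappa> M P \<longleftrightarrow>
     invertible P \<and>
     (\<exists>l1 l2. l1 \<ge> l2 \<and>
        linear_part \<gamma> \<mu> \<kappa> M *v column 1 P = l1 *s column 1 P \<and>
        linear_part \<gamma> \<mu> \<kappa> M *v column 2 P = l2 *s column 2 P) \<and>
     (M = 1 \<longrightarrow> column 1 P = vector [-1, 1 - \<gamma>] \<and> column 2 P = vector [\<kappa> * (1 - \<gamma>), \<mu>])"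

definition U_hat :: "real^2^2 \<Rightarrow> real \<Rightarrow> real \<Rightarrow> real" where
  "U_hat P u \<theta> = (matrix_inv P *v vector [u + 1, \<theta> - 1]) $ 1"

definition \<Theta>_hat :: "real^2^2 \<Rightarrow> real \<Rightarrow> real \<Rightarrow> real" where
  "\<Theta>_hat P u \<theta> = (matrix_inv P *v vector [u + 1, \<theta> - 1]) $ 2"

(* The graph U = h(Theta), |Theta| < r, is the local stable manifold of the origin for the
   eigenvalue lambda_2 (the smaller one): a C^1 curve through the origin, tangent there to
   the Theta-axis (the lambda_2-eigendirection), positively invariant, and all of whose orbits
   exist for all x >= 0 and converge to the origin. Orbits w are written in the variables
   (u + 1, theta - 1); w $ 1 < 1 keeps them off the singularity of the nonlinear part.
   For M <= 1 these conditions determine h uniquely on {-r<..<r}. *)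
definition local_stable_manifold ::
  "real \<Rightarrow> real \<Rightarrow> real \<Rightarrow> real \<Rightarrow> real^2^2 \<Rightarrow> real \<Rightarrow> (real \<Rightarrow> real) \<Rightarrow> bool" where
  "local_stable_manifold \<gamma> \<mu> \<kappa> M P r h \<longleftrightarrow>
     r > 0 \<and> h C1_differentiable_on {-r<..<r} \<and>
     h 0 = 0 \<and> (h has_real_derivative 0) (at 0) \<and>
     (\<forall>s\<in>{-r<..<r}. \<exists>w :: real \<Rightarrow> real^2.
        w 0 = P *v vector [h s, s] \<and>
        (\<forall>x\<ge>0. w x $ 1 < 1 \<and>
           (w has_vector_derivative
              linear_part \<gamma> \<mu> \<kappa> M *v w x + nonlinear_part \<gamma> \<mu> \<kappa> M (w x)) (at x within {0..}) \<and>
           \<bar>(matrix_inv P *v w x) $ 2\<bar> < r \<and>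
           (matrix_inv P *v w x) $ 1 = h ((matrix_inv P *v w x) $ 2)) \<and>
        (w \<longlongrightarrow> 0) at_top)"

definition M_plus :: "real \<Rightarrow> (real \<times> real) set" where
  "M_plus \<epsilon>0 = {(u, \<theta>). norm (u + 1, \<theta> - 1) < \<epsilon>0}"

definition M_zero :: "real^2^2 \<Rightarrow> (real \<Rightarrow> real) \<Rightarrow> real \<Rightarrow> (real \<times> real) set" where
  "M_zero P h \<epsilon>0 = {(u, \<theta>) \<in> M_plus \<epsilon>0. U_hat P u \<theta> \<ge> h (\<Theta>_hat P u \<theta>)}"

definition M_minus :: "real^2^2 \<Rightarrow> (real \<Rightarrow> real) \<Rightarrow> real \<Rightarrow> (real \<times> real) set" where
  "M_minus P h \<epsilon>0 = {(u, \<theta>) \<in> M_plus \<epsilon>0. U_hat P u \<theta> = h (\<Theta>_hat P u \<theta>)}"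

end

(* Integrating the conservation laws from x to infinity turns (S) into a planar autonomous system for
   (a, b) = (u + 1, theta - 1), with rho = -1/u; uniqueness is uniqueness for this system with the
   given initial value, so only existence and decay of orbits ending at the origin is at stake.
   For M > 1 the matrix diag(mu, kappa) J is symmetric and negative definite, so mu a^2 + kappa b^2 is a
   Lyapunov function. For M <= 1, pass to eigenvector coordinates (U, T). The stable manifold is a graph
   U = h(T), and h(t) = t k(t) reduces its invariance equation to a regular singular scalar equation
   that is solved by contraction; on the graph T decays exponentially. For M = 1 the coordinate
   V = U - h(T) stays nonnegative and satisfies V' = V (b T - a V + ...) with a > 0, while T' = l2 T + ...;
   after a change of coordinates this gives E' <= -c E^(3/2) for a quadratic energy E, hence decay like
   delta / (1 + delta x). Derivatives are bounded by bootstrapping through the differential equation,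
   which is polynomial in (a, b, a / (1 - a)). *)

theory Submission
  imports Defs
begin

section \<open>Ordinary differential equations\<close>


text \<open>At M = 1 the linear part is silent in the U-direction, and everything rests on the
  coefficient of U^2 in U'. With the prescribed columns of P it is -(\<gamma> + 1) / (2 d), d =
  \<mu> + \<kappa> (\<gamma> - 1)^2, so the quadratic term attracts on the side V \<ge> 0;
  invariance of the graph makes V' a multiple of V up to bounded factors, so this side is never
  left. The inequality for E gives up the faster decay of T. It must be recovered for the
  derivatives: T' = l2 T + ... gains a power of the weight only if T itself is of quadratic size,
  which follows by reading the T-equation as a damped linear one with quadratic source. Since C and
  c may not depend on the boundary data, decay is a property of families indexed by the data, never
  of a single function. Global existence comes from cutting the field off outside a ball; a
  continuity argument then shows that the orbit does not notice the cut-off. Uniqueness has to face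
  competitors that need not be small, so it uses Lipschitz bounds on compact intervals of x
  instead.\<close>

lemma integral_from_0_has_vector_derivative:
  fixes g :: "real \<Rightarrow> 'a::banach"
  assumes g: "continuous_on {0..} g" and x: "x \<ge> 0"
  shows "((\<lambda>x. integral {0..x} g) has_vector_derivative g x) (at x within {0..})"
proof -
  have "((\<lambda>x. integral {0..x} g) has_vector_derivative g x) (at x within {0..x+1})"
    by (rule integral_has_vector_derivative) (use x in \<open>auto intro: continuous_on_subset[OF g]\<close>)
  moreover have "at x within {0..x+1} = at x within {0..}"
    by (rule at_within_nhd[where S="{x-1<..<x+1}"]) (use x in auto)
  ultimately show ?thesis by simp
qed

text \<open>Integrating a function of growth exp (b y) gains a factor 1 / b; this is the source of
  the contraction in the weighted Picard iteration.\<close>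

lemma norm_integral_exp_bound:
  fixes g :: "real \<Rightarrow> 'a::euclidean_space"
  assumes g: "continuous_on {0..} g" and b: "b > 0" and D: "D \<ge> 0"
    and bd: "\<And>y. y \<ge> 0 \<Longrightarrow> norm (g y) \<le> D * exp (b * y)" and m: "m \<ge> 0"
  shows "norm (integral {0..m} g) \<le> D / b * exp (b * m)"
proof -
  have i: "((\<lambda>y. D * exp (b * y)) has_integral (D / b * exp (b * m) - D / b * exp (b * 0))) {0..m}"
    using m b
    by (intro fundamental_theorem_of_calculus)
       (auto intro!: derivative_eq_intros simp: has_real_derivative_iff_has_vector_derivative[symmetric])
  have "norm (integral {0..m} g) \<le> integral {0..m} (\<lambda>y. D * exp (b * y))"
    using bd i by (intro integral_norm_bound_integral)
       (auto intro!: integrable_continuous_interval continuous_intros intro: continuous_on_subset[OF g])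
  also have "\<dots> = D / b * exp (b * m) - D / b * exp (b * 0)"
    using i by (rule integral_unique)
  also have "\<dots> \<le> D / b * exp (b * m)" using b D by simp
  finally show ?thesis .
qed

text \<open>Picard iteration is a contraction on all of \<open>[0,\<infinity>)\<close> for the norm weighted by
  \<open>exp (- b x)\<close>, once \<open>b\<close> exceeds the Lipschitz constant.\<close>

lemma global_lipschitz_flow:
  fixes f :: "'a::euclidean_space \<Rightarrow> 'a"
  assumes lip: "L-lipschitz_on UNIV f" and f0: "f 0 = 0"
  shows "\<exists>w. w 0 = w0 \<and> (\<forall>x\<ge>0. (w has_vector_derivative f (w x)) (at x within {0..}))"
proof -
  have L: "L \<ge> 0" using lip by (rule lipschitz_on_nonneg)
  \<comment> \<open>The factor 2 makes the contraction constant L / b at most 1/2; the added 1 keeps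
    b positive when L = 0.\<close>
  define b where "b = 2 * L + 1"
  have b: "b > 0" "L / b \<le> 1/2" using L by (auto simp: b_def field_simps)
  have fd: "norm (f x - f y) \<le> L * norm (x - y)" for x y
    using lipschitz_onD[OF lip, of x y] by (simp add: dist_norm)
  have fn: "norm (f x) \<le> L * norm x" for x using fd[of x 0] f0 by simp
  have fc: "continuous_on UNIV f" using lip by (rule lipschitz_on_continuous_on)
  \<comment> \<open>The unknown v is the solution divided by exp (b x), so the weight is restored
    before f is applied.\<close>
  define g where "g v y = f (exp (b * y) *\<^sub>R apply_bcontfun v y)" for v and y :: real
  have gc: "continuous_on S (g v)" for v S
    unfolding g_def by (intro continuous_on_compose2[OF fc] continuous_intros) auto
  \<comment> \<open>Bounded continuous functions live on the whole line here; \<open>max 0 t\<close>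
    extends the iterate to t < 0 by its value at 0.\<close>
  define F where "F v t = exp (- b * max 0 t) *\<^sub>R (w0 + integral {0..max 0 t} (g v))" for v t
  have vb: "norm (apply_bcontfun v y) \<le> dist v (const_bcontfun 0)" for v :: "real \<Rightarrow>\<^sub>C 'a" and y
    using dist_bounded[of v y "const_bcontfun 0"] by (simp add: const_bcontfun.rep_eq)
  have Ib: "norm (integral {0..m} (g v)) \<le> (L * dist v (const_bcontfun 0)) / b * exp (b * m)"
    if "m \<ge> 0" for v m
  proof (rule norm_integral_exp_bound[OF gc b(1) _ _ that])
    show "0 \<le> L * dist v (const_bcontfun 0)" using L by simp
    fix y :: real
    have "norm (g v y) \<le> L * (exp (b * y) * norm (apply_bcontfun v y))"
      unfolding g_def using fn[of "exp (b * y) *\<^sub>R apply_bcontfun v y"] by simp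
    also have "\<dots> \<le> L * (exp (b * y) * dist v (const_bcontfun 0))"
      using L vb by (intro mult_left_mono) auto
    finally show "norm (g v y) \<le> L * dist v (const_bcontfun 0) * exp (b * y)"
      by (simp add: mult_ac)
  qed
  have Iv: "((\<lambda>x. integral {0..x} (g v)) has_vector_derivative g v x) (at x within {0..})"
    if "x \<ge> 0" for v x
    using gc that by (rule integral_from_0_has_vector_derivative)
  have Ic: "continuous_on {0..} (\<lambda>x. integral {0..x} (g v))" for v
    using Iv by (auto simp: continuous_on_eq_continuous_within
        intro!: has_derivative_continuous simp: has_vector_derivative_def)
  have FB: "F v \<in> bcontfun" for v
    unfolding bcontfun_def
  proof (intro CollectI conjI)
    have "continuous_on UNIV (\<lambda>t. integral {0..max 0 t} (g v))"
      by (rule continuous_on_compose2[OF Ic]) (auto intro!: continuous_intros)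
    then show "continuous_on UNIV (F v)"
      unfolding F_def by (intro continuous_intros)
    have "norm (F v t) \<le> norm w0 + L * dist v (const_bcontfun 0) / b" for t
    proof -
      let ?m = "max 0 t"
      have "norm (F v t) \<le> exp (- b * ?m) * (norm w0 + norm (integral {0..?m} (g v)))"
        unfolding F_def by (simp add: norm_triangle_ineq)
      also have "\<dots> \<le> exp (- b * ?m) * (norm w0 * exp (b * ?m) + (L * dist v (const_bcontfun 0)) / b * exp (b * ?m))"
        using Ib[of ?m v] b mult_left_mono[of 1 "exp (b * ?m)" "norm w0"]
        by (intro mult_left_mono add_mono) auto
      also have "\<dots> = norm w0 + L * dist v (const_bcontfun 0) / b"
        by (simp add: exp_minus field_simps)
      finally show ?thesis .
    qed
    then show "bounded (range (F v))" unfolding bounded_iff by blast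
  qed
  define T where "T v = Bcontfun (F v)" for v
  have Tv: "apply_bcontfun (T v) = F v" for v
    unfolding T_def using FB by (rule Bcontfun_inverse)
  have "dist (T u) (T v) \<le> 1/2 * dist u v" for u v
  proof (rule dist_bound)
    fix t :: real
    let ?m = "max 0 t"
    have "norm (integral {0..?m} (\<lambda>y. g u y - g v y)) \<le> (L * dist u v) / b * exp (b * ?m)"
    proof (rule norm_integral_exp_bound[OF _ b(1)])
      show "continuous_on {0..} (\<lambda>y. g u y - g v y)" by (intro continuous_intros gc)
      show "0 \<le> L * dist u v" using L by simp
      fix y :: real
      have "norm (g u y - g v y) \<le> L * (exp (b * y) * norm (apply_bcontfun u y - apply_bcontfun v y))"
        unfolding g_def using fd[of "exp (b * y) *\<^sub>R apply_bcontfun u y" "exp (b * y) *\<^sub>R apply_bcontfun v y"]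
        by (simp add: scaleR_diff_right[symmetric])
      also have "\<dots> \<le> L * (exp (b * y) * dist u v)"
        using L dist_bounded[of u y v] by (intro mult_left_mono) (auto simp: dist_norm)
      finally show "norm (g u y - g v y) \<le> L * dist u v * exp (b * y)" by (simp add: mult_ac)
    qed simp
    moreover have "integral {0..?m} (\<lambda>y. g u y - g v y) = integral {0..?m} (g u) - integral {0..?m} (g v)"
      by (intro integral_diff integrable_continuous_interval gc)
    moreover have "dist (F u t) (F v t) = exp (- b * ?m) * norm (integral {0..?m} (g u) - integral {0..?m} (g v))"
      unfolding F_def dist_norm by (simp add: scaleR_diff_right[symmetric])
    ultimately have "dist (F u t) (F v t) \<le> exp (- b * ?m) * ((L * dist u v) / b * exp (b * ?m))"
      by (metis mult_left_mono exp_ge_zero)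
    also have "\<dots> = (L / b) * dist u v" by (simp add: exp_minus field_simps)
    also have "\<dots> \<le> 1/2 * dist u v" using b by (intro mult_right_mono) auto
    finally show "dist (apply_bcontfun (T u) t) (apply_bcontfun (T v) t) \<le> 1/2 * dist u v"
      by (simp add: Tv)
  qed
  then have "\<exists>!v. T v = v" by (intro banach_fix_type[of "1/2"]) auto
  then obtain v where v: "T v = v" by blast
  define w where "w x = exp (b * x) *\<^sub>R apply_bcontfun v x" for x
  have w: "w x = w0 + integral {0..x} (g v)" if "x \<ge> 0" for x
  proof -
    have "w x = exp (b * x) *\<^sub>R F v x" unfolding w_def using v Tv by metis
    then show ?thesis using that by (simp add: F_def exp_minus)
  qed
  have "(w has_vector_derivative f (w x)) (at x within {0..})" if "x \<ge> 0" for x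
  proof -
    have "((\<lambda>x. w0 + integral {0..x} (g v)) has_vector_derivative g v x) (at x within {0..})"
      using has_vector_derivative_add[OF has_vector_derivative_const Iv[OF that, of v], of w0] by simp
    then have "(w has_vector_derivative g v x) (at x within {0..})"
      by (rule has_vector_derivative_transform[rotated 2]) (use that w in auto)
    then show ?thesis by (simp add: g_def w_def)
  qed
  moreover have "w 0 = w0" using w[of 0] by simp
  ultimately show ?thesis by blast
qed

text \<open>Compose f with the nearest-point projection onto the ball. The projection does not
  increase distances, so the composition is globally Lipschitz, and its flow solves the original
  equation wherever it is inside the ball.\<close>

lemma ball_lipschitz_flow:
  fixes f :: "'a::euclidean_space \<Rightarrow> 'a"
  assumes lip: "L-lipschitz_on (cball 0 R) f" and f0: "f 0 = 0" and R: "R > 0"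
  shows "\<exists>w. w 0 = w0 \<and> continuous_on {0..} w \<and>
    (\<forall>x\<ge>0. norm (w x) \<le> R \<longrightarrow> (w has_vector_derivative f (w x)) (at x within {0..}))"
proof -
  define p where "p = closest_point (cball (0::'a) R)"
  have p: "dist (p x) (p y) \<le> dist x y" for x y
    unfolding p_def by (rule closest_point_lipschitz) (use R in auto)
  have pin: "p x \<in> cball 0 R" for x
    unfolding p_def by (rule closest_point_in_set) (use R in auto)
  have pid: "p x = x" if "norm x \<le> R" for x
    unfolding p_def using that by (intro closest_point_self) auto
  have L: "L \<ge> 0" using lip by (rule lipschitz_on_nonneg)
  have "L-lipschitz_on UNIV (\<lambda>x. f (p x))"
  proof (rule lipschitz_onI[OF _ L])
    fix x y
    have "dist (f (p x)) (f (p y)) \<le> L * dist (p x) (p y)"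
      using lipschitz_onD[OF lip pin pin] .
    also have "\<dots> \<le> L * dist x y" using p L by (intro mult_left_mono)
    finally show "dist (f (p x)) (f (p y)) \<le> L * dist x y" .
  qed
  moreover have "f (p 0) = 0" using pid[of 0] f0 R by simp
  ultimately obtain w where w: "w 0 = w0"
    "\<And>x. x \<ge> 0 \<Longrightarrow> (w has_vector_derivative f (p (w x))) (at x within {0..})"
    using global_lipschitz_flow[of L "\<lambda>x. f (p x)" w0] by blast
  moreover have "continuous_on {0..} w"
    using w(2) by (auto simp: continuous_on_eq_continuous_within has_vector_derivative_def
        intro!: has_derivative_continuous)
  ultimately show ?thesis using pid by (metis (no_types, lifting))
qed

text \<open>At the first time at which \<phi> reaches R, the bound \<le> R holds up to that time,
  and \<open>step\<close> improves it to a strict one, a contradiction. This turns estimates that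
  are valid only while an orbit stays in a ball into estimates for all x \<ge> 0.\<close>

lemma trapping:
  fixes \<phi> :: "real \<Rightarrow> real"
  assumes c: "continuous_on {0..} \<phi>" and 0: "\<phi> 0 < R"
    and step: "\<And>T. T \<ge> 0 \<Longrightarrow> (\<And>x. 0 \<le> x \<Longrightarrow> x \<le> T \<Longrightarrow> \<phi> x \<le> R) \<Longrightarrow> \<phi> T < R"
    and x: "x \<ge> 0"
  shows "\<phi> x < R"
proof (rule ccontr)
  assume "\<not> \<phi> x < R"
  define S where "S = {0..x} \<inter> \<phi> -` {R..}"
  have xS: "x \<in> S" using \<open>\<not> \<phi> x < R\<close> x by (auto simp: S_def)
  have cl: "closed S" unfolding S_def
    by (rule continuous_closed_preimage) (auto intro: continuous_on_subset[OF c])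
  have bb: "bdd_below S" unfolding S_def by (auto intro: bdd_belowI[of _ 0])
  define t where "t = Inf S"
  have tS: "t \<in> S" unfolding t_def using cl bb xS by (intro closed_contains_Inf) auto
  have t0: "t \<ge> 0" "t \<le> x" "\<phi> t \<ge> R" using tS by (auto simp: S_def)
  have lt: "\<phi> y < R" if "0 \<le> y" "y < t" for y
  proof (rule ccontr)
    assume "\<not> \<phi> y < R"
    then have "y \<in> S" using that t0 by (auto simp: S_def)
    then show False using that bb unfolding t_def by (meson cInf_lower leD)
  qed
  have "\<phi> t \<le> R"
  proof (rule ccontr)
    assume n: "\<not> \<phi> t \<le> R"
    obtain y where "0 \<le> y" "y \<le> t" "\<phi> y = R"
      using IVT'[of \<phi> 0 R t] 0 n t0 continuous_on_subset[OF c, of "{0..t}"] by force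
    moreover from this n have "y < t" by (cases "y = t") auto
    ultimately show False using lt[of y] by simp
  qed
  then have "\<phi> y \<le> R" if "0 \<le> y" "y \<le> t" for y using lt[of y] that by (cases "y = t") auto
  then have "\<phi> t < R" using step t0 by blast
  then show False using t0 by simp
qed

section \<open>Differential inequalities for scalar functions\<close>

lemma nonincreasing_of_deriv:
  fixes E :: "real \<Rightarrow> real"
  assumes c: "continuous_on {s..t} E" and st: "s \<le> t"
    and d: "\<And>x. s < x \<Longrightarrow> x < t \<Longrightarrow> (E has_real_derivative E' x) (at x) \<and> E' x \<le> 0"
  shows "E t \<le> E s"
  using d c st by (intro DERIV_nonpos_imp_decreasing_open[of s t E]) auto

text \<open>\<open>exp (- k * x) * E x\<close> is nonincreasing. The derivative is required only
  inside the interval, since at x = 0 the orbits have only one-sided derivatives.\<close>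

lemma gronwall_decay:
  fixes E :: "real \<Rightarrow> real"
  assumes c: "continuous_on {s..t} E" and st: "s \<le> t"
    and d: "\<And>x. s < x \<Longrightarrow> x < t \<Longrightarrow> (E has_real_derivative E' x) (at x) \<and> E' x \<le> k * E x"
  shows "E t \<le> exp (k * (t - s)) * E s"
proof -
  have "exp (- k * t) * E t \<le> exp (- k * s) * E s"
  proof (rule nonincreasing_of_deriv[OF _ st])
    show "continuous_on {s..t} (\<lambda>x. exp (- k * x) * E x)" by (intro continuous_intros c)
    fix x assume x: "s < x" "x < t"
    show "((\<lambda>x. exp (- k * x) * E x) has_real_derivative exp (- k * x) * (E' x - k * E x)) (at x)
      \<and> exp (- k * x) * (E' x - k * E x) \<le> 0"
      using d[OF x] by (auto intro!: derivative_eq_intros mult_nonneg_nonpos simp: algebra_simps)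
  qed
  then have "exp (k * t) * (exp (- k * t) * E t) \<le> exp (k * t) * (exp (- k * s) * E s)"
    by (intro mult_left_mono) auto
  then show ?thesis by (simp add: exp_minus exp_diff right_diff_distrib field_simps)
qed

text \<open>Apply the exponential bound to V^2, whose derivative is at most 2 K V^2.\<close>

lemma zero_of_gronwall:
  fixes V :: "real \<Rightarrow> real"
  assumes c: "continuous_on {s..t} V" and st: "s \<le> t" and 0: "V s = 0"
    and d: "\<And>x. s < x \<Longrightarrow> x < t \<Longrightarrow> (V has_real_derivative V' x) (at x) \<and> \<bar>V' x\<bar> \<le> K * \<bar>V x\<bar>"
  shows "V t = 0"
proof -
  have "(V t)\<^sup>2 \<le> exp (2 * K * (t - s)) * (V s)\<^sup>2"
  proof (rule gronwall_decay[OF _ st])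
    show "continuous_on {s..t} (\<lambda>x. (V x)\<^sup>2)" by (intro continuous_intros c)
    fix x assume x: "s < x" "x < t"
    have "2 * V x * V' x \<le> 2 * \<bar>V x\<bar> * \<bar>V' x\<bar>"
      by (metis abs_ge_self abs_mult abs_numeral)
    also have "\<dots> \<le> 2 * \<bar>V x\<bar> * (K * \<bar>V x\<bar>)" using d[OF x] by (intro mult_left_mono) auto
    also have "\<dots> = 2 * K * (V x)\<^sup>2" by (simp add: power2_eq_square)
    finally show "((\<lambda>x. (V x)\<^sup>2) has_real_derivative 2 * V x * V' x) (at x) \<and> 2 * V x * V' x \<le> 2 * K * (V x)\<^sup>2"
      using d[OF x] by (auto intro!: derivative_eq_intros)
  qed
  then show ?thesis using 0 by simp
qed

text \<open>If V' = O(V), then V cannot cross 0: a negative value at t would be preceded by a zero,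
  and from there on V would be 0. This keeps transonic orbits on one side of the graph.\<close>

lemma nonneg_of_gronwall:
  fixes V :: "real \<Rightarrow> real"
  assumes c: "continuous_on {s..t} V" and st: "s \<le> t" and 0: "V s \<ge> 0"
    and d: "\<And>x. s < x \<Longrightarrow> x < t \<Longrightarrow> (V has_real_derivative V' x) (at x) \<and> \<bar>V' x\<bar> \<le> K * \<bar>V x\<bar>"
  shows "V t \<ge> 0"
proof (rule ccontr)
  assume n: "\<not> V t \<ge> 0"
  obtain y where y: "s \<le> y" "y \<le> t" "V y = 0"
    using IVT2'[of V t 0 s] n 0 st c by force
  have "V t = 0"
    by (rule zero_of_gronwall[OF continuous_on_subset[OF c] y(2,3), of V' K]) (use y d in auto)
  then show False using n by simp
qed

section \<open>Regular singular equations\<close>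


text \<open>On [0, t] the weight \<open>s powr m\<close> is largest at t, so the prefactor cancels
  it and the length t of the interval remains. On a short interval this t is the smallness that
  makes the fixed point map contract.\<close>

lemma weighted_integral_bound:
  fixes f :: "real \<Rightarrow> real"
  assumes f: "continuous_on {0..} f" and t: "t \<ge> 0" and m: "m \<ge> 0" and D: "D \<ge> 0"
    and bd: "\<And>s. 0 \<le> s \<Longrightarrow> s \<le> t \<Longrightarrow> \<bar>f s\<bar> \<le> D * s powr m"
  shows "\<bar>t powr (- m) * integral {0..t} f\<bar> \<le> D * t"
proof (cases "t = 0")
  case False
  then have t: "t > 0" using t by simp
  have "norm (integral {0..t} f) \<le> (D * t powr m) * (t - 0)"
  proof (rule integral_bound)
    fix s assume s: "s \<in> {0..t}"
    then have "\<bar>f s\<bar> \<le> D * s powr m" using bd by simp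
    also have "\<dots> \<le> D * t powr m" using s D m by (intro mult_left_mono powr_mono2) auto
    finally show "norm (f s) \<le> D * t powr m" by simp
  qed (use t in \<open>auto intro: continuous_on_subset[OF f]\<close>)
  then have "t powr (- m) * \<bar>integral {0..t} f\<bar> \<le> t powr (- m) * (D * t powr m * t)"
    by (intro mult_left_mono) auto
  also have "\<dots> = D * t" using t by (simp add: powr_minus field_simps)
  finally show ?thesis by (simp add: abs_mult)
qed simp

text \<open>Multiplying \<open>t k' + m k = t G(k, t)\<close> by \<open>t powr (m - 1)\<close> turns the regular singular
  equation into the fixed point equation \<open>k t = t powr (- m) * \<integral>\<^sub>0\<^sup>t s powr m * G (k s) s ds\<close>.\<close>

lemma regular_singular_ode:
  fixes G :: "real \<Rightarrow> real \<Rightarrow> real"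
  assumes m: "m > 0" and B: "B \<ge> 0" and r: "0 < r" "B * r \<le> 1 / 2"
    and Gc: "continuous_on ({-1..1} \<times> {0..r}) (\<lambda>(x, t). G x t)"
    and Gb: "\<And>x t. \<bar>x\<bar> \<le> 1 \<Longrightarrow> 0 \<le> t \<Longrightarrow> t \<le> r \<Longrightarrow> \<bar>G x t\<bar> \<le> B"
    and Gl: "\<And>x y t. \<bar>x\<bar> \<le> 1 \<Longrightarrow> \<bar>y\<bar> \<le> 1 \<Longrightarrow> 0 \<le> t \<Longrightarrow> t \<le> r \<Longrightarrow> \<bar>G x t - G y t\<bar> \<le> B * \<bar>x - y\<bar>"
  shows "\<exists>k. continuous_on {0..r} k \<and> (\<forall>t. 0 \<le> t \<longrightarrow> t \<le> r \<longrightarrow> \<bar>k t\<bar> \<le> B * t) \<and>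
    (\<forall>t. 0 < t \<longrightarrow> t < r \<longrightarrow> (k has_real_derivative G (k t) t - m * k t / t) (at t))"
proof -
  \<comment> \<open>The fixed point is sought among all bounded continuous functions on the line, so
    both arguments of G are clamped to the region where its bounds hold.\<close>
  define cl where "cl t = max 0 (min r t)" for t
  define cx :: "real \<Rightarrow> real" where "cx x = max (-1) (min 1 x)" for x
  have cl: "0 \<le> cl t" "cl t \<le> r" for t using r by (auto simp: cl_def)
  have cx: "\<bar>cx x\<bar> \<le> 1" "\<bar>cx x - cx y\<bar> \<le> \<bar>x - y\<bar>" for x y by (auto simp: cx_def)
  define g where "g v s = s powr m * G (cx (apply_bcontfun v s)) (cl s)" for v :: "real \<Rightarrow>\<^sub>C real" and s
  have gc: "continuous_on {0..} (g v)" for v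
  proof -
    have "continuous_on {0..} (\<lambda>s. (\<lambda>(x, t). G x t) (cx (apply_bcontfun v s), cl s))"
      by (rule continuous_on_compose2[OF Gc])
         (use cl cx(1) in \<open>auto simp: cx_def cl_def intro!: continuous_intros\<close>)
    then have 1: "continuous_on {0..} (\<lambda>s. G (cx (apply_bcontfun v s)) (cl s))" by simp
    have 2: "continuous_on {0..} (\<lambda>s::real. s powr m)"
      using m by (intro continuous_on_powr') (auto intro!: continuous_intros)
    show ?thesis unfolding g_def by (intro continuous_on_mult 1 2)
  qed
  define H where "H v t = t powr (- m) * integral {0..t} (g v)" for v t
  have gb: "\<bar>g v s\<bar> \<le> B * s powr m" if "s \<ge> 0" for v s
    using mult_right_mono[OF Gb[OF cx(1) cl, of "apply_bcontfun v s" s], of "s powr m"]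
    by (simp add: g_def abs_mult mult.commute)
  have Hb: "\<bar>H v t\<bar> \<le> B * t" if "t \<ge> 0" for v t
    unfolding H_def using that m B gb by (intro weighted_integral_bound gc) auto
  have Hd: "(H v has_real_derivative (g v t * t powr (- m) - m * H v t / t)) (at t)" if t: "t > 0" for v t
  proof -
    have "((\<lambda>t. integral {0..t} (g v)) has_real_derivative g v t) (at t within {0..})"
      using integral_from_0_has_vector_derivative[OF gc] t
      by (simp add: has_real_derivative_iff_has_vector_derivative)
    moreover have "at t within {0..} = at t" using t by (intro at_within_interior) auto
    ultimately have 1: "((\<lambda>t. integral {0..t} (g v)) has_real_derivative g v t) (at t)" by simp
    have 2: "((\<lambda>t. t powr (- m)) has_real_derivative - m * t powr (- m) / t) (at t)"
      using t by (auto intro!: derivative_eq_intros simp: powr_diff)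
    show ?thesis unfolding H_def
      using DERIV_mult[OF 2 1] by (rule DERIV_cong) (simp add: H_def field_simps)
  qed
  \<comment> \<open>Away from 0 this is differentiability. At 0 the factor
    \<open>t powr (- m)\<close> is singular, and continuity comes from
    \<open>\<bar>H v t\<bar> \<le> B * t\<close>.\<close>
  have Hc: "continuous_on {0..} (H v)" for v
    unfolding continuous_on_eq_continuous_within
  proof
    fix t :: real assume "t \<in> {0..}"
    show "continuous (at t within {0..}) (H v)"
    proof (cases "t = 0")
      case True
      have "((\<lambda>t. B * t) \<longlongrightarrow> B * 0) (at 0 within {0..})" by (intro tendsto_intros)
      moreover have "\<forall>\<^sub>F t in at 0 within {0..}. norm (H v t) \<le> B * t"
        by (auto simp: eventually_at intro!: exI[of _ 1] Hb)
      ultimately have "(H v \<longlongrightarrow> 0) (at 0 within {0..})"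
        by (simp add: Lim_null_comparison[where f="H v" and g="\<lambda>t. B * t"])
      then show ?thesis using True m by (simp add: continuous_within H_def)
    next
      case False
      then show ?thesis using Hd[of t v] \<open>t \<in> {0..}\<close>
        by (auto intro: continuous_at_imp_continuous_at_within DERIV_isCont)
    qed
  qed
  have clc: "continuous_on UNIV cl" unfolding cl_def by (intro continuous_intros)
  have FB: "(\<lambda>t. H v (cl t)) \<in> bcontfun" for v
    unfolding bcontfun_def
  proof (intro CollectI conjI)
    show "continuous_on UNIV (\<lambda>t. H v (cl t))"
      by (rule continuous_on_compose2[OF Hc clc]) (use cl in auto)
    have "\<bar>H v (cl t)\<bar> \<le> B * r" for t
      using Hb[OF cl(1)[of t], of v] mult_left_mono[OF cl(2)[of t] B] by simp
    then show "bounded (range (\<lambda>t. H v (cl t)))" unfolding bounded_iff by auto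
  qed
  define T where "T v = Bcontfun (\<lambda>t. H v (cl t))" for v
  have Tv: "apply_bcontfun (T v) t = H v (cl t)" for v t
    unfolding T_def using Bcontfun_inverse[OF FB] by simp
  have "dist (T u) (T v) \<le> 1/2 * dist u v" for u v
  proof (rule dist_bound)
    fix t :: real
    have "\<bar>cl t powr (- m) * integral {0..cl t} (\<lambda>s. g u s - g v s)\<bar> \<le> (B * dist u v) * cl t"
    proof (rule weighted_integral_bound)
      show "continuous_on {0..} (\<lambda>s. g u s - g v s)" by (intro continuous_intros gc)
      fix s :: real
      have "\<bar>g u s - g v s\<bar> = s powr m * \<bar>G (cx (apply_bcontfun u s)) (cl s) - G (cx (apply_bcontfun v s)) (cl s)\<bar>"
        unfolding g_def by (simp add: abs_mult right_diff_distrib[symmetric])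
      also have "\<dots> \<le> s powr m * (B * \<bar>cx (apply_bcontfun u s) - cx (apply_bcontfun v s)\<bar>)"
        by (intro mult_left_mono Gl cx cl) auto
      also have "\<dots> \<le> s powr m * (B * dist u v)"
        using cx(2)[of "apply_bcontfun u s" "apply_bcontfun v s"] dist_bounded[of u s v] B
        by (intro mult_left_mono) (auto simp: dist_real_def)
      finally show "\<bar>g u s - g v s\<bar> \<le> B * dist u v * s powr m" by (simp add: mult_ac)
    qed (use cl m B in auto)
    moreover have "integral {0..cl t} (\<lambda>s. g u s - g v s) = integral {0..cl t} (g u) - integral {0..cl t} (g v)"
      by (intro integral_diff integrable_continuous_interval continuous_on_subset[OF gc]) auto
    ultimately have "dist (T u t) (T v t) \<le> (B * dist u v) * cl t"
      by (simp add: Tv H_def dist_real_def right_diff_distrib)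
    also have "\<dots> \<le> (B * dist u v) * r" using B cl by (intro mult_left_mono) auto
    also have "\<dots> = (B * r) * dist u v" by simp
    also have "\<dots> \<le> 1/2 * dist u v" using r by (intro mult_right_mono) auto
    finally show "dist (T u t) (T v t) \<le> 1/2 * dist u v" .
  qed
  then have "\<exists>!v. T v = v" by (intro banach_fix_type[of "1/2"]) auto
  then obtain v where v: "T v = v" by blast
  have vH: "apply_bcontfun v t = H v t" if "0 \<le> t" "t \<le> r" for t
    using Tv[of v t] that by (simp add: v cl_def)
  have "continuous_on {0..r} (apply_bcontfun v)" by simp
  moreover have vb: "\<bar>apply_bcontfun v t\<bar> \<le> B * t" if "0 \<le> t" "t \<le> r" for t
    using Hb[of t v] vH that by simp
  moreover have "(apply_bcontfun v has_real_derivative G (v t) t - m * v t / t) (at t)" if t: "0 < t" "t < r" for t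
  proof -
    \<comment> \<open>B r \<le> 1/2 keeps the fixed point inside [-1, 1], so the clamps do not act
      on it and the equation holds with G itself.\<close>
    have "\<bar>v t\<bar> \<le> 1" using vb[of t] t r mult_left_mono[of t r B] B by simp
    then have "cx (v t) = v t" "cl t = t" using t by (auto simp: cx_def cl_def)
    then have "g v t * t powr (- m) = G (v t) t"
      using t by (simp add: g_def powr_minus)
    then have "(H v has_real_derivative G (v t) t - m * v t / t) (at t)"
      using Hd[of t v] t vH[of t] by simp
    then show ?thesis
      by (rule has_field_derivative_transform_within_open[where S="{0<..<r}"]) (use t vH in auto)
  qed
  ultimately show ?thesis by blast
qed

section \<open>Lipschitz estimates for the nonlinearity\<close>


text \<open>These are the two estimates that \<open>regular_singular_ode\<close> asks of G, as a
  class closed under sums, products and inverses. A composite G can then be checked by its syntactic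
  structure.\<close>

definition bounded_lipschitz :: "real set \<Rightarrow> (real \<Rightarrow> real \<Rightarrow> real) \<Rightarrow> bool" where
  "bounded_lipschitz S f \<longleftrightarrow> (\<exists>B. \<forall>t\<in>S. \<forall>x y. \<bar>x\<bar> \<le> 1 \<longrightarrow> \<bar>y\<bar> \<le> 1 \<longrightarrow>
     \<bar>f x t\<bar> \<le> B \<and> \<bar>f x t - f y t\<bar> \<le> B * \<bar>x - y\<bar>)"

lemma bounded_lipschitzI:
  assumes "\<And>t x y. t \<in> S \<Longrightarrow> \<bar>x\<bar> \<le> 1 \<Longrightarrow> \<bar>y\<bar> \<le> 1 \<Longrightarrow> \<bar>f x t\<bar> \<le> B \<and> \<bar>f x t - f y t\<bar> \<le> C * \<bar>x - y\<bar>"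
  shows "bounded_lipschitz S f"
  unfolding bounded_lipschitz_def
proof (intro exI[of _ "max B C"] ballI allI impI)
  fix t x y :: real assume a: "t \<in> S" "\<bar>x\<bar> \<le> 1" "\<bar>y\<bar> \<le> 1"
  have "C * \<bar>x - y\<bar> \<le> max B C * \<bar>x - y\<bar>" by (intro mult_right_mono) auto
  then show "\<bar>f x t\<bar> \<le> max B C \<and> \<bar>f x t - f y t\<bar> \<le> max B C * \<bar>x - y\<bar>"
    using assms[OF a] by linarith
qed

lemma bounded_lipschitzE:
  assumes "bounded_lipschitz S f"
  obtains B where "B \<ge> 0"
    "\<And>t x. t \<in> S \<Longrightarrow> \<bar>x\<bar> \<le> 1 \<Longrightarrow> \<bar>f x t\<bar> \<le> B"
    "\<And>t x y. t \<in> S \<Longrightarrow> \<bar>x\<bar> \<le> 1 \<Longrightarrow> \<bar>y\<bar> \<le> 1 \<Longrightarrow> \<bar>f x t - f y t\<bar> \<le> B * \<bar>x - y\<bar>"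
proof -
  from assms obtain B where B: "\<forall>t\<in>S. \<forall>x y. \<bar>x\<bar> \<le> 1 \<longrightarrow> \<bar>y\<bar> \<le> 1 \<longrightarrow>
     \<bar>f x t\<bar> \<le> B \<and> \<bar>f x t - f y t\<bar> \<le> B * \<bar>x - y\<bar>"
    unfolding bounded_lipschitz_def by blast
  show thesis
  proof (rule that[of "\<bar>B\<bar>"])
    fix t x y :: real assume a: "t \<in> S" "\<bar>x\<bar> \<le> 1"
    then have "\<bar>f x t\<bar> \<le> B" using B by blast
    then show "\<bar>f x t\<bar> \<le> \<bar>B\<bar>" by linarith
    assume "\<bar>y\<bar> \<le> 1"
    then have "\<bar>f x t - f y t\<bar> \<le> B * \<bar>x - y\<bar>" using B a by blast
    also have "\<dots> \<le> \<bar>B\<bar> * \<bar>x - y\<bar>" by (intro mult_right_mono) auto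
    finally show "\<bar>f x t - f y t\<bar> \<le> \<bar>B\<bar> * \<bar>x - y\<bar>" .
  qed simp
qed

lemma bounded_lipschitz_const: "bounded_lipschitz S (\<lambda>x t. c)"
  by (rule bounded_lipschitzI[of _ _ "\<bar>c\<bar>" 0]) auto

lemma bounded_lipschitz_fst: "bounded_lipschitz S (\<lambda>x t. x)"
  by (rule bounded_lipschitzI[of _ _ 1 1]) auto

lemma bounded_lipschitz_snd:
  assumes "\<And>t. t \<in> S \<Longrightarrow> \<bar>t\<bar> \<le> r"
  shows "bounded_lipschitz S (\<lambda>x t. t)"
  by (rule bounded_lipschitzI[of _ _ r 0]) (use assms in auto)

lemma bounded_lipschitz_add:
  assumes "bounded_lipschitz S f" "bounded_lipschitz S g"
  shows "bounded_lipschitz S (\<lambda>x t. f x t + g x t)"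
proof -
  obtain B where B: "B \<ge> 0" "\<And>t x. t \<in> S \<Longrightarrow> \<bar>x\<bar> \<le> 1 \<Longrightarrow> \<bar>f x t\<bar> \<le> B"
    "\<And>t x y. t \<in> S \<Longrightarrow> \<bar>x\<bar> \<le> 1 \<Longrightarrow> \<bar>y\<bar> \<le> 1 \<Longrightarrow> \<bar>f x t - f y t\<bar> \<le> B * \<bar>x - y\<bar>"
    using assms(1) by (rule bounded_lipschitzE) blast
  obtain C where C: "C \<ge> 0" "\<And>t x. t \<in> S \<Longrightarrow> \<bar>x\<bar> \<le> 1 \<Longrightarrow> \<bar>g x t\<bar> \<le> C"
    "\<And>t x y. t \<in> S \<Longrightarrow> \<bar>x\<bar> \<le> 1 \<Longrightarrow> \<bar>y\<bar> \<le> 1 \<Longrightarrow> \<bar>g x t - g y t\<bar> \<le> C * \<bar>x - y\<bar>"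
    using assms(2) by (rule bounded_lipschitzE) blast
  show ?thesis
  proof (rule bounded_lipschitzI[of _ _ "B + C" "B + C"], rule conjI)
    fix t x y :: real assume a: "t \<in> S" "\<bar>x\<bar> \<le> 1" "\<bar>y\<bar> \<le> 1"
    show "\<bar>f x t + g x t\<bar> \<le> B + C" using B(2)[OF a(1,2)] C(2)[OF a(1,2)] by linarith
    show "\<bar>f x t + g x t - (f y t + g y t)\<bar> \<le> (B + C) * \<bar>x - y\<bar>"
      using B(3)[OF a] C(3)[OF a] unfolding distrib_right by linarith
  qed
qed

lemma bounded_lipschitz_mult:
  assumes "bounded_lipschitz S f" "bounded_lipschitz S g"
  shows "bounded_lipschitz S (\<lambda>x t. f x t * g x t)"
proof -
  obtain B where B: "B \<ge> 0" "\<And>t x. t \<in> S \<Longrightarrow> \<bar>x\<bar> \<le> 1 \<Longrightarrow> \<bar>f x t\<bar> \<le> B"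
    "\<And>t x y. t \<in> S \<Longrightarrow> \<bar>x\<bar> \<le> 1 \<Longrightarrow> \<bar>y\<bar> \<le> 1 \<Longrightarrow> \<bar>f x t - f y t\<bar> \<le> B * \<bar>x - y\<bar>"
    using assms(1) by (rule bounded_lipschitzE) blast
  obtain C where C: "C \<ge> 0" "\<And>t x. t \<in> S \<Longrightarrow> \<bar>x\<bar> \<le> 1 \<Longrightarrow> \<bar>g x t\<bar> \<le> C"
    "\<And>t x y. t \<in> S \<Longrightarrow> \<bar>x\<bar> \<le> 1 \<Longrightarrow> \<bar>y\<bar> \<le> 1 \<Longrightarrow> \<bar>g x t - g y t\<bar> \<le> C * \<bar>x - y\<bar>"
    using assms(2) by (rule bounded_lipschitzE) blast
  show ?thesis
  proof (rule bounded_lipschitzI[of _ _ "B * C" "2 * B * C"], rule conjI)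
    fix t x y :: real assume a: "t \<in> S" "\<bar>x\<bar> \<le> 1" "\<bar>y\<bar> \<le> 1"
    show "\<bar>f x t * g x t\<bar> \<le> B * C" unfolding abs_mult
      using B(2)[OF a(1,2)] C(2)[OF a(1,2)] B(1) by (intro mult_mono) auto
    have 1: "\<bar>f x t * (g x t - g y t)\<bar> \<le> B * (C * \<bar>x - y\<bar>)" unfolding abs_mult
      using B(2)[OF a(1,2)] C(3)[OF a] B(1) by (intro mult_mono) auto
    have 2: "\<bar>(f x t - f y t) * g y t\<bar> \<le> (B * \<bar>x - y\<bar>) * C" unfolding abs_mult
      using C(2)[OF a(1,3)] B(3)[OF a] B(1) by (intro mult_mono) auto
    have "f x t * g x t - f y t * g y t = f x t * (g x t - g y t) + (f x t - f y t) * g y t"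
      by (simp add: algebra_simps)
    then have "\<bar>f x t * g x t - f y t * g y t\<bar> \<le> B * (C * \<bar>x - y\<bar>) + (B * \<bar>x - y\<bar>) * C"
      using 1 2 by linarith
    then show "\<bar>f x t * g x t - f y t * g y t\<bar> \<le> 2 * B * C * \<bar>x - y\<bar>"
      by (simp add: algebra_simps)
  qed
qed

lemma bounded_lipschitz_inverse:
  assumes "bounded_lipschitz S f" and d: "d > 0"
    and f: "\<And>x t. t \<in> S \<Longrightarrow> \<bar>x\<bar> \<le> 1 \<Longrightarrow> \<bar>f x t\<bar> \<ge> d"
  shows "bounded_lipschitz S (\<lambda>x t. inverse (f x t))"
proof -
  obtain B where B: "B \<ge> 0" 
    "\<And>t x y. t \<in> S \<Longrightarrow> \<bar>x\<bar> \<le> 1 \<Longrightarrow> \<bar>y\<bar> \<le> 1 \<Longrightarrow> \<bar>f x t - f y t\<bar> \<le> B * \<bar>x - y\<bar>"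
    using assms(1) by (rule bounded_lipschitzE) blast
  show ?thesis
  proof (rule bounded_lipschitzI[of _ _ "inverse d" "inverse d * B * inverse d"], rule conjI)
    fix t x y :: real assume a: "t \<in> S" "\<bar>x\<bar> \<le> 1" "\<bar>y\<bar> \<le> 1"
    have i: "\<bar>inverse (f x t)\<bar> \<le> inverse d" "\<bar>inverse (f y t)\<bar> \<le> inverse d"
      using f[OF a(1,2)] f[OF a(1,3)] d by (auto simp: abs_inverse intro!: le_imp_inverse_le)
    then show "\<bar>inverse (f x t)\<bar> \<le> inverse d" by simp
    have "f x t \<noteq> 0" "f y t \<noteq> 0" using f[OF a(1,2)] f[OF a(1,3)] d by auto
    then have "\<bar>inverse (f x t) - inverse (f y t)\<bar> = \<bar>inverse (f x t)\<bar> * \<bar>f x t - f y t\<bar> * \<bar>inverse (f y t)\<bar>"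
      by (simp add: inverse_diff_inverse abs_mult abs_minus_commute)
    also have "\<dots> \<le> inverse d * (B * \<bar>x - y\<bar>) * inverse d"
      using i B(2)[OF a] B(1) d by (intro mult_mono) auto
    finally show "\<bar>inverse (f x t) - inverse (f y t)\<bar> \<le> inverse d * B * inverse d * \<bar>x - y\<bar>"
      by (simp add: mult_ac)
  qed
qed

lemmas bounded_lipschitz_intros =
  bounded_lipschitz_const bounded_lipschitz_fst bounded_lipschitz_add bounded_lipschitz_mult

text \<open>The common shape of all nonlinear terms. With x = u + 1 and s = (u + 1) + (\<theta> -
  1), the first summand is the nonlinearity of the velocity equation and the second that of the
  temperature equation; a linear change of unknowns only mixes A and B.\<close>

definition quad :: "real \<Rightarrow> real \<Rightarrow> real \<Rightarrow> real \<Rightarrow> real" where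
  "quad A B x s = A * (x * s / (1 - x)) + B * x\<^sup>2"

text \<open>The function vanishes to second order at the origin, which is why its Lipschitz constant
  on a box of size e is O(e). Over the common denominator, which is at least 1/4, the numerator is
  bounded with constant 3/2, and (3/2) / (1/4) = 6.\<close>

lemma frac_lipschitz:
  fixes x y s t e :: real
  assumes e: "e \<le> 1/2" and b: "\<bar>x\<bar> \<le> e" "\<bar>y\<bar> \<le> e" "\<bar>s\<bar> \<le> e" "\<bar>t\<bar> \<le> e"
  shows "\<bar>x * s / (1 - x) - y * t / (1 - y)\<bar> \<le> 6 * e * (\<bar>x - y\<bar> + \<bar>s - t\<bar>)"
proof -
  have e0: "e \<ge> 0" using b by linarith
  have d: "1 - x \<ge> 1/2" "1 - y \<ge> 1/2" using e b by linarith+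
  have dd: "(1 - x) * (1 - y) \<ge> 1/2 * (1/2)" using d by (intro mult_mono) auto
  have eq: "x * s / (1 - x) - y * t / (1 - y) = ((x - y) * s + y * (s - t) - x * y * (s - t)) / ((1 - x) * (1 - y))"
    using d by (simp add: field_simps)
  have "\<bar>(x - y) * s + y * (s - t) - x * y * (s - t)\<bar> \<le> \<bar>x - y\<bar> * \<bar>s\<bar> + \<bar>y\<bar> * \<bar>s - t\<bar> + \<bar>x\<bar> * \<bar>y\<bar> * \<bar>s - t\<bar>"
    unfolding abs_mult[symmetric] by linarith
  also have "\<dots> \<le> \<bar>x - y\<bar> * e + e * \<bar>s - t\<bar> + (1/2) * e * \<bar>s - t\<bar>"
    using b e e0 by (intro add_mono mult_mono) auto
  also have "\<dots> \<le> 3/2 * e * (\<bar>x - y\<bar> + \<bar>s - t\<bar>)"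
    using mult_nonneg_nonneg[OF e0, of "\<bar>x - y\<bar>"] by (simp add: algebra_simps)
  finally have n: "\<bar>(x - y) * s + y * (s - t) - x * y * (s - t)\<bar> \<le> 3/2 * e * (\<bar>x - y\<bar> + \<bar>s - t\<bar>)" .
  have "\<bar>x * s / (1 - x) - y * t / (1 - y)\<bar> \<le> (3/2 * e * (\<bar>x - y\<bar> + \<bar>s - t\<bar>)) / (1/4)"
    unfolding eq abs_divide using n dd e0 by (intro frac_le) auto
  then show ?thesis by simp
qed

lemma quad_lipschitz:
  assumes e: "e \<le> 1/2" and b: "\<bar>x\<bar> \<le> e" "\<bar>y\<bar> \<le> e" "\<bar>s\<bar> \<le> e" "\<bar>t\<bar> \<le> e"
  shows "\<bar>quad A B x s - quad A B y t\<bar> \<le> 6 * (\<bar>A\<bar> + \<bar>B\<bar>) * e * (\<bar>x - y\<bar> + \<bar>s - t\<bar>)"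
proof -
  have e0: "e \<ge> 0" using b by linarith
  have sq: "\<bar>x\<^sup>2 - y\<^sup>2\<bar> \<le> 6 * e * (\<bar>x - y\<bar> + \<bar>s - t\<bar>)"
  proof -
    have "\<bar>x\<^sup>2 - y\<^sup>2\<bar> = \<bar>x + y\<bar> * \<bar>x - y\<bar>" by (simp add: abs_mult[symmetric] power2_eq_square algebra_simps)
    also have "\<dots> \<le> (6 * e) * (\<bar>x - y\<bar> + \<bar>s - t\<bar>)" using b by (intro mult_mono) auto
    finally show ?thesis .
  qed
  have "\<bar>quad A B x s - quad A B y t\<bar> = \<bar>A * (x * s / (1 - x) - y * t / (1 - y)) + B * (x\<^sup>2 - y\<^sup>2)\<bar>"
    unfolding quad_def by (simp add: right_diff_distrib)
  also have "\<dots> \<le> \<bar>A\<bar> * \<bar>x * s / (1 - x) - y * t / (1 - y)\<bar> + \<bar>B\<bar> * \<bar>x\<^sup>2 - y\<^sup>2\<bar>"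
    unfolding abs_mult[symmetric] by (rule abs_triangle_ineq)
  also have "\<dots> \<le> \<bar>A\<bar> * (6 * e * (\<bar>x - y\<bar> + \<bar>s - t\<bar>)) + \<bar>B\<bar> * (6 * e * (\<bar>x - y\<bar> + \<bar>s - t\<bar>))"
    by (intro add_mono mult_left_mono sq frac_lipschitz[OF e b]) auto
  finally show ?thesis by (simp add: algebra_simps)
qed

text \<open>This is the remainder of x s / (1 - x) after its quadratic part x s. One more order of
  vanishing gives one more factor e, as needed in \<open>center_estimate\<close>, where quadratic
  terms must be kept exactly.\<close>

lemma cubic_lipschitz:
  fixes x y s t e :: real
  assumes e: "e \<le> 1/2" and b: "\<bar>x\<bar> \<le> e" "\<bar>y\<bar> \<le> e" "\<bar>s\<bar> \<le> e" "\<bar>t\<bar> \<le> e"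
  shows "\<bar>x\<^sup>2 * s / (1 - x) - y\<^sup>2 * t / (1 - y)\<bar> \<le> 12 * e\<^sup>2 * (\<bar>x - y\<bar> + \<bar>s - t\<bar>)"
proof -
  have e0: "e \<ge> 0" using b by linarith
  have 1: "\<bar>x * s / (1 - x)\<bar> \<le> 2 * e\<^sup>2"
  proof -
    have "\<bar>x\<bar> * \<bar>s\<bar> / (1 - x) \<le> e * e / (1/2)" using b e by (intro frac_le mult_mono) auto
    then show ?thesis using b e by (simp add: abs_mult power2_eq_square)
  qed
  have "x\<^sup>2 * s / (1 - x) - y\<^sup>2 * t / (1 - y) = (x - y) * (x * s / (1 - x)) + y * (x * s / (1 - x) - y * t / (1 - y))"
    by (simp add: power2_eq_square right_diff_distrib left_diff_distrib diff_divide_distrib mult.assoc)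
  also have "\<bar>\<dots>\<bar> \<le> \<bar>x - y\<bar> * \<bar>x * s / (1 - x)\<bar> + \<bar>y\<bar> * \<bar>x * s / (1 - x) - y * t / (1 - y)\<bar>"
    unfolding abs_mult[symmetric] by (rule abs_triangle_ineq)
  also have "\<dots> \<le> (\<bar>x - y\<bar> + \<bar>s - t\<bar>) * (2 * e\<^sup>2) + e * (6 * e * (\<bar>x - y\<bar> + \<bar>s - t\<bar>))"
  proof (rule add_mono)
    show "\<bar>x - y\<bar> * \<bar>x * s / (1 - x)\<bar> \<le> (\<bar>x - y\<bar> + \<bar>s - t\<bar>) * (2 * e\<^sup>2)"
      by (rule mult_mono[OF _ 1]) auto
    show "\<bar>y\<bar> * \<bar>x * s / (1 - x) - y * t / (1 - y)\<bar> \<le> e * (6 * e * (\<bar>x - y\<bar> + \<bar>s - t\<bar>))"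
      by (rule mult_mono[OF b(2) frac_lipschitz[OF e b]]) (use e0 in auto)
  qed
  also have "\<dots> \<le> 12 * e\<^sup>2 * (\<bar>x - y\<bar> + \<bar>s - t\<bar>)"
  proof -
    have "e\<^sup>2 * (\<bar>x - y\<bar> + \<bar>s - t\<bar>) \<ge> 0" by simp
    then show ?thesis by (simp add: power2_eq_square algebra_simps)
  qed
  finally show ?thesis .
qed

section \<open>The stable manifold as an invariant graph\<close>


lemma abs_lin_le:
  fixes p q U T e :: real
  assumes "\<bar>U\<bar> \<le> e" "\<bar>T\<bar> \<le> e"
  shows "\<bar>p * U + q * T\<bar> \<le> (\<bar>p\<bar> + \<bar>q\<bar>) * e"
proof -
  have "\<bar>p * U + q * T\<bar> \<le> \<bar>p\<bar> * \<bar>U\<bar> + \<bar>q\<bar> * \<bar>T\<bar>"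
    unfolding abs_mult[symmetric] by (rule abs_triangle_ineq)
  also have "\<dots> \<le> \<bar>p\<bar> * e + \<bar>q\<bar> * e" using assms by (intro add_mono mult_left_mono) auto
  finally show ?thesis by (simp add: algebra_simps)
qed

text \<open>The field is U' = l1 U + F1, T' = l2 T + F2. The coefficients \<alpha>, \<beta> express
  u + 1 through (U, T), and \<alpha>', \<beta>' express the sum (u + 1) + (\<theta> - 1), the second
  argument of \<open>quad\<close>.\<close>

locale planar_field =
  fixes l1 l2 \<alpha> \<beta> \<alpha>' \<beta>' A1 B1 A2 B2 :: real
  assumes l1: "0 \<le> l1" and l2: "l2 < 0"
begin

definition F1 :: "real \<Rightarrow> real \<Rightarrow> real" where
  "F1 U T = quad A1 B1 (\<alpha> * U + \<beta> * T) (\<alpha>' * U + \<beta>' * T)"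

definition F2 :: "real \<Rightarrow> real \<Rightarrow> real" where
  "F2 U T = quad A2 B2 (\<alpha> * U + \<beta> * T) (\<alpha>' * U + \<beta>' * T)"

text \<open>Bounds the passage from (U, T) to the arguments of \<open>quad\<close>, both for sizes
  and for increments; the added 1 gives N \<ge> 1.\<close>

definition N :: real where "N = \<bar>\<alpha>\<bar> + \<bar>\<beta>\<bar> + \<bar>\<alpha>'\<bar> + \<bar>\<beta>'\<bar> + 1"

text \<open>One factor N rescales the radius of the box, the other the increments; 6 is the constant
  of \<open>quad_lipschitz\<close>. Thus K e is a Lipschitz constant of both nonlinearities on the
  box of size e.\<close>

definition K :: real where "K = 6 * (\<bar>A1\<bar> + \<bar>B1\<bar> + \<bar>A2\<bar> + \<bar>B2\<bar>) * N * N"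

lemma N: "N \<ge> 1" by (simp add: N_def)

lemma K: "K \<ge> 0" unfolding K_def using N by (intro mult_nonneg_nonneg) auto

lemma coords_le:
  assumes "\<bar>U\<bar> \<le> e" "\<bar>T\<bar> \<le> e"
  shows "\<bar>\<alpha> * U + \<beta> * T\<bar> \<le> N * e" "\<bar>\<alpha>' * U + \<beta>' * T\<bar> \<le> N * e"
proof -
  have "e \<ge> 0" using assms by linarith
  then have "(\<bar>\<alpha>\<bar> + \<bar>\<beta>\<bar>) * e \<le> N * e" "(\<bar>\<alpha>'\<bar> + \<bar>\<beta>'\<bar>) * e \<le> N * e"
    by (auto simp: N_def intro!: mult_right_mono)
  then show "\<bar>\<alpha> * U + \<beta> * T\<bar> \<le> N * e" "\<bar>\<alpha>' * U + \<beta>' * T\<bar> \<le> N * e"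
    using abs_lin_le[OF assms, of \<alpha> \<beta>] abs_lin_le[OF assms, of \<alpha>' \<beta>'] by linarith+
qed

lemma coords_diff_le:
  "\<bar>(\<alpha> * U + \<beta> * T) - (\<alpha> * V + \<beta> * S)\<bar> + \<bar>(\<alpha>' * U + \<beta>' * T) - (\<alpha>' * V + \<beta>' * S)\<bar>
    \<le> N * (\<bar>U - V\<bar> + \<bar>T - S\<bar>)"
proof -
  have "\<bar>(p * U + q * T) - (p * V + q * S)\<bar> \<le> \<bar>p\<bar> * \<bar>U - V\<bar> + \<bar>q\<bar> * \<bar>T - S\<bar>" for p q :: real
    unfolding abs_mult[symmetric] by (rule order_trans[OF eq_refl abs_triangle_ineq]) (simp add: algebra_simps)
  from this[of \<alpha> \<beta>] this[of \<alpha>' \<beta>']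
  have "\<bar>(\<alpha> * U + \<beta> * T) - (\<alpha> * V + \<beta> * S)\<bar> + \<bar>(\<alpha>' * U + \<beta>' * T) - (\<alpha>' * V + \<beta>' * S)\<bar>
    \<le> (\<bar>\<alpha>\<bar> + \<bar>\<alpha>'\<bar>) * \<bar>U - V\<bar> + (\<bar>\<beta>\<bar> + \<bar>\<beta>'\<bar>) * \<bar>T - S\<bar>"
    by (simp add: algebra_simps)
  also have "\<dots> \<le> N * \<bar>U - V\<bar> + N * \<bar>T - S\<bar>"
    by (intro add_mono mult_right_mono) (auto simp: N_def)
  finally show ?thesis by (simp add: algebra_simps)
qed

lemma F_lipschitz:
  assumes e: "N * e \<le> 1/2" and b: "\<bar>U\<bar> \<le> e" "\<bar>T\<bar> \<le> e" "\<bar>V\<bar> \<le> e" "\<bar>S\<bar> \<le> e"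
  shows "\<bar>F1 U T - F1 V S\<bar> \<le> K * e * (\<bar>U - V\<bar> + \<bar>T - S\<bar>)"
    and "\<bar>F2 U T - F2 V S\<bar> \<le> K * e * (\<bar>U - V\<bar> + \<bar>T - S\<bar>)"
proof -
  have e0: "e \<ge> 0" using b by linarith
  have *: "\<bar>quad A B (\<alpha> * U + \<beta> * T) (\<alpha>' * U + \<beta>' * T) - quad A B (\<alpha> * V + \<beta> * S) (\<alpha>' * V + \<beta>' * S)\<bar>
    \<le> K * e * (\<bar>U - V\<bar> + \<bar>T - S\<bar>)" if AB: "\<bar>A\<bar> + \<bar>B\<bar> \<le> \<bar>A1\<bar> + \<bar>B1\<bar> + \<bar>A2\<bar> + \<bar>B2\<bar>" for A B
  proof -
    have "\<bar>quad A B (\<alpha> * U + \<beta> * T) (\<alpha>' * U + \<beta>' * T) - quad A B (\<alpha> * V + \<beta> * S) (\<alpha>' * V + \<beta>' * S)\<bar>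
      \<le> 6 * (\<bar>A\<bar> + \<bar>B\<bar>) * (N * e) * (\<bar>(\<alpha> * U + \<beta> * T) - (\<alpha> * V + \<beta> * S)\<bar> + \<bar>(\<alpha>' * U + \<beta>' * T) - (\<alpha>' * V + \<beta>' * S)\<bar>)"
      by (intro quad_lipschitz[OF e] coords_le b)
    also have "\<dots> \<le> 6 * (\<bar>A1\<bar> + \<bar>B1\<bar> + \<bar>A2\<bar> + \<bar>B2\<bar>) * (N * e) * (N * (\<bar>U - V\<bar> + \<bar>T - S\<bar>))"
      using AB N e0 by (intro mult_mono coords_diff_le) auto
    finally show ?thesis by (simp add: K_def mult_ac)
  qed
  show "\<bar>F1 U T - F1 V S\<bar> \<le> K * e * (\<bar>U - V\<bar> + \<bar>T - S\<bar>)"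
    and "\<bar>F2 U T - F2 V S\<bar> \<le> K * e * (\<bar>U - V\<bar> + \<bar>T - S\<bar>)"
    unfolding F1_def F2_def by (intro *; simp)+
qed

lemma F_0: "F1 0 0 = 0" "F2 0 0 = 0" by (simp_all add: F1_def F2_def quad_def)

lemma F_bound:
  assumes e: "N * e \<le> 1/2" and b: "\<bar>U\<bar> \<le> e" "\<bar>T\<bar> \<le> e"
  shows "\<bar>F1 U T\<bar> \<le> K * e * (\<bar>U\<bar> + \<bar>T\<bar>)" "\<bar>F2 U T\<bar> \<le> K * e * (\<bar>U\<bar> + \<bar>T\<bar>)"
  using F_lipschitz[OF e b, of 0 0] b by (auto simp: F_0)

text \<open>What remains of \<open>quad\<close> on the ray U = t k after division by t^2
  (\<open>quad_blowup\<close>). It is written with sums, products and one inverse so that the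
  closure rules of \<open>bounded_lipschitz\<close> apply literally.\<close>

definition \<Phi> :: "real \<Rightarrow> real \<Rightarrow> real \<Rightarrow> real \<Rightarrow> real" where
  "\<Phi> A B k t = A * ((\<alpha> * k + \<beta>) * (\<alpha>' * k + \<beta>') * inverse (1 + t * ((-1) * (\<alpha> * k + \<beta>)))) +
     B * ((\<alpha> * k + \<beta>) * (\<alpha> * k + \<beta>))"

lemma quad_blowup:
  "quad A B (\<alpha> * (t * k) + \<beta> * t) (\<alpha>' * (t * k) + \<beta>' * t) = t\<^sup>2 * \<Phi> A B k t"
proof -
  have "\<alpha> * (t * k) + \<beta> * t = t * (\<alpha> * k + \<beta>)" "\<alpha>' * (t * k) + \<beta>' * t = t * (\<alpha>' * k + \<beta>')"
    by (simp_all add: algebra_simps)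
  then show ?thesis unfolding quad_def \<Phi>_def
    by (simp only:) (simp add: divide_inverse power2_eq_square algebra_simps)
qed

lemma denominator_ge:
  assumes "\<bar>k\<bar> \<le> 1" "N * \<bar>t\<bar> \<le> 1/2"
  shows "1 + t * ((-1) * (\<alpha> * k + \<beta>)) \<ge> 1/2"
proof -
  have "\<bar>\<alpha> * k + \<beta>\<bar> \<le> N" using coords_le(1)[of k 1 1] assms by simp
  then have "\<bar>t\<bar> * \<bar>\<alpha> * k + \<beta>\<bar> \<le> \<bar>t\<bar> * N" by (intro mult_left_mono) auto
  then have "\<bar>t * (\<alpha> * k + \<beta>)\<bar> \<le> 1/2" using assms(2) by (simp add: abs_mult mult.commute)
  then show ?thesis by (simp only: mult_minus1 mult_minus_right)
qed

lemma bounded_lipschitz_\<Phi>: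
  assumes S: "\<And>t. t \<in> S \<Longrightarrow> N * \<bar>t\<bar> \<le> 1/2"
  shows "bounded_lipschitz S (\<Phi> A B)"
proof -
  have t: "\<bar>t\<bar> \<le> 1/2" if "t \<in> S" for t
    using S[OF that] N mult_right_mono[of 1 N "\<bar>t\<bar>"] by simp
  have "bounded_lipschitz S (\<lambda>k t. inverse (1 + t * ((-1) * (\<alpha> * k + \<beta>))))"
  proof (rule bounded_lipschitz_inverse[where d="1/2"])
    show "bounded_lipschitz S (\<lambda>k t. 1 + t * ((-1) * (\<alpha> * k + \<beta>)))"
      by (intro bounded_lipschitz_intros bounded_lipschitz_snd[OF t])
    fix k t :: real assume "t \<in> S" "\<bar>k\<bar> \<le> 1"
    then show "1/2 \<le> \<bar>1 + t * ((-1) * (\<alpha> * k + \<beta>))\<bar>" using denominator_ge[of k t] S by force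
  qed simp
  then show ?thesis unfolding \<Phi>_def by (intro bounded_lipschitz_intros)
qed

lemma continuous_\<Phi>:
  assumes S: "\<And>t. t \<in> S \<Longrightarrow> N * \<bar>t\<bar> \<le> 1/2"
  shows "continuous_on ({-1..1} \<times> S) (\<lambda>(k, t). \<Phi> A B k t)"
proof -
  have "1 + t * ((-1) * (\<alpha> * k + \<beta>)) \<noteq> 0" if "k \<in> {-1..1}" "t \<in> S" for k t
    using denominator_ge[OF _ S[OF that(2)], of k] that by force
  then show ?thesis unfolding \<Phi>_def split_beta
    by (intro continuous_intros) auto
qed

text \<open>The invariance equation of a graph \<open>U = h t\<close> is singular at \<open>t = 0\<close>. Substituting
  \<open>h t = t * k t\<close> makes it regular singular, \<open>t k' = (l1 / l2 - 1) k + t G(k, t)\<close> with a smooth \<open>G\<close>;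
  as \<open>l1 / l2 \<le> 0\<close>, it has a solution vanishing at 0.\<close>

lemma stable_manifold:
  "\<exists>r>0. \<exists>C\<ge>0. \<exists>h h'. continuous_on {-r<..<r} h' \<and>
     (\<forall>t. \<bar>t\<bar> < r \<longrightarrow> (h has_real_derivative h' t) (at t) \<and> \<bar>h t\<bar> \<le> C * t\<^sup>2 \<and> \<bar>h' t\<bar> \<le> C * \<bar>t\<bar> \<and>
        h' t * (l2 * t + F2 (h t) t) = l1 * h t + F1 (h t) t)"
proof -
  define a where "a = l1 / l2"
  have a: "a \<le> 0" using l1 l2 by (simp add: a_def divide_nonneg_neg)
  define r0 where "r0 = 1 / (2 * N)"
  have r0: "r0 > 0" using N by (simp add: r0_def)
  have S0: "N * \<bar>t\<bar> \<le> 1/2" if "t \<in> {-r0..r0}" for t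
  proof -
    have "N * \<bar>t\<bar> \<le> N * r0" using that N by (intro mult_left_mono) auto
    then show ?thesis using N by (simp add: r0_def)
  qed
  obtain B2' where B2': "B2' \<ge> 0" "\<And>k t. t \<in> {-r0..r0} \<Longrightarrow> \<bar>k\<bar> \<le> 1 \<Longrightarrow> \<bar>\<Phi> A2 B2 k t\<bar> \<le> B2'"
    using bounded_lipschitzE[OF bounded_lipschitz_\<Phi>[OF S0]] by metis
  \<comment> \<open>On this interval \<open>t * \<Phi> A2 B2 k t\<close> is at most half of
    \<bar>l2\<bar>, so the denominator in G stays below l2 / 2 and is never 0.\<close>
  define r1 where "r1 = min r0 (- l2 / (2 * (B2' + 1)))"
  have r1: "r1 > 0" "r1 \<le> r0" using r0 l2 B2'(1) by (auto simp: r1_def divide_neg_pos)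
  \<comment> \<open>With h = t k, invariance reads k + t k' = (l1 k + t \<Phi>1) / (l2 + t \<Phi>2),
    where \<Phi>1, \<Phi>2 are the two instances of \<open>\<Phi>\<close>. Subtracting a k, a = l1 /
    l2, cancels the part of order 0 in t on the right and leaves t G; hence m = 1 - a below.\<close>
  define G where "G k t = (\<Phi> A1 B1 k t + (- a) * (\<Phi> A2 B2 k t * k)) * inverse (l2 + t * \<Phi> A2 B2 k t)" for k t
  have den: "l2 + t * \<Phi> A2 B2 k t \<le> l2 / 2" if "t \<in> {-r1..r1}" "\<bar>k\<bar> \<le> 1" for k t
  proof -
    have "\<bar>t * \<Phi> A2 B2 k t\<bar> \<le> r1 * B2'" unfolding abs_mult
      using that r1 B2'(2)[of t k] by (intro mult_mono) auto
    also have "\<dots> \<le> (- l2 / (2 * (B2' + 1))) * (B2' + 1)" using B2'(1) r1 l2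
      by (intro mult_mono) (auto simp: r1_def divide_nonpos_pos)
    also have "\<dots> = - l2 / 2" using B2'(1) by (simp add: field_simps)
    finally show ?thesis by (simp add: abs_le_iff)
  qed
  have S1: "N * \<bar>t\<bar> \<le> 1/2" if "t \<in> {-r1..r1}" for t using S0 that r1 by auto
  have t1: "\<bar>t\<bar> \<le> r1" if "t \<in> {-r1..r1}" for t using that by auto
  have "bounded_lipschitz {-r1..r1} (\<lambda>k t. inverse (l2 + t * \<Phi> A2 B2 k t))"
  proof (rule bounded_lipschitz_inverse[where d="- l2 / 2"])
    show "bounded_lipschitz {-r1..r1} (\<lambda>k t. l2 + t * \<Phi> A2 B2 k t)"
      by (intro bounded_lipschitz_intros bounded_lipschitz_snd[OF t1] bounded_lipschitz_\<Phi>[OF S1])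
    fix t x :: real assume "t \<in> {-r1..r1}" "\<bar>x\<bar> \<le> 1"
    then show "- l2 / 2 \<le> \<bar>l2 + t * \<Phi> A2 B2 x t\<bar>" using den[of t x] l2 by linarith
  qed (use l2 in auto)
  then have "bounded_lipschitz {-r1..r1} G" unfolding G_def
    by (intro bounded_lipschitz_intros bounded_lipschitz_\<Phi>[OF S1])
  then obtain B where B: "B \<ge> 0" "\<And>t k. t \<in> {-r1..r1} \<Longrightarrow> \<bar>k\<bar> \<le> 1 \<Longrightarrow> \<bar>G k t\<bar> \<le> B"
    "\<And>t x y. t \<in> {-r1..r1} \<Longrightarrow> \<bar>x\<bar> \<le> 1 \<Longrightarrow> \<bar>y\<bar> \<le> 1 \<Longrightarrow> \<bar>G x t - G y t\<bar> \<le> B * \<bar>x - y\<bar>"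
    by (rule bounded_lipschitzE) blast
  have "l2 + t * \<Phi> A2 B2 k t \<noteq> 0" if "t \<in> {-r1..r1}" "k \<in> {-1..1}" for k t
    using den[of t k] that l2 by force
  moreover have "continuous_on ({-1..1} \<times> {-r1..r1}) (\<lambda>p. \<Phi> A B (fst p) (snd p))" for A B
    using continuous_\<Phi>[where S="{-r1..r1}" and A=A and B=B, OF S1] by (simp add: split_beta)
  ultimately have Gc: "continuous_on ({-1..1} \<times> {-r1..r1}) (\<lambda>p. G (fst p) (snd p))"
    unfolding G_def by (intro continuous_intros) auto
  define r where "r = min r1 (1 / (2 * (B + 1)))"
  have r: "r > 0" "r \<le> r1" using r1 B(1) by (auto simp: r_def)
  have Br: "B * r \<le> 1/2"
  proof -
    have "B * r \<le> (B + 1) * (1 / (2 * (B + 1)))" using B(1) r by (intro mult_mono) (auto simp: r_def)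
    also have "\<dots> = 1/2" using B(1) by (simp add: field_simps)
    finally show ?thesis .
  qed
  define m where "m = 1 - a"
  have m: "m > 0" using a by (simp add: m_def)
  \<comment> \<open>The two half lines are solved separately. The reflection t -> - t preserves the
    singular term and replaces G by its negative at - t; both signs s are treated at once.\<close>
  have Gs: "\<exists>k. continuous_on {0..r} k \<and> (\<forall>t. 0 \<le> t \<longrightarrow> t \<le> r \<longrightarrow> \<bar>k t\<bar> \<le> B * t) \<and>
    (\<forall>t. 0 < t \<longrightarrow> t < r \<longrightarrow> (k has_real_derivative s * G (k t) (s * t) - m * k t / t) (at t))"
    if s: "s = 1 \<or> s = -1" for s
  proof (rule regular_singular_ode[OF m B(1) r(1) Br])
    have st: "s * t \<in> {-r1..r1}" if "0 \<le> t" "t \<le> r" for t using s that r by auto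
    show "continuous_on ({- 1..1} \<times> {0..r}) (\<lambda>(x, t). s * G x (s * t))"
      unfolding split_beta using st
      by (intro continuous_intros continuous_on_compose2[OF Gc, of _ "\<lambda>p. (fst p, s * snd p)", simplified])
        (auto intro!: continuous_intros)
    have abs_s: "\<bar>s\<bar> = 1" using s by auto
    fix x y t :: real assume x: "\<bar>x\<bar> \<le> 1" and t: "0 \<le> t" "t \<le> r"
    show "\<bar>s * G x (s * t)\<bar> \<le> B" using B(2)[OF st[OF t] x] abs_s by (simp add: abs_mult)
    assume y: "\<bar>y\<bar> \<le> 1"
    show "\<bar>s * G x (s * t) - s * G y (s * t)\<bar> \<le> B * \<bar>x - y\<bar>"
      using B(3)[OF st[OF t] x y] abs_s by (simp add: abs_mult right_diff_distrib[symmetric])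
  qed
  from Gs[of 1] obtain kp where kp: "continuous_on {0..r} kp" "\<And>t. 0 \<le> t \<Longrightarrow> t \<le> r \<Longrightarrow> \<bar>kp t\<bar> \<le> B * t"
    "\<And>t. 0 < t \<Longrightarrow> t < r \<Longrightarrow> (kp has_real_derivative G (kp t) t - m * kp t / t) (at t)" by auto
  from Gs[of "-1"] obtain km where km: "continuous_on {0..r} km" "\<And>t. 0 \<le> t \<Longrightarrow> t \<le> r \<Longrightarrow> \<bar>km t\<bar> \<le> B * t"
    "\<And>t. 0 < t \<Longrightarrow> t < r \<Longrightarrow> (km has_real_derivative - G (km t) (- t) - m * km t / t) (at t)" by auto
  define k where "k t = (if t \<ge> 0 then kp t else km (- t))" for t
  have kb: "\<bar>k t\<bar> \<le> B * \<bar>t\<bar>" if "\<bar>t\<bar> \<le> r" for t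
    using kp(2)[of t] km(2)[of "- t"] that by (auto simp: k_def)
  have k1: "\<bar>k t\<bar> \<le> 1" if "\<bar>t\<bar> \<le> r" for t
    using kb[OF that] mult_left_mono[OF that B(1)] Br by linarith
  have kd: "(k has_real_derivative G (k t) t - m * k t / t) (at t)" if t: "\<bar>t\<bar> < r" "t \<noteq> 0" for t
  proof (cases "t > 0")
    case True
    have "(kp has_real_derivative G (k t) t - m * k t / t) (at t)"
      using kp(3)[OF True] t True by (simp add: k_def)
    then show ?thesis
      by (rule has_field_derivative_transform_within_open[where S="{0<..}"]) (use True in \<open>auto simp: k_def\<close>)
  next
    case False
    then have "(km has_real_derivative - G (km (-t)) (- (-t)) - m * km (-t) / (-t)) (at (- t))"
      using t by (intro km(3)) auto
    then have "((\<lambda>t. km (- t)) has_real_derivative - (- G (km (-t)) t - m * km (-t) / (-t))) (at t)"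
      by (simp add: DERIV_mirror)
    then have "((\<lambda>t. km (- t)) has_real_derivative G (k t) t - m * k t / t) (at t)"
      using t False by (simp add: k_def)
    then show ?thesis
      by (rule has_field_derivative_transform_within_open[where S="{..<0}"]) (use t False in \<open>auto simp: k_def\<close>)
  qed
  define h where "h t = t * k t" for t
  \<comment> \<open>By the product rule h' = k + t k' = (1 - m) k + t G. The division by t has
    disappeared, so the formula is continuous through 0.\<close>
  define h' where "h' t = a * k t + t * G (k t) t" for t
  define C where "C = \<bar>a\<bar> * B + B"
  have C: "C \<ge> B" "C \<ge> 0" using B(1) by (auto simp: C_def)
  have tG: "t \<in> {-r1..r1}" if "\<bar>t\<bar> \<le> r" for t using that r by auto
  have hb: "\<bar>h t\<bar> \<le> C * t\<^sup>2" if "\<bar>t\<bar> < r" for t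
  proof -
    have "\<bar>h t\<bar> \<le> \<bar>t\<bar> * (B * \<bar>t\<bar>)" unfolding h_def abs_mult using kb[of t] that by (intro mult_left_mono) auto
    also have "\<dots> = B * t\<^sup>2" by (simp add: power2_eq_square)
    also have "\<dots> \<le> C * t\<^sup>2" using C by (intro mult_right_mono) auto
    finally show ?thesis .
  qed
  have h'b: "\<bar>h' t\<bar> \<le> C * \<bar>t\<bar>" if "\<bar>t\<bar> < r" for t
  proof -
    have "\<bar>h' t\<bar> \<le> \<bar>a\<bar> * \<bar>k t\<bar> + \<bar>t\<bar> * \<bar>G (k t) t\<bar>"
      unfolding h'_def abs_mult[symmetric] by (rule abs_triangle_ineq)
    also have "\<dots> \<le> \<bar>a\<bar> * (B * \<bar>t\<bar>) + \<bar>t\<bar> * B"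
      using kb[of t] B(2)[OF tG k1, of t] that by (intro add_mono mult_left_mono) auto
    finally show ?thesis by (simp add: C_def algebra_simps)
  qed
  have h0: "h 0 = 0" "h' 0 = 0" using kb[of 0] r by (auto simp: h_def h'_def)
  have hd: "(h has_real_derivative h' t) (at t)" if t: "\<bar>t\<bar> < r" for t
  proof (cases "t = 0")
    case False
    show ?thesis unfolding h_def
      using DERIV_mult[OF DERIV_ident kd[OF t False]] False
      by (auto elim!: DERIV_cong simp: h'_def m_def field_simps)
  next
    case True
    have "((\<lambda>x. C * \<bar>x\<bar>) \<longlongrightarrow> C * \<bar>0\<bar>) (at 0)" by (intro tendsto_intros)
    moreover have "\<forall>\<^sub>F x in at 0. norm (h x / x) \<le> C * \<bar>x\<bar>"
    proof -
      have "norm (h x / x) \<le> C * \<bar>x\<bar>" if "x \<noteq> 0" "\<bar>x\<bar> < r" for x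
      proof -
        have "\<bar>h x\<bar> \<le> (C * \<bar>x\<bar>) * \<bar>x\<bar>"
          using hb[OF that(2)] by (simp add: power2_eq_square mult.assoc abs_mult_self_eq)
        then show ?thesis using that(1) by (simp add: divide_le_eq)
      qed
      then show ?thesis using r by (auto simp: eventually_at intro!: exI[of _ r])
    qed
    ultimately have "((\<lambda>x. h x / x) \<longlongrightarrow> 0) (at 0)"
      by (simp add: Lim_null_comparison[where g="\<lambda>x. C * \<bar>x\<bar>"])
    then have "(h has_real_derivative 0) (at 0)" by (simp add: has_field_derivative_iff h0)
    then show ?thesis using True h0 by simp
  qed
  have kcont: "continuous_on {-r<..<r} k"
  proof (rule continuous_at_imp_continuous_on, rule ballI)
    fix t assume t: "t \<in> {-r<..<r}"
    show "isCont k t"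
    proof (cases "t = 0")
      case False
      moreover have "\<bar>t\<bar> < r" using t by auto
      ultimately show ?thesis using kd[of t] by (blast intro: DERIV_isCont)
    next
      case True
      have "((\<lambda>x. B * \<bar>x\<bar>) \<longlongrightarrow> B * \<bar>0\<bar>) (at 0)" by (intro tendsto_intros)
      moreover have "\<forall>\<^sub>F x in at 0. norm (k x) \<le> B * \<bar>x\<bar>"
        using r kb by (auto simp: eventually_at intro!: exI[of _ r])
      ultimately have "(k \<longlongrightarrow> 0) (at 0)"
        by (simp add: Lim_null_comparison[where g="\<lambda>x. B * \<bar>x\<bar>"])
      moreover have "k 0 = 0" using kb[of 0] r by simp
      ultimately show ?thesis using True by (simp add: isCont_def)
    qed
  qed
  have h'c: "continuous_on {-r<..<r} h'"
  proof -
    have "(k t, t) \<in> {-1..1} \<times> {-r1..r1}" if "t \<in> {-r<..<r}" for t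
      using k1[of t] r that by (auto simp: abs_le_iff)
    moreover have "continuous_on {-r<..<r} (\<lambda>t. (k t, t))" by (intro continuous_intros kcont)
    ultimately have "continuous_on {-r<..<r} (\<lambda>t. G (fst (k t, t)) (snd (k t, t)))"
      by (intro continuous_on_compose2[OF Gc]) auto
    then show ?thesis unfolding h'_def by (auto intro!: continuous_intros kcont)
  qed
  have inv: "h' t * (l2 * t + F2 (h t) t) = l1 * h t + F1 (h t) t" if t: "\<bar>t\<bar> < r" for t
  proof -
    define d where "d = l2 + t * \<Phi> A2 B2 (k t) t"
    have "d \<noteq> 0" using den[OF tG k1, of t t] t l2 by (simp add: d_def)
    then have Gd: "G (k t) t * d = \<Phi> A1 B1 (k t) t - a * \<Phi> A2 B2 (k t) t * k t"
      by (simp add: G_def d_def[symmetric] mult.assoc)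
    have F: "l2 * t + F2 (h t) t = t * d" "F1 (h t) t = t\<^sup>2 * \<Phi> A1 B1 (k t) t"
      unfolding F1_def F2_def h_def quad_blowup d_def by (simp_all add: power2_eq_square algebra_simps)
    have al: "l1 = a * l2" using l2 by (simp add: a_def)
    have "h' t * (t * d) = a * k t * t * d + t * t * (G (k t) t * d)"
      by (simp add: h'_def algebra_simps)
    also have "\<dots> = l1 * h t + t\<^sup>2 * \<Phi> A1 B1 (k t) t"
      unfolding Gd by (simp add: al h_def d_def algebra_simps power2_eq_square)
    finally show ?thesis by (simp add: F)
  qed
  show ?thesis using r(1) C(2) h'c hd hb h'b inv by blast
qed

end

section \<open>Decay at a degenerate node\<close>


text \<open>The hypothesis says that 1 / sqrt E grows at least at rate k. As E is nonincreasing, E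
  \<tau> > 0 forces E > 0 on the whole interval, so this quantity is defined; for E \<tau> = 0 the
  claim is trivial.\<close>

lemma algebraic_decay:
  fixes E :: "real \<Rightarrow> real"
  assumes c: "continuous_on {0..\<tau>} E" and \<tau>: "\<tau> \<ge> 0" and nn: "\<And>x. 0 \<le> x \<Longrightarrow> x \<le> \<tau> \<Longrightarrow> E x \<ge> 0" and k: "k \<ge> 0"
    and d: "\<And>x. 0 < x \<Longrightarrow> x < \<tau> \<Longrightarrow> (E has_real_derivative E' x) (at x) \<and> E' x \<le> - (2 * k * E x * sqrt (E x))"
  shows "sqrt (E \<tau>) * (1 + k * sqrt (E 0) * \<tau>) \<le> sqrt (E 0)"
proof (cases "E \<tau> = 0")
  case True
  then show ?thesis using nn[of 0] \<tau> by simp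
next
  case False
  then have pos\<tau>: "E \<tau> > 0" using nn[of \<tau>] \<tau> by simp
  have pos: "E x > 0" if x: "0 \<le> x" "x \<le> \<tau>" for x
  proof -
    have "E \<tau> \<le> E x"
    proof (rule nonincreasing_of_deriv[where E=E and E'=E'])
      show "continuous_on {x..\<tau>} E" using x by (intro continuous_on_subset[OF c]) auto
      fix y assume y: "x < y" "y < \<tau>"
      have "0 \<le> 2 * k * E y * sqrt (E y)" using nn[of y] x y k by (intro mult_nonneg_nonneg) auto
      then show "(E has_real_derivative E' y) (at y) \<and> E' y \<le> 0"
        using d[of y] x y by linarith
    qed (use x in auto)
    then show ?thesis using pos\<tau> by simp
  qed
  have "k * \<tau> - inverse (sqrt (E \<tau>)) \<le> k * 0 - inverse (sqrt (E 0))"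
  proof (rule nonincreasing_of_deriv[OF _ \<tau>])
    show "continuous_on {0..\<tau>} (\<lambda>x. k * x - inverse (sqrt (E x)))"
      using pos by (intro continuous_intros c) (auto simp: less_le)
    fix x assume x: "0 < x" "x < \<tau>"
    then have p: "E x > 0" using pos by simp
    have D: "((\<lambda>x. k * x - inverse (sqrt (E x))) has_real_derivative k + E' x / (2 * E x * sqrt (E x))) (at x)"
      using d[OF x] p by (auto intro!: derivative_eq_intros simp: field_simps power2_eq_square)
    have "E' x / (2 * E x * sqrt (E x)) \<le> - k"
      using d[OF x] p by (simp add: divide_le_eq mult_ac)
    then show "((\<lambda>x. k * x - inverse (sqrt (E x))) has_real_derivative k + E' x / (2 * E x * sqrt (E x))) (at x)
        \<and> k + E' x / (2 * E x * sqrt (E x)) \<le> 0"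
      using D by simp
  qed
  then have "inverse (sqrt (E 0)) + k * \<tau> \<le> inverse (sqrt (E \<tau>))" by simp
  moreover have "sqrt (E 0) > 0" "sqrt (E \<tau>) > 0" using pos[of 0] pos\<tau> \<tau> by auto
  ultimately show ?thesis by (simp add: field_simps)
qed

text \<open>The weight \<open>exp (- (b / l2) T)\<close> removes the term \<open>b T V\<close>, and \<open>exp (k T\<^sup>2)\<close> absorbs the
  remaining \<open>V T\<^sup>2\<close>, so that \<open>Y\<^sup>2 + T\<^sup>2\<close> with \<open>Y = V exp (k T\<^sup>2 - (b / l2) T)\<close> is a strict
  Lyapunov function.\<close>

lemma degenerate_node_decay:
  fixes a b l2 D :: real
  assumes a: "a > 0" and l2: "l2 < 0" and D: "D \<ge> 0"
  shows "\<exists>\<sigma>>0. \<exists>k>0. \<forall>\<tau> V T V' T'. \<tau> \<ge> 0 \<longrightarrow> continuous_on {0..\<tau>} V \<longrightarrow> continuous_on {0..\<tau>} T \<longrightarrow>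
    (\<forall>x. 0 \<le> x \<longrightarrow> x \<le> \<tau> \<longrightarrow> 0 \<le> V x \<and> V x \<le> \<sigma> \<and> \<bar>T x\<bar> \<le> \<sigma>) \<longrightarrow>
    (\<forall>x. 0 < x \<longrightarrow> x < \<tau> \<longrightarrow> (V has_real_derivative V' x) (at x) \<and> (T has_real_derivative T' x) (at x) \<and>
       \<bar>V' x - V x * (b * T x - a * V x)\<bar> \<le> D * V x * ((V x)\<^sup>2 + (T x)\<^sup>2) \<and>
       \<bar>T' x - l2 * T x\<bar> \<le> D * ((V x)\<^sup>2 + (T x)\<^sup>2)) \<longrightarrow>
    (\<exists>S0 S. 0 \<le> S0 \<and> 0 \<le> S \<and> S0 \<le> 3 * V 0 + \<bar>T 0\<bar> \<and> V \<tau> \<le> 3 * S \<and> \<bar>T \<tau>\<bar> \<le> S \<and> S * (1 + k * S0 * \<tau>) \<le> S0)"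
proof -
  \<comment> \<open>Since T' = l2 T + ..., the derivative of - q T contributes - b T, which cancels
    the indefinite term b T V.\<close>
  define q where "q = b / l2"
  have b: "b = q * l2" using l2 by (simp add: q_def)
  \<comment> \<open>Chosen so that - l2 K = D (2 + \<bar>q\<bar>), the total size of the error
    terms. The term K T^2 in the exponent produces 2 K l2 T^2, twice what the T^2 part of the error
    needs.\<close>
  define K where "K = D * (2 + \<bar>q\<bar>) / (- l2)"
  have K: "K \<ge> 0" using D l2 unfolding K_def by (intro divide_nonneg_pos mult_nonneg_nonneg) auto
  have Kl: "- l2 * K = D * (2 + \<bar>q\<bar>)" using l2 by (simp add: K_def)
  \<comment> \<open>Cost of absorbing 18 D \<bar>T\<bar> Y^2 into (- l2 / 2) T^2 by completing the
    square: (18 D)^2 / (2 (- l2)).\<close>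
  define D' where "D' = 162 * D\<^sup>2 / (- l2)"
  have D': "D' \<ge> 0" using l2 by (simp add: D'_def divide_nonneg_neg)
  \<comment> \<open>The entries after 1 yield \<open>s1\<close> to \<open>s5\<close> in this order;
    the entry 1 lets powers of T be lowered.\<close>
  define \<sigma> where "\<sigma> = Min {1, 1 / (2 * K + 1), 1 / (\<bar>q\<bar> + K + 1), a / (2 * (- l2 * K + 1)),
     - l2 / (4 * (D + 1)), a / (18 * (D' + 1))}"
  have pos: "0 < 1 / (2 * K + 1)" "0 < 1 / (\<bar>q\<bar> + K + 1)" "0 < a / (2 * (- l2 * K + 1))"
     "0 < - l2 / (4 * (D + 1))" "0 < a / (18 * (D' + 1))"
    using K D D' a l2 mult_nonpos_nonneg[of l2 K]
    by - (rule divide_pos_pos; simp; fail | rule divide_pos_pos; linarith)+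
  have \<sigma>: "\<sigma> > 0" using pos by (simp add: \<sigma>_def)
  have le: "\<sigma> \<le> 1" "\<sigma> \<le> 1 / (2 * K + 1)" "\<sigma> \<le> 1 / (\<bar>q\<bar> + K + 1)" "\<sigma> \<le> a / (2 * (- l2 * K + 1))"
     "\<sigma> \<le> - l2 / (4 * (D + 1))" "\<sigma> \<le> a / (18 * (D' + 1))"
    unfolding \<sigma>_def by (rule Min_le; simp)+
  have s1: "2 * K * \<sigma> \<le> 1"
  proof -
    have "\<sigma> * (2 * K + 1) \<le> 1" using le(2) K by (subst (asm) le_divide_eq) auto
    then show ?thesis using \<sigma> by (simp add: algebra_simps)
  qed
  have s2: "(\<bar>q\<bar> + K) * \<sigma> \<le> 1"
  proof -
    have "\<sigma> * (\<bar>q\<bar> + K + 1) \<le> 1" using le(3) K by (subst (asm) le_divide_eq) auto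
    then show ?thesis using \<sigma> by (simp add: algebra_simps)
  qed
  have s3: "(- l2 * K) * \<sigma> \<le> a / 2"
  proof -
    have "0 \<le> - l2 * K" using K l2 by (simp add: mult_nonpos_nonneg)
    then have "\<sigma> * (2 * (- l2 * K + 1)) \<le> a" using le(4) by (subst (asm) le_divide_eq) auto
    then show ?thesis using \<sigma> by (simp add: algebra_simps)
  qed
  have s4: "2 * D * \<sigma> \<le> - l2 / 2"
  proof -
    have "\<sigma> * (4 * (D + 1)) \<le> - l2" using le(5) D by (subst (asm) le_divide_eq) auto
    then show ?thesis using \<sigma> by (simp add: algebra_simps)
  qed
  have s5: "D' * (3 * \<sigma>) \<le> a / 6"
  proof -
    have "\<sigma> * (18 * (D' + 1)) \<le> a" using le(6) D' by (subst (asm) le_divide_eq) auto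
    then show ?thesis using \<sigma> by (simp add: algebra_simps)
  qed
  \<comment> \<open>The two rates in E' \<le> - (a / 6) Y^3 + l2 T^2, of which the smaller is
    kept.\<close>
  define c where "c = min (a / 6) (- l2)"
  have c: "c > 0" using a l2 by (simp add: c_def)
  have main: "\<exists>S0 S. 0 \<le> S0 \<and> 0 \<le> S \<and> S0 \<le> 3 * V 0 + \<bar>T 0\<bar> \<and> V \<tau> \<le> 3 * S \<and> \<bar>T \<tau>\<bar> \<le> S \<and> S * (1 + c / 6 * S0 * \<tau>) \<le> S0"
    if \<tau>: "\<tau> \<ge> 0" and Vc: "continuous_on {0..\<tau>} V" and Tc: "continuous_on {0..\<tau>} T"
      and box: "\<forall>x. 0 \<le> x \<longrightarrow> x \<le> \<tau> \<longrightarrow> 0 \<le> V x \<and> V x \<le> \<sigma> \<and> \<bar>T x\<bar> \<le> \<sigma>"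
      and der: "\<forall>x. 0 < x \<longrightarrow> x < \<tau> \<longrightarrow> (V has_real_derivative V' x) (at x) \<and> (T has_real_derivative T' x) (at x) \<and>
       \<bar>V' x - V x * (b * T x - a * V x)\<bar> \<le> D * V x * ((V x)\<^sup>2 + (T x)\<^sup>2) \<and>
       \<bar>T' x - l2 * T x\<bar> \<le> D * ((V x)\<^sup>2 + (T x)\<^sup>2)" for \<tau> V T V' T'
  proof -
    define \<psi> where "\<psi> x = K * (T x)\<^sup>2 - q * T x" for x
    define Y where "Y x = V x * exp (\<psi> x)" for x
    define E where "E x = (Y x)\<^sup>2 + (T x)\<^sup>2" for x
    \<comment> \<open>With the exponent in [-1, 1] the weight lies between 1/3 and 3, so Y and V are
      comparable; this is the origin of the factors 3 in the conclusion.\<close>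
    have \<psi>: "\<bar>\<psi> x\<bar> \<le> 1" if x: "0 \<le> x" "x \<le> \<tau>" for x
    proof -
      have T: "\<bar>T x\<bar> \<le> \<sigma>" using box x by blast
      have "\<bar>\<psi> x\<bar> \<le> \<bar>K * (T x)\<^sup>2\<bar> + \<bar>q * T x\<bar>" unfolding \<psi>_def by (rule abs_triangle_ineq4)
      also have "\<dots> = K * (\<bar>T x\<bar> * \<bar>T x\<bar>) + \<bar>q\<bar> * \<bar>T x\<bar>"
        using K by (simp add: abs_mult power2_eq_square)
      also have "\<dots> \<le> K * (\<sigma> * 1) + \<bar>q\<bar> * \<sigma>"
        using T le(1) K by (intro add_mono mult_left_mono mult_mono) auto
      also have "\<dots> \<le> 1" using s2 by (simp add: algebra_simps)
      finally show ?thesis .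
    qed
    have e3: "exp (1::real) \<le> 3" by (rule exp_le)
    have ex: "1 / 3 \<le> exp (\<psi> x)" "exp (\<psi> x) \<le> 3" if x: "0 \<le> x" "x \<le> \<tau>" for x
    proof -
      have "exp (\<psi> x) \<le> exp 1" using \<psi>[OF x] by simp
      then show "exp (\<psi> x) \<le> 3" using e3 by linarith
      have "exp (- \<psi> x) \<le> exp 1" using \<psi>[OF x] by simp
      then have "exp (- \<psi> x) \<le> 3" using e3 by linarith
      then show "1 / 3 \<le> exp (\<psi> x)" by (simp add: exp_minus field_simps)
    qed
    have YV: "0 \<le> Y x" "Y x \<le> 3 * V x" "V x \<le> 3 * Y x" if x: "0 \<le> x" "x \<le> \<tau>" for x
    proof -
      have V: "0 \<le> V x" using box x by blast
      show "0 \<le> Y x" using V by (simp add: Y_def)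
      show "Y x \<le> 3 * V x" unfolding Y_def using mult_left_mono[OF ex(2)[OF x] V] by simp
      show "V x \<le> 3 * Y x" unfolding Y_def using mult_left_mono[OF ex(1)[OF x] V] by simp
    qed
    define Y' where "Y' x = exp (\<psi> x) * (V' x + V x * ((2 * K * T x - q) * T' x))" for x
    define E' where "E' x = 2 * Y x * Y' x + 2 * T x * T' x" for x
    have Ed: "(E has_real_derivative E' x) (at x) \<and> E' x \<le> - (2 * (c / 6) * E x * sqrt (E x))"
      if x0: "0 < x" "x < \<tau>" for x
    proof
      have x: "0 \<le> x" "x \<le> \<tau>" using x0 by auto
      have V: "0 \<le> V x" "V x \<le> \<sigma>" and T: "\<bar>T x\<bar> \<le> \<sigma>" using box x by auto
      have dV: "(V has_real_derivative V' x) (at x)" and dT: "(T has_real_derivative T' x) (at x)"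
        and bV: "\<bar>V' x - V x * (b * T x - a * V x)\<bar> \<le> D * V x * ((V x)\<^sup>2 + (T x)\<^sup>2)"
        and bT: "\<bar>T' x - l2 * T x\<bar> \<le> D * ((V x)\<^sup>2 + (T x)\<^sup>2)" using der x0 by auto
      have dY: "(Y has_real_derivative Y' x) (at x)"
        unfolding Y_def \<psi>_def using dV dT
        by (auto intro!: derivative_eq_intros simp: Y'_def \<psi>_def algebra_simps)
      show "(E has_real_derivative E' x) (at x)" unfolding E_def using dY dT
        by (auto intro!: derivative_eq_intros simp: E'_def)
      let ?Q = "(V x)\<^sup>2 + (T x)\<^sup>2"
      have Q: "?Q \<ge> 0" by simp
      have "\<bar>2 * K * T x\<bar> \<le> 2 * K * \<sigma>" using T K by (simp add: abs_mult mult_left_mono)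
      then have kt: "\<bar>2 * K * T x - q\<bar> \<le> 1 + \<bar>q\<bar>" using s1 by linarith
      have "(2 * K * T x - q) * (T' x - l2 * T x) \<le> \<bar>2 * K * T x - q\<bar> * \<bar>T' x - l2 * T x\<bar>"
        unfolding abs_mult[symmetric] by (rule abs_ge_self)
      also have "\<dots> \<le> (1 + \<bar>q\<bar>) * (D * ?Q)" using kt bT by (intro mult_mono) auto
      finally have 1: "(2 * K * T x - q) * T' x \<le> (2 * K * T x - q) * (l2 * T x) + (1 + \<bar>q\<bar>) * (D * ?Q)"
        by (simp add: algebra_simps)
      have "V' x + V x * ((2 * K * T x - q) * T' x) \<le>
          V x * (b * T x - a * V x) + D * V x * ?Q
          + V x * ((2 * K * T x - q) * (l2 * T x) + (1 + \<bar>q\<bar>) * (D * ?Q))"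
        using bV mult_left_mono[OF 1 V(1)] by linarith
      also have "\<dots> = V x * (- a * V x + 2 * (K * l2) * (T x)\<^sup>2 + D * (2 + \<bar>q\<bar>) * ?Q)"
        by (simp add: b algebra_simps power2_eq_square)
      also have "\<dots> = V x * (- a * V x + (- l2 * K) * (V x)\<^sup>2 - (- l2 * K) * (T x)\<^sup>2)"
        unfolding Kl[symmetric] by (simp add: algebra_simps)
      also have "\<dots> \<le> V x * (- a * V x + (- l2 * K) * (V x)\<^sup>2)"
        using K l2 V by (intro mult_left_mono) (auto simp: mult_nonpos_nonneg)
      also have "\<dots> \<le> V x * (- a * V x + a / 2 * V x)"
      proof -
        have "(- l2 * K) * (V x)\<^sup>2 = ((- l2 * K) * V x) * V x" by (simp add: power2_eq_square)
        also have "\<dots> \<le> ((- l2 * K) * \<sigma>) * V x" using V K l2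
          by (intro mult_right_mono mult_left_mono) (auto simp: mult_nonpos_nonneg)
        also have "\<dots> \<le> a / 2 * V x" using s3 V by (intro mult_right_mono) auto
        finally show ?thesis using V by (intro mult_left_mono) auto
      qed
      finally have 2: "V' x + V x * ((2 * K * T x - q) * T' x) \<le> - (a / 2) * (V x * V x)"
        by (simp add: algebra_simps)
      have "Y' x \<le> exp (\<psi> x) * (- (a / 2) * (V x * V x))" unfolding Y'_def using 2 by (intro mult_left_mono) auto
      also have "\<dots> = - (a / 2) * (Y x * V x)" by (simp add: Y_def)
      also have "\<dots> \<le> - (a / 2) * (Y x * (Y x / 3))"
        using a YV[OF x] by (intro mult_left_mono_neg mult_left_mono) auto
      finally have "Y' x \<le> - (a / 6) * (Y x * Y x)" by simp
      then have "2 * Y x * Y' x \<le> 2 * Y x * (- (a / 6) * (Y x * Y x))"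
        using YV(1)[OF x] by (intro mult_left_mono) auto
      then have y: "2 * Y x * Y' x \<le> - (a / 3) * (Y x) ^ 3" by (simp add: power3_eq_cube)
      have "T x * (T' x - l2 * T x) \<le> \<bar>T x\<bar> * \<bar>T' x - l2 * T x\<bar>"
        unfolding abs_mult[symmetric] by (rule abs_ge_self)
      also have "\<dots> \<le> \<bar>T x\<bar> * (D * ?Q)" using bT by (intro mult_left_mono) auto
      finally have t0: "2 * T x * T' x \<le> 2 * l2 * (T x)\<^sup>2 + 2 * \<bar>T x\<bar> * (D * ?Q)"
        by (simp add: algebra_simps power2_eq_square)
      have t1: "2 * \<bar>T x\<bar> * (D * (T x)\<^sup>2) \<le> (- l2 / 2) * (T x)\<^sup>2"
      proof -
        have "2 * \<bar>T x\<bar> * (D * (T x)\<^sup>2) = (2 * D * \<bar>T x\<bar>) * (T x)\<^sup>2" by simp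
        also have "\<dots> \<le> (2 * D * \<sigma>) * (T x)\<^sup>2" using T D by (intro mult_right_mono mult_left_mono) auto
        also have "\<dots> \<le> (- l2 / 2) * (T x)\<^sup>2" using s4 by (intro mult_right_mono) auto
        finally show ?thesis .
      qed
      have t2: "2 * \<bar>T x\<bar> * (D * (V x)\<^sup>2) \<le> (- l2 / 2) * (T x)\<^sup>2 + D' * Y x ^ 4"
      proof -
        have "(V x)\<^sup>2 \<le> (3 * Y x)\<^sup>2" using YV(3)[OF x] V by (intro power_mono) auto
        then have "2 * \<bar>T x\<bar> * (D * (V x)\<^sup>2) \<le> 2 * \<bar>T x\<bar> * (D * (9 * (Y x)\<^sup>2))"
          using D by (intro mult_left_mono) (auto simp: power_mult_distrib)
        also have "\<dots> \<le> (- l2 / 2) * (T x)\<^sup>2 + D' * Y x ^ 4"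
        proof -
          have "0 \<le> ((- l2) * \<bar>T x\<bar> - 18 * D * (Y x)\<^sup>2)\<^sup>2" by simp
          also have "\<dots> = l2\<^sup>2 * (T x)\<^sup>2 + 324 * D\<^sup>2 * Y x ^ 4 - (- l2) * 2 * (2 * \<bar>T x\<bar> * (D * (9 * (Y x)\<^sup>2)))"
            by (simp add: power2_diff power_mult_distrib power_even_abs numeral_eq_Suc algebra_simps abs_mult_self_eq)
          finally have "(- l2) * 2 * (2 * \<bar>T x\<bar> * (D * (9 * (Y x)\<^sup>2))) \<le> l2\<^sup>2 * (T x)\<^sup>2 + 324 * D\<^sup>2 * Y x ^ 4" by simp
          also have "\<dots> = (- l2) * 2 * ((- l2 / 2) * (T x)\<^sup>2 + D' * Y x ^ 4)"
            using l2 by (simp add: D'_def field_simps power2_eq_square)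
          finally show ?thesis using l2 by (simp only: mult_le_cancel_left_pos)
        qed
        finally show ?thesis .
      qed
      have t: "2 * T x * T' x \<le> l2 * (T x)\<^sup>2 + D' * Y x ^ 4"
        using t0 t1 t2 by (simp add: algebra_simps)
      have y4: "D' * Y x ^ 4 \<le> (a / 6) * Y x ^ 3"
      proof -
        have "Y x \<le> 3 * \<sigma>" using YV(2)[OF x] V by linarith
        then have "D' * Y x * Y x ^ 3 \<le> D' * (3 * \<sigma>) * Y x ^ 3"
          using D' YV(1)[OF x] by (intro mult_right_mono mult_left_mono) auto
        also have "\<dots> \<le> (a / 6) * Y x ^ 3" using s5 YV(1)[OF x] by (intro mult_right_mono) auto
        finally show ?thesis by (simp add: power_Suc2[symmetric] numeral_eq_Suc mult.assoc)
      qed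
      \<comment> \<open>T is damped at a quadratic rate, V only at a cubic one. The former is
        weakened to match, so that one inequality for E covers both.\<close>
      have T3: "\<bar>T x\<bar> ^ 3 \<le> (T x)\<^sup>2"
      proof -
        have "\<bar>T x\<bar> ^ 3 = \<bar>T x\<bar> * \<bar>T x\<bar>\<^sup>2" by (simp add: numeral_eq_Suc)
        also have "\<dots> \<le> 1 * \<bar>T x\<bar>\<^sup>2" using T le(1) by (intro mult_right_mono) auto
        finally show ?thesis by simp
      qed
      have "E' x \<le> - (a / 6) * Y x ^ 3 + l2 * (T x)\<^sup>2"
        unfolding E'_def using y t y4 by linarith
      also have "\<dots> \<le> - c * Y x ^ 3 + - c * \<bar>T x\<bar> ^ 3"
      proof (rule add_mono)
        show "- (a / 6) * Y x ^ 3 \<le> - c * Y x ^ 3" 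
          using YV(1)[OF x] by (intro mult_right_mono) (auto simp: c_def)
        have "c * \<bar>T x\<bar> ^ 3 \<le> (- l2) * (T x)\<^sup>2" using T3 c l2 by (intro mult_mono) (auto simp: c_def)
        then show "l2 * (T x)\<^sup>2 \<le> - c * \<bar>T x\<bar> ^ 3" by simp
      qed
      finally have E1: "E' x \<le> - c * (Y x ^ 3 + \<bar>T x\<bar> ^ 3)" by (simp add: algebra_simps)
      \<comment> \<open>E \<le> 2 m^2 and sqrt 2 \<le> 3/2 give E sqrt E \<le> 3 m^3, and m^3 is one
        of the two cubes in \<open>E1\<close>. Hence the rate c / 3, which is written 2 (c / 6) to
        fit \<open>algebraic_decay\<close>.\<close>
      define m where "m = max (Y x) \<bar>T x\<bar>"
      have m: "m \<ge> 0" "Y x \<le> m" "\<bar>T x\<bar> \<le> m" by (auto simp: m_def)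
      have Em: "E x \<le> 2 * m\<^sup>2" unfolding E_def
        using power_mono[OF m(2) YV(1)[OF x], of 2] power_mono[OF m(3), of 2] by simp
      have "E x \<le> 9 / 4 * m\<^sup>2" using Em zero_le_power2[of m] by linarith
      also have "\<dots> = (3 / 2 * m)\<^sup>2" by (simp add: power2_eq_square)
      finally have "sqrt (E x) \<le> sqrt ((3 / 2 * m)\<^sup>2)" by (rule real_sqrt_le_mono)
      then have sm: "sqrt (E x) \<le> 3 / 2 * m" using m by (simp add: real_sqrt_unique)
      have "E x * sqrt (E x) \<le> (2 * m\<^sup>2) * (3 / 2 * m)"
        using Em sm m by (intro mult_mono) (auto simp: E_def)
      also have "\<dots> = 3 * m ^ 3" by (simp add: power2_eq_square power3_eq_cube)
      also have "m ^ 3 \<le> Y x ^ 3 + \<bar>T x\<bar> ^ 3"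
        using YV(1)[OF x] by (auto simp: m_def max_def)
      finally have "E x * sqrt (E x) \<le> 3 * (Y x ^ 3 + \<bar>T x\<bar> ^ 3)" by simp
      then have "c * (E x * sqrt (E x)) \<le> c * (3 * (Y x ^ 3 + \<bar>T x\<bar> ^ 3))" using c by (intro mult_left_mono) auto
      then show "E' x \<le> - (2 * (c / 6) * E x * sqrt (E x))" using E1 by (simp add: algebra_simps)
    qed
    have Ec: "continuous_on {0..\<tau>} E" unfolding E_def Y_def \<psi>_def by (intro continuous_intros Vc Tc)
    have fin: "sqrt (E \<tau>) * (1 + c / 6 * sqrt (E 0) * \<tau>) \<le> sqrt (E 0)"
      by (rule algebraic_decay[OF Ec \<tau> _ _ Ed]) (use c in \<open>auto simp: E_def\<close>)
    have "sqrt (E 0) \<le> \<bar>Y 0\<bar> + \<bar>T 0\<bar>" unfolding E_def by (rule sqrt_sum_squares_le_sum_abs)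
    then have 1: "sqrt (E 0) \<le> 3 * V 0 + \<bar>T 0\<bar>" using YV[of 0] \<tau> by simp
    have "\<bar>Y \<tau>\<bar> \<le> sqrt (E \<tau>)" "\<bar>T \<tau>\<bar> \<le> sqrt (E \<tau>)" unfolding E_def
      using real_sqrt_sum_squares_ge1 real_sqrt_sum_squares_ge2 by (auto simp: real_le_rsqrt)
    then have "V \<tau> \<le> 3 * sqrt (E \<tau>)" "\<bar>T \<tau>\<bar> \<le> sqrt (E \<tau>)" using YV[of \<tau>] \<tau> by auto
    moreover have "0 \<le> sqrt (E \<tau>)" "0 \<le> sqrt (E 0)" by (simp_all add: E_def)
    ultimately show ?thesis using fin 1 by blast
  qed
  have "0 < c / 6" using c by simp
  then show ?thesis using main \<sigma> by blast
qed

section \<open>Orbits near the origin\<close>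


context planar_field
begin

text \<open>The linear part is left general: the supersonic case keeps the original unknowns and the
  full matrix, the other cases use a diagonal one. Derivatives are taken within the half line, so
  that x = 0 is included.\<close>

definition flow :: "real \<Rightarrow> real \<Rightarrow> real \<Rightarrow> real \<Rightarrow> (real \<Rightarrow> real) \<Rightarrow> (real \<Rightarrow> real) \<Rightarrow> real \<Rightarrow> bool" where
  "flow j11 j12 j21 j22 U T x \<longleftrightarrow>
     (U has_real_derivative (j11 * U x + j12 * T x + F1 (U x) (T x))) (at x within {0..}) \<and>
     (T has_real_derivative (j21 * U x + j22 * T x + F2 (U x) (T x))) (at x within {0..})"

lemma ball_flow:
  assumes R: "R > 0" "N * R \<le> 1/2"
  shows "\<exists>U T. U 0 = U0 \<and> T 0 = T0 \<and> continuous_on {0..} U \<and> continuous_on {0..} T \<and>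
    (\<forall>x\<ge>0. norm (U x, T x) \<le> R \<longrightarrow> flow j11 j12 j21 j22 U T x)"
proof -
  define f where "f p = (j11 * fst p + j12 * snd p + F1 (fst p) (snd p), j21 * fst p + j22 * snd p + F2 (fst p) (snd p))" for p
  define L where "L = \<bar>j11\<bar> + \<bar>j12\<bar> + \<bar>j21\<bar> + \<bar>j22\<bar> + 4 * (K * R)"
  have KR: "K * R \<ge> 0" using K R by simp
  have L: "L \<ge> 0" using KR by (simp add: L_def)
  have "L-lipschitz_on (cball 0 R) f"
  proof (rule lipschitz_onI[OF _ L])
    fix p q :: "real \<times> real" assume pq: "p \<in> cball 0 R" "q \<in> cball 0 R"
    have b: "\<bar>fst p\<bar> \<le> R" "\<bar>snd p\<bar> \<le> R" "\<bar>fst q\<bar> \<le> R" "\<bar>snd q\<bar> \<le> R"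
      using pq norm_fst_le[of "fst p" "snd p"] norm_snd_le[of "snd p" "fst p"]
        norm_fst_le[of "fst q" "snd q"] norm_snd_le[of "snd q" "fst q"] by (auto simp: dist_norm)
    define d1 where "d1 = \<bar>fst p - fst q\<bar>"
    define d2 where "d2 = \<bar>snd p - snd q\<bar>"
    have d: "d1 \<le> dist p q" "d2 \<le> dist p q"
      using dist_fst_le[of p q] dist_snd_le[of p q] by (auto simp: d1_def d2_def dist_real_def)
    note F = F_lipschitz[OF R(2) b]
    have lin: "\<bar>(j * fst p + j' * snd p) - (j * fst q + j' * snd q)\<bar> \<le> \<bar>j\<bar> * d1 + \<bar>j'\<bar> * d2" for j j'
      unfolding d1_def d2_def abs_mult[symmetric] by (rule order_trans[OF eq_refl abs_triangle_ineq]) (simp add: algebra_simps)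
    have "dist (f p) (f q) \<le> \<bar>fst (f p) - fst (f q)\<bar> + \<bar>snd (f p) - snd (f q)\<bar>"
      using sqrt_sum_squares_le_sum_abs[of "fst (f p) - fst (f q)" "snd (f p) - snd (f q)"]
      by (simp add: dist_prod_def dist_real_def)
    also have "\<dots> \<le> (\<bar>j11\<bar> * d1 + \<bar>j12\<bar> * d2 + K * R * (d1 + d2)) + (\<bar>j21\<bar> * d1 + \<bar>j22\<bar> * d2 + K * R * (d1 + d2))"
    proof -
      have "\<bar>(A + u) - (A' + v)\<bar> \<le> a + b" if "\<bar>A - A'\<bar> \<le> a" "\<bar>u - v\<bar> \<le> b" for A A' u v a b :: real
        using that by linarith
      note c = this
      show ?thesis unfolding f_def fst_conv snd_conv
        by (rule add_mono; rule c; (rule lin | rule F[folded d1_def d2_def]))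
    qed
    also have "\<dots> \<le> L * dist p q"
    proof -
      have "\<bar>j11\<bar> * d1 \<le> \<bar>j11\<bar> * dist p q" "\<bar>j12\<bar> * d2 \<le> \<bar>j12\<bar> * dist p q"
        "\<bar>j21\<bar> * d1 \<le> \<bar>j21\<bar> * dist p q" "\<bar>j22\<bar> * d2 \<le> \<bar>j22\<bar> * dist p q"
        using d by (auto intro!: mult_left_mono)
      moreover have "K * R * (d1 + d2) \<le> K * R * (2 * dist p q)"
        using d KR by (intro mult_left_mono) auto
      ultimately show ?thesis unfolding L_def distrib_right by linarith
    qed
    finally show "dist (f p) (f q) \<le> L * dist p q" .
  qed
  moreover have "f 0 = 0" by (simp add: f_def F_0 zero_prod_def)
  ultimately obtain w where w: "w 0 = (U0, T0)" "continuous_on {0..} w"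
    "\<And>x. x \<ge> 0 \<Longrightarrow> norm (w x) \<le> R \<Longrightarrow> (w has_vector_derivative f (w x)) (at x within {0..})"
    using ball_lipschitz_flow[of L R f "(U0, T0)"] R by blast
  have "flow j11 j12 j21 j22 (\<lambda>x. fst (w x)) (\<lambda>x. snd (w x)) x" if x: "x \<ge> 0" "norm (w x) \<le> R" for x
  proof -
    have "(w has_vector_derivative f (w x)) (at x within {0..})" using w(3) x by simp
    then have "((\<lambda>x. fst (w x)) has_vector_derivative fst (f (w x))) (at x within {0..})"
      "((\<lambda>x. snd (w x)) has_vector_derivative snd (f (w x))) (at x within {0..})"
      by (auto intro: bounded_linear.has_vector_derivative bounded_linear_fst bounded_linear_snd)
    then show ?thesis
      by (simp add: flow_def f_def has_real_derivative_iff_has_vector_derivative)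
  qed
  moreover have "continuous_on {0..} (\<lambda>x. fst (w x))" "continuous_on {0..} (\<lambda>x. snd (w x))"
    by (intro continuous_intros w)+
  ultimately show ?thesis
    by (intro exI[of _ "\<lambda>x. fst (w x)"] exI[of _ "\<lambda>x. snd (w x)"]) (simp add: w(1))
qed

text \<open>The output of \<open>stable_manifold\<close> on a smaller interval. The three smallness
  conditions serve different ends: C r \<le> 1 gives \<bar>h t\<bar> \<le> \<bar>t\<bar>, N r \<le>
  1/2 keeps the field away from its singularity, and 4 (K r) \<le> - l2 lets the damping of T
  dominate the nonlinearity on the graph.\<close>

definition invariant_graph :: "real \<Rightarrow> real \<Rightarrow> (real \<Rightarrow> real) \<Rightarrow> (real \<Rightarrow> real) \<Rightarrow> bool" where
  "invariant_graph r C h h' \<longleftrightarrow> 0 < r \<and> 0 \<le> C \<and> C * r \<le> 1 \<and> N * r \<le> 1/2 \<and> 4 * (K * r) \<le> - l2 \<and>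
     continuous_on {-r<..<r} h' \<and>
     (\<forall>t. \<bar>t\<bar> < r \<longrightarrow> (h has_real_derivative h' t) (at t) \<and> \<bar>h t\<bar> \<le> C * t\<^sup>2 \<and> \<bar>h' t\<bar> \<le> C * \<bar>t\<bar> \<and>
        h' t * (l2 * t + F2 (h t) t) = l1 * h t + F1 (h t) t)"

lemma invariant_graph_abs_le:
  assumes "invariant_graph r C h h'" "\<bar>t\<bar> < r"
  shows "\<bar>h t\<bar> \<le> \<bar>t\<bar>"
proof -
  have *: "\<bar>h t\<bar> \<le> C * t\<^sup>2" "C * r \<le> 1" "0 \<le> C" using assms by (auto simp: invariant_graph_def)
  have "C * \<bar>t\<bar> \<le> 1" using * assms(2) mult_left_mono[of "\<bar>t\<bar>" r C] by simp
  then have "(C * \<bar>t\<bar>) * \<bar>t\<bar> \<le> 1 * \<bar>t\<bar>" by (intro mult_right_mono) auto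
  then show ?thesis using * by (simp add: power2_eq_square mult.assoc abs_mult_self_eq)
qed

lemma invariant_graph_exists: "\<exists>r C h h'. invariant_graph r C h h'"
proof -
  obtain r C h h' where *: "r > 0" "C \<ge> 0" "continuous_on {-r<..<r} h'"
     "\<And>t. \<bar>t\<bar> < r \<Longrightarrow> (h has_real_derivative h' t) (at t) \<and> \<bar>h t\<bar> \<le> C * t\<^sup>2 \<and> \<bar>h' t\<bar> \<le> C * \<bar>t\<bar> \<and>
        h' t * (l2 * t + F2 (h t) t) = l1 * h t + F1 (h t) t"
    using stable_manifold by metis
  define q where "q = min (min r (1 / (C + 1))) (min (1 / (2 * N)) (- l2 / (4 * (K + 1))))"
  have q: "q > 0" "q \<le> r" "q \<le> 1 / (C + 1)" "q \<le> 1 / (2 * N)" "q \<le> - l2 / (4 * (K + 1))"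
    using *(1,2) N K l2 by (auto simp: q_def intro!: divide_neg_pos)
  have "q * (C + 1) \<le> 1" using q(3) *(2) by (subst (asm) le_divide_eq) auto
  moreover have "q * (2 * N) \<le> 1" using q(4) N by (subst (asm) le_divide_eq) auto
  moreover have "q * (4 * (K + 1)) \<le> - l2" using q(5) K by (subst (asm) le_divide_eq) auto
  moreover have "continuous_on {-q<..<q} h'" using q by (intro continuous_on_subset[OF *(3)]) auto
  ultimately have "invariant_graph q C h h'"
    unfolding invariant_graph_def using q *(2) *(4) by (auto simp: algebra_simps)
  then show ?thesis by blast
qed

text \<open>On the graph the system is the single equation T' = l2 T + F2 (h T) T; once it is
  solved, invariance of the graph says that U = h T satisfies the other equation.\<close>

lemma graph_orbit:
  assumes ig: "invariant_graph r C h h'" and s: "\<bar>s\<bar> < r"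
  shows "\<exists>T. T 0 = s \<and> continuous_on {0..} T \<and> (\<forall>x\<ge>0. \<bar>T x\<bar> \<le> \<bar>s\<bar> * exp (l2 / 2 * x) \<and> flow l1 0 0 l2 (\<lambda>x. h (T x)) T x)"
proof -
  have ig': "0 < r" "0 \<le> C" "C * r \<le> 1" "N * r \<le> 1/2" "4 * (K * r) \<le> - l2"
    "\<And>t. \<bar>t\<bar> < r \<Longrightarrow> (h has_real_derivative h' t) (at t)" "\<And>t. \<bar>t\<bar> < r \<Longrightarrow> \<bar>h' t\<bar> \<le> C * \<bar>t\<bar>"
    "\<And>t. \<bar>t\<bar> < r \<Longrightarrow> h' t * (l2 * t + F2 (h t) t) = l1 * h t + F1 (h t) t"
    "\<And>t. \<bar>t\<bar> < r \<Longrightarrow> \<bar>h t\<bar> \<le> C * t\<^sup>2"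
    using ig by (auto simp: invariant_graph_def)
  \<comment> \<open>Strictly between \<bar>s\<bar> and r: the closed ball lies inside the open
    domain of h, and the orbit starts in its interior.\<close>
  define R where "R = (\<bar>s\<bar> + r) / 2"
  have R: "R > 0" "R < r" "\<bar>s\<bar> < R" using s ig'(1) by (auto simp: R_def)
  note hle = invariant_graph_abs_le[OF ig]
  define f where "f t = l2 * t + F2 (h t) t" for t
  have hl: "\<bar>h t - h u\<bar> \<le> 1 * \<bar>t - u\<bar>" if tu: "\<bar>t\<bar> \<le> R" "\<bar>u\<bar> \<le> R" for t u
  proof -
    have "norm (h t - h u) \<le> 1 * norm (t - u)"
    proof (rule field_differentiable_bound[of "{-R..R}" h h'])
      fix z assume z: "z \<in> {-R..R}"
      then have z': "\<bar>z\<bar> < r" using R by auto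
      show "(h has_field_derivative h' z) (at z within {-R..R})"
        using ig'(6)[OF z'] by (rule has_field_derivative_at_within)
      have "\<bar>h' z\<bar> \<le> C * r" using ig'(7)[OF z'] mult_left_mono[of "\<bar>z\<bar>" r C] z' ig'(2) by simp
      then show "norm (h' z) \<le> 1" using ig'(3) by simp
    qed (use tu in auto)
    then show ?thesis by simp
  qed
  have NR: "N * R \<le> 1/2" using R(2) ig'(4) N by (smt (verit) mult_left_mono)
  have KR: "K * R \<ge> 0" using K R by simp
  have "(- l2 + 2 * (K * R))-lipschitz_on (cball 0 R) f"
  proof (rule lipschitz_onI)
    fix t u :: real assume "t \<in> cball 0 R" "u \<in> cball 0 R"
    then have tu: "\<bar>t\<bar> \<le> R" "\<bar>u\<bar> \<le> R" by auto
    then have htu: "\<bar>h t\<bar> \<le> R" "\<bar>h u\<bar> \<le> R" using hle[of t] hle[of u] R by auto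
    have "\<bar>F2 (h t) t - F2 (h u) u\<bar> \<le> K * R * (\<bar>h t - h u\<bar> + \<bar>t - u\<bar>)"
      using F_lipschitz(2)[OF NR htu(1) tu(1) htu(2) tu(2)] .
    also have "\<dots> \<le> K * R * (2 * \<bar>t - u\<bar>)" using hl[OF tu] KR by (intro mult_left_mono) auto
    finally have 1: "\<bar>F2 (h t) t - F2 (h u) u\<bar> \<le> 2 * (K * R) * \<bar>t - u\<bar>" by simp
    have "\<bar>l2 * t - l2 * u\<bar> = - l2 * \<bar>t - u\<bar>"
      using l2 by (simp add: right_diff_distrib[symmetric] abs_mult)
    then show "dist (f t) (f u) \<le> (- l2 + 2 * (K * R)) * dist t u"
      using 1 unfolding f_def dist_real_def distrib_right by linarith
  qed (use l2 KR in auto)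
  moreover have h0: "h 0 = 0" using hle[of 0] ig'(1) by simp
  then have "f 0 = 0" by (simp add: f_def F_0)
  ultimately obtain T where T: "T 0 = s" "continuous_on {0..} T"
    "\<And>x. x \<ge> 0 \<Longrightarrow> norm (T x) \<le> R \<Longrightarrow> (T has_vector_derivative f (T x)) (at x within {0..})"
    using ball_lipschitz_flow[of _ R f s] R by blast
  have Td: "(T has_real_derivative f (T x)) (at x within {0..})" if "x \<ge> 0" "\<bar>T x\<bar> \<le> R" for x
    using T(3)[of x] that by (simp add: has_real_derivative_iff_has_vector_derivative)
  \<comment> \<open>The nonlinearity uses up at most half of the damping 2 l2 t^2, so T^2 decays at
    rate l2 and \<bar>T\<bar> at rate l2 / 2.\<close>
  have tf: "2 * t * f t \<le> l2 * t\<^sup>2" if t: "\<bar>t\<bar> \<le> R" for t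
  proof -
    have "N * \<bar>t\<bar> \<le> N * R" using t N by (intro mult_left_mono) auto
    then have "N * \<bar>t\<bar> \<le> 1/2" using NR by linarith
    then have "\<bar>F2 (h t) t\<bar> \<le> K * \<bar>t\<bar> * (\<bar>h t\<bar> + \<bar>t\<bar>)" using hle[of t] t R by (intro F_bound) auto
    also have "\<dots> \<le> K * \<bar>t\<bar> * (2 * \<bar>t\<bar>)" using hle[of t] t R K by (intro mult_left_mono) auto
    finally have "\<bar>t\<bar> * \<bar>F2 (h t) t\<bar> \<le> \<bar>t\<bar> * (K * \<bar>t\<bar> * (2 * \<bar>t\<bar>))" by (intro mult_left_mono) auto
    also have "\<dots> = (2 * (K * \<bar>t\<bar>)) * t\<^sup>2" by (simp add: power2_eq_square abs_mult_self_eq)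
    also have "\<dots> \<le> (- l2 / 2) * t\<^sup>2"
    proof (rule mult_right_mono)
      have "K * \<bar>t\<bar> \<le> K * r" using t R K by (intro mult_left_mono) auto
      then show "2 * (K * \<bar>t\<bar>) \<le> - l2 / 2" using ig'(5) by simp
    qed simp
    finally have "\<bar>t * F2 (h t) t\<bar> \<le> (- l2 / 2) * t\<^sup>2" unfolding abs_mult .
    then have "t * F2 (h t) t \<le> (- l2 / 2) * t\<^sup>2" by linarith
    then show ?thesis by (simp add: f_def algebra_simps power2_eq_square)
  qed
  have decay: "\<bar>T \<tau>\<bar> \<le> \<bar>s\<bar> * exp (l2 / 2 * \<tau>)" if \<tau>: "\<tau> \<ge> 0" and in_R: "\<And>x. 0 \<le> x \<Longrightarrow> x \<le> \<tau> \<Longrightarrow> \<bar>T x\<bar> \<le> R" for \<tau>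
  proof -
    have "(T \<tau>)\<^sup>2 \<le> exp (l2 * (\<tau> - 0)) * (T 0)\<^sup>2"
    proof (rule gronwall_decay[OF _ \<tau>])
      show "continuous_on {0..\<tau>} (\<lambda>x. (T x)\<^sup>2)" by (intro continuous_intros continuous_on_subset[OF T(2)]) auto
      fix x assume x: "0 < x" "x < \<tau>"
      have "at x within {0..} = at x" using x by (intro at_within_interior) auto
      then have "(T has_real_derivative f (T x)) (at x)" using Td[of x] in_R[of x] x by simp
      then show "((\<lambda>x. (T x)\<^sup>2) has_real_derivative 2 * T x * f (T x)) (at x) \<and> 2 * T x * f (T x) \<le> l2 * (T x)\<^sup>2"
        using tf[of "T x"] in_R[of x] x by (auto intro!: derivative_eq_intros)
    qed
    also have "\<dots> = (\<bar>s\<bar> * exp (l2 / 2 * \<tau>))\<^sup>2"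
      by (simp add: T(1) power_mult_distrib exp_double[symmetric])
    finally show ?thesis using abs_le_square_iff[of "T \<tau>" "\<bar>s\<bar> * exp (l2 / 2 * \<tau>)"]
      by (simp add: abs_mult)
  qed
  have "\<bar>T x\<bar> < R" if "x \<ge> 0" for x
  proof (rule trapping[OF _ _ _ that, where \<phi>="\<lambda>x. \<bar>T x\<bar>"])
    show "continuous_on {0..} (\<lambda>x. \<bar>T x\<bar>)" by (intro continuous_intros T)
    show "\<bar>T 0\<bar> < R" using T R by simp
    fix \<tau> :: real assume \<tau>: "\<tau> \<ge> 0" and *: "\<And>x. 0 \<le> x \<Longrightarrow> x \<le> \<tau> \<Longrightarrow> \<bar>T x\<bar> \<le> R"
    have "\<bar>T \<tau>\<bar> \<le> \<bar>s\<bar> * exp (l2 / 2 * \<tau>)" using decay[OF \<tau> *] .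
    also have "\<dots> \<le> \<bar>s\<bar> * 1" using l2 \<tau> by (intro mult_left_mono) (auto simp: mult_nonpos_nonneg)
    finally show "\<bar>T \<tau>\<bar> < R" using R by simp
  qed
  then have TR: "\<bar>T x\<bar> \<le> R" if "x \<ge> 0" for x using that by (simp add: less_imp_le)
  have "flow l1 0 0 l2 (\<lambda>x. h (T x)) T x" if x: "x \<ge> 0" for x
  proof -
    have t: "\<bar>T x\<bar> < r" using TR[OF x] R by simp
    have "((\<lambda>x. h (T x)) has_real_derivative h' (T x) * f (T x)) (at x within {0..})"
      using DERIV_chain2[OF ig'(6)[OF t] Td[OF x TR[OF x]]] .
    then show ?thesis using Td[OF x TR[OF x]] ig'(8)[OF t] by (simp add: flow_def f_def)
  qed
  then show ?thesis using T decay TR by (intro exI[of _ T]) auto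
qed


text \<open>Put V = U - h T. For l1 = 0 invariance says h' (l2 T + F2 (h T) T) = F1 (h T) T, so V'
  is F1 (U, T) - F1 (h T, T) minus h' times the same difference of F2. Every term thus carries a
  factor V, also the error; a = minus the coefficient of U^2 and b = that of U T in F1.\<close>

lemma center_estimate:
  assumes ig: "invariant_graph r C h h'" and l10: "l1 = 0"
  defines "a \<equiv> - (A1 * \<alpha> * \<alpha>' + B1 * \<alpha>\<^sup>2)" and "b \<equiv> A1 * (\<alpha> * \<beta>' + \<beta> * \<alpha>') + 2 * B1 * \<alpha> * \<beta>"
  shows "\<exists>D\<ge>0. \<forall>U T. \<bar>T\<bar> < r \<longrightarrow> \<bar>U - h T\<bar> + \<bar>T\<bar> \<le> r \<longrightarrow>
    \<bar>F1 U T - h' T * (l2 * T + F2 U T) - (U - h T) * (b * T - a * (U - h T))\<bar>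
      \<le> D * \<bar>U - h T\<bar> * ((U - h T)\<^sup>2 + T\<^sup>2) \<and>
    \<bar>F2 U T\<bar> \<le> D * ((U - h T)\<^sup>2 + T\<^sup>2)"
proof -
  have ig': "0 < r" "0 \<le> C" "N * r \<le> 1/2" using ig by (auto simp: invariant_graph_def)
  define D where "D = 2 * (2 * \<bar>a\<bar> * C + 12 * \<bar>A1\<bar> * N ^ 3 + C * K) + 4 * K"
  have D: "D \<ge> 0" unfolding D_def using ig'(2) N K by (auto intro!: add_nonneg_nonneg mult_nonneg_nonneg)
  have "\<bar>F1 U T - h' T * (l2 * T + F2 U T) - (U - h T) * (b * T - a * (U - h T))\<bar>
      \<le> D * \<bar>U - h T\<bar> * ((U - h T)\<^sup>2 + T\<^sup>2) \<and> \<bar>F2 U T\<bar> \<le> D * ((U - h T)\<^sup>2 + T\<^sup>2)"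
    if T: "\<bar>T\<bar> < r" and UT: "\<bar>U - h T\<bar> + \<bar>T\<bar> \<le> r" for U T
  proof -
    define H where "H = h T"
    define V where "V = U - H"
    define e where "e = \<bar>V\<bar> + \<bar>T\<bar>"
    have H: "\<bar>H\<bar> \<le> \<bar>T\<bar>" "\<bar>H\<bar> \<le> C * T\<^sup>2" "\<bar>h' T\<bar> \<le> C * \<bar>T\<bar>" "h' T * (l2 * T + F2 H T) = F1 H T"
      using ig[unfolded invariant_graph_def] invariant_graph_abs_le[OF ig T] T l10 by (auto simp: H_def)
    have e: "e \<le> r" "\<bar>T\<bar> \<le> e" "\<bar>U\<bar> \<le> e" "\<bar>H\<bar> \<le> e" "e \<ge> 0"
      using UT H(1) by (auto simp: e_def V_def H_def)
    have Ne: "N * e \<le> 1/2" using mult_left_mono[OF e(1), of N] N ig'(3) by linarith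
    have e2: "e\<^sup>2 \<le> 2 * (V\<^sup>2 + T\<^sup>2)"
      using sum_squares_bound[of "\<bar>V\<bar>" "\<bar>T\<bar>"] by (simp add: e_def power2_sum)
    have T2: "T\<^sup>2 \<le> e\<^sup>2" using power_mono[OF e(2), of 2] by simp
    let ?x = "\<alpha> * U + \<beta> * T" and ?s = "\<alpha>' * U + \<beta>' * T" and ?y = "\<alpha> * H + \<beta> * T" and ?t = "\<alpha>' * H + \<beta>' * T"
    define c where "c = ?x\<^sup>2 * ?s / (1 - ?x) - ?y\<^sup>2 * ?t / (1 - ?y)"
    have "\<bar>c\<bar> \<le> 12 * (N * e)\<^sup>2 * (\<bar>?x - ?y\<bar> + \<bar>?s - ?t\<bar>)" unfolding c_def
      by (rule cubic_lipschitz[OF Ne]) (rule coords_le; rule e)+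
    also have "\<dots> \<le> 12 * (N * e)\<^sup>2 * (N * (\<bar>U - H\<bar> + \<bar>T - T\<bar>))"
      by (intro mult_left_mono coords_diff_le) auto
    also have "\<dots> = 12 * N ^ 3 * e\<^sup>2 * \<bar>V\<bar>" by (simp add: V_def power2_eq_square power3_eq_cube)
    finally have c: "\<bar>c\<bar> \<le> 12 * N ^ 3 * e\<^sup>2 * \<bar>V\<bar>" .
    have nz: "1 - ?x \<noteq> 0" "1 - ?y \<noteq> 0"
      using coords_le(1)[OF e(3,2)] coords_le(1)[OF e(4,2)] Ne by auto
    \<comment> \<open>x s / (1 - x) = x s + x^2 s / (1 - x) separates the exact quadratic part from
      a cubic remainder.\<close>
    have qs: "quad A B x s = A * x * s + B * x\<^sup>2 + A * (x\<^sup>2 * s / (1 - x))" if "1 - x \<noteq> 0" for A B x s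
      using that by (simp add: quad_def field_simps power2_eq_square)
    \<comment> \<open>Insert U = H + V into the quadratic form of F1. The mixed term - 2 a H V is of
      third order because H = O(T^2).\<close>
    have F1d: "F1 U T - F1 H T = V * (b * T - a * V) - 2 * a * H * V + A1 * c"
      unfolding F1_def qs[OF nz(1)] qs[OF nz(2)] c_def V_def a_def b_def
      by (simp add: algebra_simps power2_eq_square)
    have F2d: "\<bar>F2 U T - F2 H T\<bar> \<le> K * e * \<bar>V\<bar>"
      using F_lipschitz(2)[OF Ne e(3,2,4,2)] by (simp add: V_def)
    have 1: "\<bar>2 * a * H * V\<bar> \<le> (2 * \<bar>a\<bar> * C) * (e\<^sup>2 * \<bar>V\<bar>)"
    proof -
      have "\<bar>H\<bar> \<le> C * e\<^sup>2" using H(2) mult_left_mono[OF T2 ig'(2)] by linarith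
      then have "2 * \<bar>a\<bar> * (\<bar>H\<bar> * \<bar>V\<bar>) \<le> 2 * \<bar>a\<bar> * ((C * e\<^sup>2) * \<bar>V\<bar>)"
        by (intro mult_left_mono mult_right_mono) auto
      then show ?thesis by (simp add: abs_mult mult_ac)
    qed
    have 2: "\<bar>A1 * c\<bar> \<le> (12 * \<bar>A1\<bar> * N ^ 3) * (e\<^sup>2 * \<bar>V\<bar>)"
      using mult_left_mono[OF c, of "\<bar>A1\<bar>"] by (simp add: abs_mult mult_ac)
    have 3: "\<bar>h' T * (F2 U T - F2 H T)\<bar> \<le> (C * K) * (e\<^sup>2 * \<bar>V\<bar>)"
    proof -
      have "\<bar>h' T\<bar> \<le> C * e" using H(3) mult_left_mono[OF e(2) ig'(2)] by linarith
      then have "\<bar>h' T\<bar> * \<bar>F2 U T - F2 H T\<bar> \<le> (C * e) * (K * e * \<bar>V\<bar>)"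
        using F2d ig'(2) e by (intro mult_mono) auto
      then show ?thesis by (simp add: abs_mult mult_ac power2_eq_square)
    qed
    have "F1 U T - h' T * (l2 * T + F2 U T) - V * (b * T - a * V)
      = (- (2 * a * H * V)) + A1 * c + (- (h' T * (F2 U T - F2 H T)))"
      using F1d H(4) by (simp add: algebra_simps)
    then have "\<bar>F1 U T - h' T * (l2 * T + F2 U T) - V * (b * T - a * V)\<bar>
      \<le> (2 * \<bar>a\<bar> * C) * (e\<^sup>2 * \<bar>V\<bar>) + (12 * \<bar>A1\<bar> * N ^ 3) * (e\<^sup>2 * \<bar>V\<bar>) + (C * K) * (e\<^sup>2 * \<bar>V\<bar>)"
      using 1 2 3 by linarith
    also have "\<dots> = ((2 * \<bar>a\<bar> * C + 12 * \<bar>A1\<bar> * N ^ 3 + C * K) * \<bar>V\<bar>) * e\<^sup>2" by (simp add: algebra_simps)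
    also have "\<dots> \<le> ((2 * \<bar>a\<bar> * C + 12 * \<bar>A1\<bar> * N ^ 3 + C * K) * \<bar>V\<bar>) * (2 * (V\<^sup>2 + T\<^sup>2))"
      using e2 ig'(2) N K by (intro mult_left_mono mult_nonneg_nonneg add_nonneg_nonneg) auto
    also have "\<dots> = (2 * (2 * \<bar>a\<bar> * C + 12 * \<bar>A1\<bar> * N ^ 3 + C * K)) * (\<bar>V\<bar> * (V\<^sup>2 + T\<^sup>2))" by (simp add: algebra_simps)
    also have "\<dots> \<le> D * (\<bar>V\<bar> * (V\<^sup>2 + T\<^sup>2))"
      unfolding D_def using K by (intro mult_right_mono) auto
    finally have A: "\<bar>F1 U T - h' T * (l2 * T + F2 U T) - V * (b * T - a * V)\<bar> \<le> D * \<bar>V\<bar> * (V\<^sup>2 + T\<^sup>2)"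
      by (simp add: mult.assoc)
    have "\<bar>F2 U T\<bar> \<le> K * e * (\<bar>U\<bar> + \<bar>T\<bar>)" using F_bound(2)[OF Ne e(3,2)] .
    also have "\<dots> \<le> K * e * (2 * e)" using e K by (intro mult_left_mono) auto
    also have "\<dots> = 2 * K * e\<^sup>2" by (simp add: power2_eq_square)
    also have "\<dots> \<le> 2 * K * (2 * (V\<^sup>2 + T\<^sup>2))" using e2 K by (intro mult_left_mono) auto
    also have "\<dots> = (4 * K) * (V\<^sup>2 + T\<^sup>2)" by simp
    also have "\<dots> \<le> D * (V\<^sup>2 + T\<^sup>2)"
      unfolding D_def using ig'(2) N K
      by (intro mult_right_mono) (auto intro!: add_nonneg_nonneg mult_nonneg_nonneg)
    finally show ?thesis using A by (simp add: V_def H_def)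
  qed
  then show ?thesis using D by blast
qed

text \<open>\<open>neg\<close> states that U^2 enters U' with a negative coefficient. Above the
  graph V \<ge> 0 persists, so \<open>degenerate_node_decay\<close> applies as long as the orbit
  stays in a small ball, and its bound in turn confines the orbit to that ball.\<close>

lemma center_stable_orbit:
  assumes ig: "invariant_graph r C h h'" and l10: "l1 = 0" and neg: "A1 * \<alpha> * \<alpha>' + B1 * \<alpha>\<^sup>2 < 0"
  shows "\<exists>e>0. \<exists>C. \<forall>U0 T0. \<bar>U0\<bar> + \<bar>T0\<bar> < e \<longrightarrow> h T0 \<le> U0 \<longrightarrow>
    (\<exists>U T. U 0 = U0 \<and> T 0 = T0 \<and> continuous_on {0..} U \<and> continuous_on {0..} T \<and>
      (\<forall>x\<ge>0. flow 0 0 0 l2 U T x \<and>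
        \<bar>U x\<bar> + \<bar>T x\<bar> \<le> C * ((\<bar>U0\<bar> + \<bar>T0\<bar>) / (1 + (\<bar>U0\<bar> + \<bar>T0\<bar>) * x))))"
proof -
  have ig': "0 < r" "N * r \<le> 1/2" "\<And>t. \<bar>t\<bar> < r \<Longrightarrow> (h has_real_derivative h' t) (at t)"
    using ig by (auto simp: invariant_graph_def)
  define a where "a = - (A1 * \<alpha> * \<alpha>' + B1 * \<alpha>\<^sup>2)"
  define b where "b = A1 * (\<alpha> * \<beta>' + \<beta> * \<alpha>') + 2 * B1 * \<alpha> * \<beta>"
  have a: "a > 0" using neg by (simp add: a_def)
  obtain D where D: "D \<ge> 0" and DE: "\<And>U T. \<bar>T\<bar> < r \<Longrightarrow> \<bar>U - h T\<bar> + \<bar>T\<bar> \<le> r \<Longrightarrow>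
    \<bar>F1 U T - h' T * (l2 * T + F2 U T) - (U - h T) * (b * T - a * (U - h T))\<bar>
      \<le> D * \<bar>U - h T\<bar> * ((U - h T)\<^sup>2 + T\<^sup>2) \<and>
    \<bar>F2 U T\<bar> \<le> D * ((U - h T)\<^sup>2 + T\<^sup>2)"
    using center_estimate[OF ig l10, folded a_def b_def] by blast
  obtain \<sigma> k where \<sigma>: "\<sigma> > 0" and k: "k > 0" and dec: "\<And>\<tau> V T V' T'. \<tau> \<ge> 0 \<Longrightarrow> continuous_on {0..\<tau>} V \<Longrightarrow> continuous_on {0..\<tau>} T \<Longrightarrow>
    (\<And>x. 0 \<le> x \<Longrightarrow> x \<le> \<tau> \<Longrightarrow> 0 \<le> V x \<and> V x \<le> \<sigma> \<and> \<bar>T x\<bar> \<le> \<sigma>) \<Longrightarrow>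
    (\<And>x. 0 < x \<Longrightarrow> x < \<tau> \<Longrightarrow> (V has_real_derivative V' x) (at x) \<and> (T has_real_derivative T' x) (at x) \<and>
       \<bar>V' x - V x * (b * T x - a * V x)\<bar> \<le> D * V x * ((V x)\<^sup>2 + (T x)\<^sup>2) \<and>
       \<bar>T' x - l2 * T x\<bar> \<le> D * ((V x)\<^sup>2 + (T x)\<^sup>2)) \<Longrightarrow>
    (\<exists>S0 S. 0 \<le> S0 \<and> 0 \<le> S \<and> S0 \<le> 3 * V 0 + \<bar>T 0\<bar> \<and> V \<tau> \<le> 3 * S \<and> \<bar>T \<tau>\<bar> \<le> S \<and> S * (1 + k * S0 * \<tau>) \<le> S0)"
    using degenerate_node_decay[OF a l2 D, of b] by metis
  \<comment> \<open>In the ball of radius R one has \<bar>V\<bar> \<le> 2 R \<le> \<sigma> and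
    \<bar>V\<bar> + \<bar>T\<bar> \<le> 3 R \<le> r, which are the domains of the two estimates
    above.\<close>
  define R where "R = min (r / 4) (\<sigma> / 2)"
  have R: "R > 0" "4 * R \<le> r" "2 * R \<le> \<sigma>" using ig'(1) \<sigma> by (auto simp: R_def)
  have NR: "N * R \<le> 1/2"
  proof -
    have "N * R \<le> N * r" using R N by (intro mult_left_mono) auto
    then show ?thesis using ig'(2) by linarith
  qed
  note hle = invariant_graph_abs_le[OF ig]
  \<comment> \<open>With d = \<bar>U0\<bar> + \<bar>T0\<bar> one gets S0 \<le> 4 d and \<bar>U\<bar>
    + \<bar>T\<bar> \<le> 5 S \<le> 5 S0, hence the radius R / 20. The constant 5 (4 + 1 / k)
    collects S \<le> 4 d and S x \<le> 1 / k.\<close>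
  have "\<exists>U T. U 0 = U0 \<and> T 0 = T0 \<and> continuous_on {0..} U \<and> continuous_on {0..} T \<and>
      (\<forall>x\<ge>0. flow 0 0 0 l2 U T x \<and> \<bar>U x\<bar> + \<bar>T x\<bar> \<le> 5 * (4 + 1 / k) * ((\<bar>U0\<bar> + \<bar>T0\<bar>) / (1 + (\<bar>U0\<bar> + \<bar>T0\<bar>) * x)))"
    if small: "\<bar>U0\<bar> + \<bar>T0\<bar> < R / 20" and above: "h T0 \<le> U0" for U0 T0
  proof -
    define d where "d = \<bar>U0\<bar> + \<bar>T0\<bar>"
    have d: "d \<ge> 0" by (simp add: d_def)
    obtain U T where UT: "U 0 = U0" "T 0 = T0" "continuous_on {0..} U" "continuous_on {0..} T"
      "\<And>x. x \<ge> 0 \<Longrightarrow> norm (U x, T x) \<le> R \<Longrightarrow> flow 0 0 0 l2 U T x"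
      using ball_flow[OF R(1) NR, of U0 T0 0 0 0 l2] by blast
    have key: "\<exists>S0 S. 0 \<le> S0 \<and> 0 \<le> S \<and> S0 \<le> 4 * d \<and> \<bar>U \<tau>\<bar> + \<bar>T \<tau>\<bar> \<le> 5 * S \<and> S * (1 + k * S0 * \<tau>) \<le> S0"
      if \<tau>: "\<tau> \<ge> 0" and inR: "\<And>x. 0 \<le> x \<Longrightarrow> x \<le> \<tau> \<Longrightarrow> norm (U x, T x) \<le> R" for \<tau>
    proof -
      define V where "V x = U x - h (T x)" for x
      define V' where "V' x = F1 (U x) (T x) - h' (T x) * (l2 * T x + F2 (U x) (T x))" for x
      define T' where "T' x = l2 * T x + F2 (U x) (T x)" for x
      have box: "\<bar>U x\<bar> \<le> R" "\<bar>T x\<bar> \<le> R" "\<bar>T x\<bar> < r" "\<bar>h (T x)\<bar> \<le> \<bar>T x\<bar>" "\<bar>V x\<bar> \<le> 2 * R" "\<bar>U x - h (T x)\<bar> + \<bar>T x\<bar> \<le> r"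
        if x: "0 \<le> x" "x \<le> \<tau>" for x
      proof -
        show 1: "\<bar>U x\<bar> \<le> R" "\<bar>T x\<bar> \<le> R"
          using inR[OF x] norm_fst_le[of "U x" "T x"] norm_snd_le[of "T x" "U x"] by auto
        then show 2: "\<bar>T x\<bar> < r" using R by auto
        show 3: "\<bar>h (T x)\<bar> \<le> \<bar>T x\<bar>" using hle[OF 2] .
        show "\<bar>V x\<bar> \<le> 2 * R" "\<bar>U x - h (T x)\<bar> + \<bar>T x\<bar> \<le> r" using 1 3 R(2) R(1) unfolding V_def by linarith+
      qed
      have Tc: "continuous_on {0..\<tau>} T" using UT by (intro continuous_on_subset[OF UT(4)]) auto
      have hc: "continuous_on {-r<..<r} h"
      proof (rule continuous_at_imp_continuous_on, rule ballI)
        fix t assume "t \<in> {-r<..<r}"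
        then show "isCont h t" using ig'(3)[of t] by (intro DERIV_isCont[of h "h' t"]) auto
      qed
      have "continuous_on {0..\<tau>} (\<lambda>x. h (T x))"
      proof (rule continuous_on_compose2[OF hc Tc], rule image_subsetI)
        fix x assume "x \<in> {0..\<tau>}"
        then show "T x \<in> {-r<..<r}" using box(3)[of x] by auto
      qed
      then have Vc: "continuous_on {0..\<tau>} V" unfolding V_def
        by (intro continuous_intros continuous_on_subset[OF UT(3)]) auto
      have der: "(V has_real_derivative V' x) (at x)" "(T has_real_derivative T' x) (at x)" if x: "0 < x" "x < \<tau>" for x
      proof -
        have "at x within {0..} = at x" using x by (intro at_within_interior) auto
        then have f: "(U has_real_derivative F1 (U x) (T x)) (at x)" "(T has_real_derivative T' x) (at x)"
          using UT(5)[of x] inR[of x] x by (auto simp: flow_def T'_def)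
        show "(T has_real_derivative T' x) (at x)" by (rule f)
        have "((\<lambda>x. h (T x)) has_real_derivative h' (T x) * T' x) (at x)"
          using DERIV_chain2[OF ig'(3) f(2)] box(3)[of x] x by simp
        then show "(V has_real_derivative V' x) (at x)"
          unfolding V_def V'_def using f by (auto intro!: derivative_eq_intros simp: T'_def)
      qed
      have est: "\<bar>V' x - V x * (b * T x - a * V x)\<bar> \<le> D * \<bar>V x\<bar> * ((V x)\<^sup>2 + (T x)\<^sup>2)"
        "\<bar>T' x - l2 * T x\<bar> \<le> D * ((V x)\<^sup>2 + (T x)\<^sup>2)" if x: "0 \<le> x" "x \<le> \<tau>" for x
        using DE[OF box(3)[OF x] box(6)[OF x]] by (auto simp: V_def V'_def T'_def)
      define Q where "Q = \<bar>b\<bar> * R + a * (2 * R) + D * ((2 * R)\<^sup>2 + R\<^sup>2)"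
      have V'b: "\<bar>V' x\<bar> \<le> Q * \<bar>V x\<bar>" if x: "0 \<le> x" "x \<le> \<tau>" for x
      proof -
        have sq: "(V x)\<^sup>2 + (T x)\<^sup>2 \<le> (2 * R)\<^sup>2 + R\<^sup>2"
          using power_mono[OF box(5)[OF x], of 2] power_mono[OF box(2)[OF x], of 2] by simp
        have "\<bar>b * T x - a * V x\<bar> \<le> \<bar>b\<bar> * \<bar>T x\<bar> + a * \<bar>V x\<bar>"
          using abs_triangle_ineq4[of "b * T x" "a * V x"] a by (simp add: abs_mult)
        also have "\<dots> \<le> \<bar>b\<bar> * R + a * (2 * R)" using box[OF x] a by (intro add_mono mult_left_mono) auto
        finally have "\<bar>V x\<bar> * \<bar>b * T x - a * V x\<bar> \<le> \<bar>V x\<bar> * (\<bar>b\<bar> * R + a * (2 * R))" by (intro mult_left_mono) auto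
        moreover have "D * \<bar>V x\<bar> * ((V x)\<^sup>2 + (T x)\<^sup>2) \<le> D * \<bar>V x\<bar> * ((2 * R)\<^sup>2 + R\<^sup>2)"
          using sq D by (intro mult_left_mono) auto
        moreover have "\<bar>V' x\<bar> \<le> \<bar>V' x - V x * (b * T x - a * V x)\<bar> + \<bar>V x\<bar> * \<bar>b * T x - a * V x\<bar>"
          unfolding abs_mult[symmetric] by linarith
        ultimately have "\<bar>V' x\<bar> \<le> D * \<bar>V x\<bar> * ((2 * R)\<^sup>2 + R\<^sup>2) + \<bar>V x\<bar> * (\<bar>b\<bar> * R + a * (2 * R))"
          using est(1)[OF x] by linarith
        then show ?thesis by (simp add: Q_def algebra_simps)
      qed
      have Vnn: "V x \<ge> 0" if x: "0 \<le> x" "x \<le> \<tau>" for x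
      proof (rule nonneg_of_gronwall[where s=0 and t=x and V=V and V'=V' and K=Q])
        show "continuous_on {0..x} V" using x by (intro continuous_on_subset[OF Vc]) auto
        show "V 0 \<ge> 0" using above by (simp add: V_def UT)
      qed (use x der V'b in auto)
      have "\<exists>S0 S. 0 \<le> S0 \<and> 0 \<le> S \<and> S0 \<le> 3 * V 0 + \<bar>T 0\<bar> \<and> V \<tau> \<le> 3 * S \<and> \<bar>T \<tau>\<bar> \<le> S \<and> S * (1 + k * S0 * \<tau>) \<le> S0"
      proof (rule dec[OF \<tau> Vc Tc, of V' T'])
        fix x assume x: "0 \<le> x" "x \<le> \<tau>"
        show "0 \<le> V x \<and> V x \<le> \<sigma> \<and> \<bar>T x\<bar> \<le> \<sigma>" using Vnn[OF x] box(2,5)[OF x] R by auto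
      next
        fix x assume x: "0 < x" "x < \<tau>"
        then show "(V has_real_derivative V' x) (at x) \<and> (T has_real_derivative T' x) (at x) \<and>
          \<bar>V' x - V x * (b * T x - a * V x)\<bar> \<le> D * V x * ((V x)\<^sup>2 + (T x)\<^sup>2) \<and>
          \<bar>T' x - l2 * T x\<bar> \<le> D * ((V x)\<^sup>2 + (T x)\<^sup>2)"
          using der[OF x] est[of x] Vnn[of x] by simp
      qed
      then obtain S0 S where S0: "0 \<le> S0" and S: "0 \<le> S" "S0 \<le> 3 * V 0 + \<bar>T 0\<bar>" "V \<tau> \<le> 3 * S" "\<bar>T \<tau>\<bar> \<le> S" "S * (1 + k * S0 * \<tau>) \<le> S0"
        by blast
      have "V 0 \<le> \<bar>U0\<bar> + \<bar>T0\<bar>" using box(4)[of 0] \<tau> unfolding V_def UT by linarith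
      then have "S0 \<le> 4 * d" using S(2) by (simp add: d_def UT)
      moreover have "\<bar>U \<tau>\<bar> \<le> V \<tau> + \<bar>h (T \<tau>)\<bar>" using Vnn[of \<tau>] \<tau> by (simp add: V_def)
      then have "\<bar>U \<tau>\<bar> + \<bar>T \<tau>\<bar> \<le> 5 * S" using S box(4)[of \<tau>] \<tau> by linarith
      ultimately show ?thesis using S0 S by blast
    qed
    have nrm: "norm (U x, T x) \<le> \<bar>U x\<bar> + \<bar>T x\<bar>" for x
      using norm_Pair_le[of "U x" "T x"] by simp
    have S_le: "S \<le> S0" if "0 \<le> S0" "0 \<le> S" "S * (1 + k * S0 * \<tau>) \<le> S0" "\<tau> \<ge> 0" for S S0 \<tau>
    proof -
      have "S * 1 \<le> S * (1 + k * S0 * \<tau>)" using that k by (intro mult_left_mono) auto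
      then show ?thesis using that by simp
    qed
    have trap: "norm (U x, T x) < R" if "x \<ge> 0" for x
    proof (rule trapping[OF _ _ _ that, where \<phi>="\<lambda>x. norm (U x, T x)"])
      show "continuous_on {0..} (\<lambda>x. norm (U x, T x))" by (intro continuous_intros UT)
      show "norm (U 0, T 0) < R" using nrm[of 0] small R by (simp add: UT)
      fix \<tau> :: real assume \<tau>: "\<tau> \<ge> 0" and *: "\<And>x. 0 \<le> x \<Longrightarrow> x \<le> \<tau> \<Longrightarrow> norm (U x, T x) \<le> R"
      obtain S0 S where S0: "0 \<le> S0" and S: "0 \<le> S" "S0 \<le> 4 * d" "\<bar>U \<tau>\<bar> + \<bar>T \<tau>\<bar> \<le> 5 * S" "S * (1 + k * S0 * \<tau>) \<le> S0"
        using key[OF \<tau> *] by blast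
      have "S \<le> 4 * d" using S_le[OF S0 S(1,4) \<tau>] S(2) by simp
      then have "norm (U \<tau>, T \<tau>) \<le> 20 * d" using order_trans[OF nrm[of \<tau>] S(3)] by linarith
      also have "\<dots> < R" using small by (simp add: d_def)
      finally show "norm (U \<tau>, T \<tau>) < R" .
    qed
    have "\<bar>U x\<bar> + \<bar>T x\<bar> \<le> 5 * (4 + 1 / k) * (d / (1 + d * x))" if x: "x \<ge> 0" for x
    proof -
      obtain S0 S where S0: "0 \<le> S0" and S: "0 \<le> S" "S0 \<le> 4 * d" "\<bar>U x\<bar> + \<bar>T x\<bar> \<le> 5 * S" "S * (1 + k * S0 * x) \<le> S0"
        using key[OF x] trap by (meson less_imp_le)
      have SS: "S \<le> S0" using S_le[OF S0 S(1,4) x] .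
      \<comment> \<open>For large x the bound on S is independent of the initial size; multiplied by
        d it controls the second term of S (1 + d x) = S + d S x.\<close>
      have Skx: "S * k * x \<le> 1"
      proof (cases "S0 = 0")
        case True
        then show ?thesis using SS S(1) by simp
      next
        case False
        then have p: "S0 > 0" using SS S(1) by simp
        have "S0 * (S * k * x) \<le> S0 * 1" using S(1,4) by (simp add: algebra_simps)
        then show ?thesis using p by (simp only: mult_le_cancel_left_pos)
      qed
      have "S * (1 + d * x) = S + d * (S * x)" by (simp add: algebra_simps)
      also have "\<dots> \<le> 4 * d + d * (1 / k)"
      proof (intro add_mono mult_left_mono)
        show "S * x \<le> 1 / k" using Skx k by (simp add: field_simps)
      qed (use SS S d in auto)
      finally have "S * (1 + d * x) \<le> (4 + 1 / k) * d" by (simp add: algebra_simps)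
      then have "S \<le> (4 + 1 / k) * d / (1 + d * x)" using d x by (subst le_divide_eq) (auto simp: add_pos_nonneg)
      then have "5 * S \<le> 5 * ((4 + 1 / k) * d / (1 + d * x))" by simp
      also have "\<dots> = 5 * (4 + 1 / k) * (d / (1 + d * x))" by simp
      finally show ?thesis using S(3) by (rule order_trans[rotated])
    qed
    then show ?thesis using UT trap unfolding d_def by (intro exI[of _ U] exI[of _ T]) (auto simp: less_imp_le)
  qed
  moreover have "R / 20 > 0" using R by simp
  ultimately show ?thesis by blast
qed

end

section \<open>Uniform decay of all derivatives\<close>


lemma higher_deriv_cong_open:
  fixes f g :: "real \<Rightarrow> real"
  assumes "open S" "\<And>x. x \<in> S \<Longrightarrow> f x = g x" "x \<in> S"
  shows "(deriv ^^ k) f x = (deriv ^^ k) g x"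
  using assms(3)
proof (induction k arbitrary: x)
  case (Suc k)
  have "\<forall>\<^sub>F y in nhds x. (deriv ^^ k) f y = (deriv ^^ k) g y"
    using Suc assms(1) by (auto simp: eventually_nhds)
  then show ?case by (simp add: deriv_cong_ev)
qed (use assms(2) in simp)

text \<open>The decay classes: \<open>cls K n f\<close> means that for \<open>j \<le> K\<close> the \<open>j\<close>-th derivative of the family \<open>f\<close> is
  \<open>O(W (n + j))\<close>, uniformly over the parameter set \<open>A\<close>. With \<open>Z = 0\<close> the weights describe exponential
  decay, with \<open>Z = \<delta> / (1 + \<delta> x)\<close> each derivative gains a factor \<open>Z\<close>.\<close>

locale decay_weights =
  fixes A :: "'p set" and \<delta> :: "'p \<Rightarrow> real" and Z :: "'p \<Rightarrow> real \<Rightarrow> real" and c :: real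
  assumes \<delta>: "p \<in> A \<Longrightarrow> 0 \<le> \<delta> p" "p \<in> A \<Longrightarrow> \<delta> p \<le> 1"
    and Z: "p \<in> A \<Longrightarrow> x > 0 \<Longrightarrow> 0 \<le> Z p x" "p \<in> A \<Longrightarrow> x > 0 \<Longrightarrow> Z p x \<le> \<delta> p"
    and c: "c > 0"
begin

text \<open>Order 0 has weight 1, so that constants have order 0 and orders add under products. The
  exponential part is not raised to the power n: it stands for a remainder that gains nothing under
  differentiation.\<close>

definition W :: "nat \<Rightarrow> 'p \<Rightarrow> real \<Rightarrow> real" where
  "W n p x = (if n = 0 then 1 else Z p x ^ n + \<delta> p * exp (- c * x))"

lemma e01:
  assumes "p \<in> A" "x > 0"
  shows "0 \<le> \<delta> p * exp (- c * x)" "\<delta> p * exp (- c * x) \<le> \<delta> p" "\<delta> p * exp (- c * x) \<le> 1"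
proof -
  show "0 \<le> \<delta> p * exp (- c * x)" using \<delta>(1)[OF assms(1)] by simp
  have "exp (- c * x) \<le> 1" using c assms(2) by simp
  then show "\<delta> p * exp (- c * x) \<le> \<delta> p" using mult_left_mono[of "exp (- c * x)" 1 "\<delta> p"] \<delta>(1)[OF assms(1)] by simp
  then show "\<delta> p * exp (- c * x) \<le> 1" using \<delta>(2)[OF assms(1)] by simp
qed

lemma Z1: "p \<in> A \<Longrightarrow> x > 0 \<Longrightarrow> Z p x \<le> 1"
  using Z(2) \<delta>(2) by (meson order_trans)

lemma W_nonneg: "p \<in> A \<Longrightarrow> x > 0 \<Longrightarrow> 0 \<le> W n p x"
  using Z(1)[of p x] e01(1)[of p x] by (auto simp: W_def)

lemma W_Suc:
  assumes "p \<in> A" "x > 0"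
  shows "W (Suc n) p x \<le> 2 * W n p x"
proof (cases n)
  case 0
  then show ?thesis using Z1[OF assms] e01(3)[OF assms] by (simp add: W_def)
next
  case (Suc m)
  have "Z p x ^ Suc n \<le> Z p x ^ n" using Z(1)[OF assms] Z1[OF assms] by (intro power_decreasing) auto
  moreover have "0 \<le> Z p x ^ n" using Z(1)[OF assms] by simp
  ultimately show ?thesis using Suc e01(1)[OF assms] by (simp add: W_def)
qed

text \<open>All cross terms contain the exponential part and are absorbed by it, their other factors
  being at most 1; there are three of them.\<close>

lemma W_mult:
  assumes "p \<in> A" "x > 0"
  shows "W i p x * W j p x \<le> 3 * W (i + j) p x"
proof (cases "i = 0 \<or> j = 0")
  case True
  then show ?thesis using W_nonneg[OF assms, of i] W_nonneg[OF assms, of j] by (auto simp: W_def)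
next
  case False
  define d where "d = \<delta> p * exp (- c * x)"
  have d: "0 \<le> d" "d \<le> 1" using e01[OF assms] by (simp_all add: d_def)
  have z: "0 \<le> Z p x ^ i" "Z p x ^ i \<le> 1" "0 \<le> Z p x ^ j" "Z p x ^ j \<le> 1"
    using Z(1)[OF assms] Z1[OF assms] by (auto simp: power_le_one)
  have "(Z p x ^ i + d) * (Z p x ^ j + d) = Z p x ^ (i + j) + (Z p x ^ i * d + d * Z p x ^ j + d * d)"
    by (simp add: algebra_simps power_add)
  also have "\<dots> \<le> Z p x ^ (i + j) + (1 * d + d * 1 + d * 1)"
    using z d by (intro add_mono mult_mono) auto
  also have "\<dots> \<le> 3 * (Z p x ^ (i + j) + d)" using Z(1)[OF assms] by simp
  finally show ?thesis using False by (simp add: W_def d_def)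
qed

text \<open>The derivative is a witness rather than \<open>deriv\<close>, so closure properties are
  proved by exhibiting a formula and inducting on K. The constant is chosen before p and x, which is
  the uniformity in the boundary data.\<close>

primrec cls :: "nat \<Rightarrow> nat \<Rightarrow> ('p \<Rightarrow> real \<Rightarrow> real) \<Rightarrow> bool" where
  "cls 0 n f \<longleftrightarrow> (\<exists>C. \<forall>p\<in>A. \<forall>x>0. \<bar>f p x\<bar> \<le> C * W n p x)"
| "cls (Suc K) n f \<longleftrightarrow> (\<exists>C. \<forall>p\<in>A. \<forall>x>0. \<bar>f p x\<bar> \<le> C * W n p x) \<and>
     (\<exists>f'. (\<forall>p\<in>A. \<forall>x>0. (f p has_real_derivative f' p x) (at x)) \<and> cls K (Suc n) f')"

lemma cls_0D: "cls K n f \<Longrightarrow> cls 0 n f"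
  by (cases K) auto

lemma cls_0E:
  assumes "cls 0 n f"
  obtains C where "C \<ge> 0" "\<And>p x. p \<in> A \<Longrightarrow> x > 0 \<Longrightarrow> \<bar>f p x\<bar> \<le> C * W n p x"
proof -
  obtain C where C: "\<forall>p\<in>A. \<forall>x>0. \<bar>f p x\<bar> \<le> C * W n p x" using assms by auto
  have "\<bar>f p x\<bar> \<le> \<bar>C\<bar> * W n p x" if "p \<in> A" "x > 0" for p x
  proof -
    have "\<bar>f p x\<bar> \<le> C * W n p x" using C that by blast
    also have "\<dots> \<le> \<bar>C\<bar> * W n p x" using W_nonneg[OF that] by (intro mult_right_mono) auto
    finally show ?thesis .
  qed
  then show thesis by (intro that[of "\<bar>C\<bar>"]) auto
qed

lemma cls_SucI:
  assumes "cls 0 n f" "\<And>p x. p \<in> A \<Longrightarrow> x > 0 \<Longrightarrow> (f p has_real_derivative f' p x) (at x)" "cls K (Suc n) f'"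
  shows "cls (Suc K) n f"
  using assms by auto

lemma cls_SucE:
  assumes "cls (Suc K) n f"
  obtains f' where "\<And>p x. p \<in> A \<Longrightarrow> x > 0 \<Longrightarrow> (f p has_real_derivative f' p x) (at x)" "cls K (Suc n) f'"
proof -
  have "\<exists>f'. (\<forall>p\<in>A. \<forall>x>0. (f p has_real_derivative f' p x) (at x)) \<and> cls K (Suc n) f'"
    using assms by simp
  then show thesis using that by blast
qed

lemma cls_order: "cls K (Suc n) f \<Longrightarrow> cls K n f"
proof (induction K arbitrary: n f)
  case 0
  then obtain C where C: "C \<ge> 0" "\<And>p x. p \<in> A \<Longrightarrow> x > 0 \<Longrightarrow> \<bar>f p x\<bar> \<le> C * W (Suc n) p x" by (rule cls_0E) blast
  have "\<bar>f p x\<bar> \<le> (2 * C) * W n p x" if "p \<in> A" "x > 0" for p x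
    using C(2)[OF that] mult_left_mono[OF W_Suc[OF that, of n] C(1)] by simp
  then show ?case by auto
next
  case (Suc K)
  obtain f' where f': "\<And>p x. p \<in> A \<Longrightarrow> x > 0 \<Longrightarrow> (f p has_real_derivative f' p x) (at x)" "cls K (Suc (Suc n)) f'"
    using Suc.prems by (rule cls_SucE) blast
  have "cls 0 n f"
  proof -
    obtain C where C: "C \<ge> 0" "\<And>p x. p \<in> A \<Longrightarrow> x > 0 \<Longrightarrow> \<bar>f p x\<bar> \<le> C * W (Suc n) p x"
      using cls_0D[OF Suc.prems] by (rule cls_0E) blast
    have "\<bar>f p x\<bar> \<le> (2 * C) * W n p x" if "p \<in> A" "x > 0" for p x
      using C(2)[OF that] mult_left_mono[OF W_Suc[OF that, of n] C(1)] by simp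
    then show ?thesis by auto
  qed
  then show ?case using f'(1) Suc.IH[OF f'(2)] by (rule cls_SucI)
qed

lemma cls_Suc: "cls (Suc K) n f \<Longrightarrow> cls K n f"
proof (induction K arbitrary: n f)
  case 0
  then show ?case by auto
next
  case (Suc K)
  obtain f' where f': "\<And>p x. p \<in> A \<Longrightarrow> x > 0 \<Longrightarrow> (f p has_real_derivative f' p x) (at x)" "cls (Suc K) (Suc n) f'"
    using Suc.prems by (rule cls_SucE) blast
  show ?case using cls_0D[OF Suc.prems] f'(1) Suc.IH[OF f'(2)] by (rule cls_SucI)
qed

lemma cls_add: "cls K n f \<Longrightarrow> cls K n g \<Longrightarrow> cls K n (\<lambda>p x. f p x + g p x)"
proof (induction K arbitrary: n f g)
  case 0
  obtain C where C: "C \<ge> 0" "\<And>p x. p \<in> A \<Longrightarrow> x > 0 \<Longrightarrow> \<bar>f p x\<bar> \<le> C * W n p x" using 0(1) by (rule cls_0E) blast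
  obtain D where D: "D \<ge> 0" "\<And>p x. p \<in> A \<Longrightarrow> x > 0 \<Longrightarrow> \<bar>g p x\<bar> \<le> D * W n p x" using 0(2) by (rule cls_0E) blast
  have "\<bar>f p x + g p x\<bar> \<le> (C + D) * W n p x" if "p \<in> A" "x > 0" for p x
    using C(2)[OF that] D(2)[OF that] unfolding distrib_right by linarith
  then show ?case by auto
next
  case (Suc K)
  obtain f' where f': "\<And>p x. p \<in> A \<Longrightarrow> x > 0 \<Longrightarrow> (f p has_real_derivative f' p x) (at x)" "cls K (Suc n) f'"
    using Suc.prems(1) by (rule cls_SucE) blast
  obtain g' where g': "\<And>p x. p \<in> A \<Longrightarrow> x > 0 \<Longrightarrow> (g p has_real_derivative g' p x) (at x)" "cls K (Suc n) g'"
    using Suc.prems(2) by (rule cls_SucE) blast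
  have "cls 0 n (\<lambda>p x. f p x + g p x)"
  proof -
    obtain C where C: "C \<ge> 0" "\<And>p x. p \<in> A \<Longrightarrow> x > 0 \<Longrightarrow> \<bar>f p x\<bar> \<le> C * W n p x"
      using cls_0D[OF Suc.prems(1)] by (rule cls_0E) blast
    obtain D where D: "D \<ge> 0" "\<And>p x. p \<in> A \<Longrightarrow> x > 0 \<Longrightarrow> \<bar>g p x\<bar> \<le> D * W n p x"
      using cls_0D[OF Suc.prems(2)] by (rule cls_0E) blast
    have "\<bar>f p x + g p x\<bar> \<le> (C + D) * W n p x" if "p \<in> A" "x > 0" for p x
      using C(2)[OF that] D(2)[OF that] unfolding distrib_right by linarith
    then show ?thesis by auto
  qed
  then show ?case
    by (rule cls_SucI[where f'="\<lambda>p x. f' p x + g' p x"]) (auto intro!: derivative_intros f' g' Suc.IH)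
qed

lemma cls_0_mult:
  assumes "cls 0 i f" "cls 0 j g"
  shows "cls 0 (i + j) (\<lambda>p x. f p x * g p x)"
proof -
  obtain C where C: "C \<ge> 0" "\<And>p x. p \<in> A \<Longrightarrow> x > 0 \<Longrightarrow> \<bar>f p x\<bar> \<le> C * W i p x" using assms(1) by (rule cls_0E) blast
  obtain D where D: "D \<ge> 0" "\<And>p x. p \<in> A \<Longrightarrow> x > 0 \<Longrightarrow> \<bar>g p x\<bar> \<le> D * W j p x" using assms(2) by (rule cls_0E) blast
  have "\<bar>f p x * g p x\<bar> \<le> (3 * (C * D)) * W (i + j) p x" if "p \<in> A" "x > 0" for p x
  proof -
    have "\<bar>f p x * g p x\<bar> \<le> (C * W i p x) * (D * W j p x)"
      unfolding abs_mult using C D that W_nonneg[OF that] by (intro mult_mono) auto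
    also have "\<dots> = (C * D) * (W i p x * W j p x)" by simp
    also have "\<dots> \<le> (C * D) * (3 * W (i + j) p x)" using W_mult[OF that] C D by (intro mult_left_mono) auto
    finally show ?thesis by simp
  qed
  then show ?thesis by auto
qed

lemma cls_mult: "cls K i f \<Longrightarrow> cls K j g \<Longrightarrow> cls K (i + j) (\<lambda>p x. f p x * g p x)"
proof (induction K arbitrary: i j f g)
  case 0
  then show ?case by (rule cls_0_mult)
next
  case (Suc K)
  obtain f' where f': "\<And>p x. p \<in> A \<Longrightarrow> x > 0 \<Longrightarrow> (f p has_real_derivative f' p x) (at x)" "cls K (Suc i) f'"
    using Suc.prems(1) by (rule cls_SucE) blast
  obtain g' where g': "\<And>p x. p \<in> A \<Longrightarrow> x > 0 \<Longrightarrow> (g p has_real_derivative g' p x) (at x)" "cls K (Suc j) g'"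
    using Suc.prems(2) by (rule cls_SucE) blast
  have 1: "cls 0 (i + j) (\<lambda>p x. f p x * g p x)"
    using cls_0D[OF Suc.prems(1)] cls_0D[OF Suc.prems(2)] by (rule cls_0_mult)
  have "cls K (Suc i + j) (\<lambda>p x. f' p x * g p x)" "cls K (i + Suc j) (\<lambda>p x. f p x * g' p x)"
    using Suc.IH[OF f'(2) cls_Suc[OF Suc.prems(2)]] Suc.IH[OF cls_Suc[OF Suc.prems(1)] g'(2)] by simp_all
  then have "cls K (Suc (i + j)) (\<lambda>p x. f' p x * g p x + f p x * g' p x)"
    by (intro cls_add) auto
  then show ?case
    by (intro cls_SucI[OF 1, where f'="\<lambda>p x. f' p x * g p x + f p x * g' p x"])
       (use DERIV_mult'[OF f'(1) g'(1)] in \<open>simp_all add: algebra_simps\<close>)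
qed

lemma cls_zero: "cls K n (\<lambda>p x. 0)"
proof (induction K arbitrary: n)
  case 0
  then show ?case by (auto intro!: exI[of _ 0])
next
  case (Suc K)
  show ?case by (rule cls_SucI[where f'="\<lambda>p x. 0"]) (auto intro!: exI[of _ 0] Suc.IH)
qed

lemma cls_const: "cls K 0 (\<lambda>p x. k)"
proof (cases K)
  case (Suc K')
  have "cls 0 0 (\<lambda>p x. k)" by (auto simp: W_def intro!: exI[of _ "\<bar>k\<bar>"])
  then show ?thesis unfolding Suc by (rule cls_SucI[where f'="\<lambda>p x. 0"]) (auto intro: cls_zero)
qed (auto simp: W_def intro!: exI[of _ "\<bar>k\<bar>"])

lemma cls_cmult: "cls K n f \<Longrightarrow> cls K n (\<lambda>p x. k * f p x)"
  using cls_mult[OF cls_const, of K n f k] by simp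

lemma cls_product2: "cls K 1 f \<Longrightarrow> cls K 1 g \<Longrightarrow> cls K 2 (\<lambda>p x. f p x * g p x)"
  using cls_mult[of K 1 f 1 g] by (simp add: numeral_2_eq_2)

text \<open>Since 1 + a / (1 - a) = 1 / (1 - a), division by 1 - a becomes multiplication by 1 plus
  a term of order 1, which does not change the order.\<close>

lemma cls_times_one_plus: "cls K n f \<Longrightarrow> cls K 1 g \<Longrightarrow> cls K n (\<lambda>p x. f p x * (1 + g p x))"
proof -
  assume f: "cls K n f" and "cls K 1 g"
  then have "cls K 0 g" using cls_order[of K 0 g] by simp
  then have "cls K 0 (\<lambda>p x. 1 + g p x)" by (intro cls_add cls_const)
  from cls_mult[OF f this] show ?thesis by simp
qed

text \<open>Passes from witnesses to \<open>deriv\<close>. The extra level \<open>Suc k\<close>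
  supplies differentiability of the k-th derivative.\<close>

lemma cls_higher_deriv:
  assumes "cls (Suc k) n f"
  shows "\<exists>C. \<forall>p\<in>A. \<forall>x>0. (deriv ^^ k) (f p) differentiable (at x) \<and> \<bar>(deriv ^^ k) (f p) x\<bar> \<le> C * W (n + k) p x"
  using assms
proof (induction k arbitrary: n f)
  case 0
  then obtain f' where f': "\<And>p x. p \<in> A \<Longrightarrow> x > 0 \<Longrightarrow> (f p has_real_derivative f' p x) (at x)" "cls 0 (Suc n) f'"
    by (rule cls_SucE) blast
  obtain C where C: "C \<ge> 0" "\<And>p x. p \<in> A \<Longrightarrow> x > 0 \<Longrightarrow> \<bar>f p x\<bar> \<le> C * W n p x"
    using cls_0D[OF 0] by (rule cls_0E) blast
  show ?case
  proof (intro exI[of _ C] ballI allI impI)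
    fix p x assume p: "p \<in> A" "(x::real) > 0"
    show "(deriv ^^ 0) (f p) differentiable (at x) \<and> \<bar>(deriv ^^ 0) (f p) x\<bar> \<le> C * W (n + 0) p x"
      using f'(1)[OF p] C(2)[OF p] real_differentiable_def by auto
  qed
next
  case (Suc k)
  obtain f' where f': "\<And>p x. p \<in> A \<Longrightarrow> x > 0 \<Longrightarrow> (f p has_real_derivative f' p x) (at x)" "cls (Suc k) (Suc n) f'"
    using Suc.prems by (rule cls_SucE) blast
  obtain C where C: "\<forall>p\<in>A. \<forall>x>0. (deriv ^^ k) (f' p) differentiable (at x) \<and> \<bar>(deriv ^^ k) (f' p) x\<bar> \<le> C * W (Suc n + k) p x"
    using Suc.IH[OF f'(2)] by blast
  have eq: "(deriv ^^ Suc k) (f p) x = (deriv ^^ k) (f' p) x" if "p \<in> A" "x > 0" for p x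
  proof -
    have "(deriv ^^ k) (deriv (f p)) x = (deriv ^^ k) (f' p) x"
      by (rule higher_deriv_cong_open[of "{0<..}"]) (use f'(1) that in \<open>auto intro: DERIV_imp_deriv\<close>)
    then show ?thesis by (simp only: funpow_Suc_right o_apply)
  qed
  have "(deriv ^^ Suc k) (f p) differentiable (at x) \<and> \<bar>(deriv ^^ Suc k) (f p) x\<bar> \<le> C * W (n + Suc k) p x"
    if p: "p \<in> A" "x > 0" for p x
  proof
    obtain d where d: "((deriv ^^ k) (f' p) has_real_derivative d) (at x)"
      using C p by (auto simp: real_differentiable_def)
    have "((deriv ^^ Suc k) (f p) has_real_derivative d) (at x)"
      by (rule has_field_derivative_transform_within_open[OF d, of "{0<..}"]) (use p eq in auto)
    then show "(deriv ^^ Suc k) (f p) differentiable (at x)" by (auto simp: real_differentiable_def)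
    show "\<bar>(deriv ^^ Suc k) (f p) x\<bar> \<le> C * W (n + Suc k) p x" using C p eq[OF p] by simp
  qed
  then show ?case by blast
qed


lemma cls_cong:
  assumes "cls K n f" "\<And>p x. p \<in> A \<Longrightarrow> x > 0 \<Longrightarrow> f p x = g p x"
  shows "cls K n g"
proof (cases K)
  case 0
  then show ?thesis using assms by auto
next
  case (Suc K')
  obtain f' where f': "\<And>p x. p \<in> A \<Longrightarrow> x > 0 \<Longrightarrow> (f p has_real_derivative f' p x) (at x)" "cls K' (Suc n) f'"
    using assms(1) unfolding Suc by (rule cls_SucE) blast
  show ?thesis unfolding Suc
  proof (rule cls_SucI[OF _ _ f'(2)])
    show "cls 0 n g" using cls_0D[OF assms(1)] assms(2) by auto
    fix p x assume p: "p \<in> A" "(x::real) > 0"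
    show "(g p has_real_derivative f' p x) (at x)"
      by (rule has_field_derivative_transform_within_open[OF f'(1)[OF p], of "{0<..}"]) (use p assms(2) in auto)
  qed
qed

lemma cls_order_le: "m \<le> n \<Longrightarrow> cls K n f \<Longrightarrow> cls K m f"
proof (induction n)
  case (Suc n)
  then show ?case using cls_order[of K n f] by (cases "m = Suc n") auto
qed simp

lemma cls_lin: "cls K n f \<Longrightarrow> cls K n g \<Longrightarrow> cls K n (\<lambda>p x. j * f p x + k * g p x)"
  by (intro cls_add cls_cmult)

lemma cls_quad:
  assumes "cls K 1 a" "cls K 1 s" "cls K 1 (\<lambda>p x. a p x / (1 - a p x))"
    and a: "\<And>p x. p \<in> A \<Longrightarrow> x > 0 \<Longrightarrow> a p x < 1"
  shows "cls K 2 (\<lambda>p x. quad B C (a p x) (s p x))"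
proof (rule cls_cong)
  show "cls K 2 (\<lambda>p x. B * ((a p x * s p x) * (1 + a p x / (1 - a p x))) + C * (a p x * a p x))"
    by (intro cls_lin cls_times_one_plus cls_product2 assms)
  fix p x assume "p \<in> A" "(x::real) > 0"
  then have "1 - a p x \<noteq> 0" using a[of p x] by auto
  then have "1 + a p x / (1 - a p x) = 1 / (1 - a p x)" by (simp add: field_simps)
  then show "B * ((a p x * s p x) * (1 + a p x / (1 - a p x))) + C * (a p x * a p x) = quad B C (a p x) (s p x)"
    by (simp add: quad_def power2_eq_square)
qed

lemma cls_density_0:
  assumes "cls 0 1 a" and a: "\<And>p x. p \<in> A \<Longrightarrow> x > 0 \<Longrightarrow> a p x \<le> 1/2"
  shows "cls 0 1 (\<lambda>p x. a p x / (1 - a p x))"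
proof -
  obtain C where C: "C \<ge> 0" "\<And>p x. p \<in> A \<Longrightarrow> x > 0 \<Longrightarrow> \<bar>a p x\<bar> \<le> C * W 1 p x" using assms(1) by (rule cls_0E) blast
  have "\<bar>a p x / (1 - a p x)\<bar> \<le> (2 * C) * W 1 p x" if p: "p \<in> A" "x > 0" for p x
  proof -
    have "\<bar>a p x / (1 - a p x)\<bar> \<le> \<bar>a p x\<bar> / (1/2)"
      unfolding abs_divide using a[OF p] by (intro divide_left_mono) auto
    then show ?thesis using C(2)[OF p] by simp
  qed
  then show ?thesis by auto
qed

text \<open>The density perturbation r = a / (1 - a) satisfies r' = a' (1 + r)^2, so its next
  derivative is controlled by r itself at the current level and by a'.\<close>

lemma cls_density_Suc:
  assumes a: "\<And>p x. p \<in> A \<Longrightarrow> x > 0 \<Longrightarrow> a p x \<le> 1/2"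
    and d: "\<And>p x. p \<in> A \<Longrightarrow> x > 0 \<Longrightarrow> (a p has_real_derivative a' p x) (at x)"
    and K: "cls K 1 (\<lambda>p x. a p x / (1 - a p x))" and a': "cls K 2 a'"
  shows "cls (Suc K) 1 (\<lambda>p x. a p x / (1 - a p x))"
proof (rule cls_SucI[where f'="\<lambda>p x. a' p x * (1 + a p x / (1 - a p x)) * (1 + a p x / (1 - a p x))"])
  show "cls 0 1 (\<lambda>p x. a p x / (1 - a p x))" using K by (rule cls_0D)
  show "cls K (Suc 1) (\<lambda>p x. a' p x * (1 + a p x / (1 - a p x)) * (1 + a p x / (1 - a p x)))"
    using cls_times_one_plus[OF cls_times_one_plus[OF a' K] K] by (simp add: numeral_2_eq_2)
  fix p x assume p: "p \<in> A" "(x::real) > 0"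
  have nz: "1 - a p x \<noteq> 0" using a[OF p] by auto
  have "1 + a p x / (1 - a p x) = 1 / (1 - a p x)" using nz by (simp add: field_simps)
  moreover have "((\<lambda>x. a p x / (1 - a p x)) has_real_derivative a' p x * (1 / (1 - a p x)) * (1 / (1 - a p x))) (at x)"
    using d[OF p] nz by (auto intro!: derivative_eq_intros simp: field_simps)
  ultimately show "((\<lambda>x. a p x / (1 - a p x)) has_real_derivative
      a' p x * (1 + a p x / (1 - a p x)) * (1 + a p x / (1 - a p x))) (at x)" by simp
qed

text \<open>One level of regularity is gained per use of the equation. The linear terms are only of
  order 1, but for Z = 0 all weights of positive order coincide, so they count as order 2
  (\<open>flat\<close>).\<close>

lemma exponential_bootstrap:
  assumes Z0: "\<And>p x. Z p x = 0"
    and a: "\<And>p x. p \<in> A \<Longrightarrow> x > 0 \<Longrightarrow> a p x \<le> 1/2"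
    and da: "\<And>p x. p \<in> A \<Longrightarrow> x > 0 \<Longrightarrow> (a p has_real_derivative
      (j11 * a p x + j12 * b p x + quad A1 B1 (a p x) (a p x + b p x))) (at x)"
    and db: "\<And>p x. p \<in> A \<Longrightarrow> x > 0 \<Longrightarrow> (b p has_real_derivative
      (j21 * a p x + j22 * b p x + quad A2 B2 (a p x) (a p x + b p x))) (at x)"
    and a0: "cls 0 1 a" and b0: "cls 0 1 b"
  shows "cls K 1 a \<and> cls K 1 b \<and> cls K 1 (\<lambda>p x. a p x / (1 - a p x))"
proof (induction K)
  case 0
  show ?case using a0 b0 cls_density_0[OF a0 a] by blast
next
  case (Suc K)
  have W: "W (Suc n) = W n" if "n \<ge> 1" for n using that by (simp add: W_def Z0 fun_eq_iff)
  have "cls K n f \<Longrightarrow> n \<ge> 1 \<Longrightarrow> cls K (Suc n) f" for K n f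
  proof (induction K arbitrary: n f)
    case 0
    then show ?case using W by simp
  next
    case (Suc K)
    obtain f' where f': "\<And>p x. p \<in> A \<Longrightarrow> x > 0 \<Longrightarrow> (f p has_real_derivative f' p x) (at x)" "cls K (Suc n) f'"
      using Suc.prems(1) by (rule cls_SucE) blast
    have "cls 0 (Suc n) f" using cls_0D[OF Suc.prems(1)] W[OF Suc.prems(2)] by simp
    then show ?case by (rule cls_SucI[OF _ f'(1) Suc.IH[OF f'(2)]]) simp_all
  qed
  then have flat: "cls K 2 f" if "cls K 1 f" for K f
    using that by (metis one_add_one plus_1_eq_Suc order_refl)
  have s: "cls K 1 (\<lambda>p x. a p x + b p x)" using Suc by (intro cls_add) auto
  have lt: "a p x < 1" if "p \<in> A" "x > 0" for p x using a[OF that] by simp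
  have q: "cls K 2 (\<lambda>p x. quad B C (a p x) (a p x + b p x))" for B C
    using Suc s lt by (intro cls_quad) auto
  have l: "cls K 2 (\<lambda>p x. j * a p x + j' * b p x)" for j j'
    using Suc by (intro flat cls_lin) auto
  have a': "cls K 2 (\<lambda>p x. j11 * a p x + j12 * b p x + quad A1 B1 (a p x) (a p x + b p x))"
    and b': "cls K 2 (\<lambda>p x. j21 * a p x + j22 * b p x + quad A2 B2 (a p x) (a p x + b p x))"
    by (rule cls_add[OF l q])+
  have "cls (Suc K) 1 a" by (rule cls_SucI[OF a0 da]) (use a' in \<open>simp_all add: numeral_2_eq_2\<close>)
  moreover have "cls (Suc K) 1 b" by (rule cls_SucI[OF b0 db]) (use b' in \<open>simp_all add: numeral_2_eq_2\<close>)
  moreover have "cls (Suc K) 1 (\<lambda>p x. a p x / (1 - a p x))"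
    using Suc by (intro cls_density_Suc[OF a da _ a']) auto
  ultimately show ?case by blast
qed

text \<open>The supersolution is built from \<open>\<delta> / (m + \<delta> x)\<close> instead of \<open>Z\<close>: for large \<open>m\<close> its logarithmic
  derivative is small compared with \<open>l\<close>, for every fixed power, without shrinking \<open>\<delta>\<close>.\<close>

lemma linear_ode_0:
  assumes Zeq: "\<And>p x. Z p x = \<delta> p / (1 + \<delta> p * x)" and l: "4 * c \<le> l" and n: "n \<ge> 1"
    and dy: "\<And>p x. p \<in> A \<Longrightarrow> x > 0 \<Longrightarrow> (y p has_real_derivative (- l * y p x + g p x)) (at x)"
    and y: "cls 0 1 y" and g: "cls 0 n g"
  shows "cls 0 n y"
proof -
  obtain C1 where C1: "C1 \<ge> 0" "\<And>p x. p \<in> A \<Longrightarrow> x > 0 \<Longrightarrow> \<bar>y p x\<bar> \<le> C1 * W 1 p x" using y by (rule cls_0E) blast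
  obtain C2 where C2: "C2 \<ge> 0" "\<And>p x. p \<in> A \<Longrightarrow> x > 0 \<Longrightarrow> \<bar>g p x\<bar> \<le> C2 * W n p x" using g by (rule cls_0E) blast
  have l0: "l > 0" using l c by simp
  define m where "m = 1 + 2 * real n / l"
  have m: "m \<ge> 1" "real n / m \<le> l / 2"
  proof -
    show "m \<ge> 1" using l0 by (simp add: m_def)
    have "real n \<le> (l / 2) * m" using l0 by (simp add: m_def field_simps)
    then show "real n / m \<le> l / 2" using \<open>m \<ge> 1\<close> by (subst divide_le_eq) auto
  qed
  \<comment> \<open>Z \<le> m Q costs m^n in the source, and half of the damping, l / 2, is left to
    absorb it; the other half pays for differentiating the supersolution.\<close>
  define B where "B = 2 * C2 * m ^ n / l"
  have B: "B \<ge> 0" using C2(1) m l0 by (simp add: B_def)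
  have "\<bar>y p x\<bar> \<le> (B + 2 * C1) * W n p x" if p: "p \<in> A" and x: "x > 0" for p x
  proof -
    define d where "d = \<delta> p"
    have d: "0 \<le> d" "d \<le> 1" using \<delta> p by (auto simp: d_def)
    define Q where "Q t = d / (m + d * t)" for t
    define S where "S t = B * (Q t ^ n + d * exp (- c * t))" for t
    have den: "m + d * t \<ge> 1" if "t > 0" for t using m d that by (simp add: add_increasing2)
    have Q: "0 \<le> Q t" "Q t \<le> 1 / m" "Q t \<le> Z p t" "Z p t \<le> m * Q t" if t: "t > 0" for t
    proof -
      show "0 \<le> Q t" using den[OF t] d by (simp add: Q_def)
      show "Q t \<le> 1 / m" unfolding Q_def using d m t by (intro frac_le) auto
      show "Q t \<le> Z p t" unfolding Q_def Zeq d_def[symmetric] using d m t by (intro divide_left_mono mult_pos_pos add_pos_nonneg) auto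
      have "m * (d * t) \<ge> 1 * (d * t)" using d m t by (intro mult_right_mono) auto
      then have "m + d * t \<le> m * (1 + d * t)" by (simp add: algebra_simps)
      then have "d * (m + d * t) \<le> d * (m * (1 + d * t))" using d by (intro mult_left_mono)
      moreover have "1 + d * t > 0" using d t by (intro add_pos_nonneg) auto
      ultimately show "Z p t \<le> m * Q t" unfolding Q_def Zeq d_def[symmetric]
        using den[OF t] by (simp add: field_simps)
    qed
    \<comment> \<open>Comparison of y and - y (s = 1, -1) with the supersolution. It starts at x / 2
      because the classes carry information only for x > 0; the value there enters with exp (- l x /
      2), which is below exp (- c x).\<close>
    have mono: "s * exp (l * x) * y p x - exp (l * x) * S x \<le> s * exp (l * (x / 2)) * y p (x / 2) - exp (l * (x / 2)) * S (x / 2)"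
      if s: "\<bar>s\<bar> = 1" for s
    proof (rule nonincreasing_of_deriv[where E="\<lambda>t. s * exp (l * t) * y p t - exp (l * t) * S t" and
        E'="\<lambda>t. exp (l * t) * (s * g p t - B * (l * (Q t ^ n + d * exp (- c * t)) - real n * Q t ^ Suc n - c * d * exp (- c * t)))"])
      show "continuous_on {x / 2..x} (\<lambda>t. s * exp (l * t) * y p t - exp (l * t) * S t)"
      proof (rule continuous_at_imp_continuous_on, rule ballI)
        fix t assume "t \<in> {x / 2..x}"
        then have t: "t > 0" using x by auto
        have "isCont (y p) t" using dy[OF p t] by (rule DERIV_isCont)
        moreover have "isCont S t" unfolding S_def Q_def using den[OF t] by (intro continuous_intros) auto
        ultimately show "isCont (\<lambda>t. s * exp (l * t) * y p t - exp (l * t) * S t) t"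
          by (intro continuous_intros)
      qed
      show "x / 2 \<le> x" using x by simp
      fix t assume t': "x / 2 < t" "t < x"
      then have t: "t > 0" using x by auto
      have dQ: "(Q has_real_derivative - (Q t)\<^sup>2) (at t)" unfolding Q_def
        using den[OF t] by (auto intro!: derivative_eq_intros simp: power2_eq_square)
      have dQn: "((\<lambda>t. Q t ^ n) has_real_derivative - real n * Q t ^ Suc n) (at t)"
      proof (rule DERIV_cong[OF DERIV_power[OF dQ, of n]])
        obtain k where "n = Suc k" using n by (cases n) auto
        then show "real n * (- (Q t)\<^sup>2 * Q t ^ (n - Suc 0)) = - real n * Q t ^ Suc n"
          by (simp add: power2_eq_square algebra_simps)
      qed
      have dS: "(S has_real_derivative B * (- real n * Q t ^ Suc n - c * d * exp (- c * t))) (at t)"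
      proof -
        have "((\<lambda>t. d * exp (- c * t)) has_real_derivative - (c * d * exp (- c * t))) (at t)"
          by (auto intro!: derivative_eq_intros)
        from DERIV_cmult[OF DERIV_add[OF dQn this], of B] show ?thesis
          unfolding S_def by simp
      qed
      have D: "((\<lambda>t. s * exp (l * t) * y p t - exp (l * t) * S t) has_real_derivative
        exp (l * t) * (s * g p t - B * (l * (Q t ^ n + d * exp (- c * t)) - real n * Q t ^ Suc n - c * d * exp (- c * t)))) (at t)"
      proof -
        have feq: "(\<lambda>t. s * exp (l * t) * y p t - exp (l * t) * S t) = (\<lambda>t. exp (l * t) * (s * y p t - S t))"
          by (simp add: fun_eq_iff algebra_simps)
        have "((\<lambda>t. exp (l * t)) has_real_derivative exp (l * t) * l) (at t)"
          by (auto intro!: derivative_eq_intros)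
        from DERIV_mult[OF this DERIV_diff[OF DERIV_cmult[OF dy[OF p t], of s] dS]]
        show ?thesis unfolding feq by (rule DERIV_cong) (simp add: S_def algebra_simps)
      qed
      define w where "w = Q t ^ n + d * exp (- c * t)"
      have w: "0 \<le> w" "0 \<le> Q t ^ n" "0 \<le> d * exp (- c * t)" using Q(1)[OF t] d by (auto simp: w_def)
      have "real n * Q t ^ Suc n \<le> (l / 2) * Q t ^ n"
      proof -
        have "real n * Q t \<le> real n * (1 / m)" using Q(2)[OF t] by (intro mult_left_mono) auto
        also have "\<dots> = real n / m" by simp
        also have "\<dots> \<le> l / 2" by (rule m(2))
        finally have "real n * Q t \<le> l / 2" .
        then have "(real n * Q t) * Q t ^ n \<le> (l / 2) * Q t ^ n" using w by (intro mult_right_mono)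
        then show ?thesis by (simp add: mult.assoc)
      qed
      moreover have "c * (d * exp (- c * t)) \<le> (l / 2) * (d * exp (- c * t))"
        using w l c by (intro mult_right_mono) auto
      ultimately have 1: "l / 2 * w \<le> l * w - real n * Q t ^ Suc n - c * d * exp (- c * t)"
        by (simp add: w_def algebra_simps)
      have "s * g p t \<le> \<bar>g p t\<bar>" using s by (metis abs_ge_self abs_mult mult_1)
      also have "\<dots> \<le> C2 * W n p t" using C2(2)[OF p t] .
      also have "W n p t = Z p t ^ n + d * exp (- c * t)" using n by (simp add: W_def d_def)
      also have "\<dots> \<le> (m * Q t) ^ n + m ^ n * (d * exp (- c * t))"
      proof (rule add_mono)
        show "Z p t ^ n \<le> (m * Q t) ^ n" using Q[OF t] Z(1)[OF p t] by (intro power_mono) auto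
        show "d * exp (- c * t) \<le> m ^ n * (d * exp (- c * t))"
          using mult_right_mono[OF one_le_power[OF m(1), of n] w(3)] by simp
      qed
      also have "\<dots> = m ^ n * w" by (simp add: w_def power_mult_distrib algebra_simps)
      finally have "s * g p t \<le> C2 * (m ^ n * w)" using C2(1) by (simp add: mult_left_mono)
      also have "\<dots> = B * (l / 2 * w)" using l0 by (simp add: B_def)
      also have "\<dots> \<le> B * (l * w - real n * Q t ^ Suc n - c * d * exp (- c * t))"
        using 1 B by (rule mult_left_mono)
      finally have "s * g p t - B * (l * w - real n * Q t ^ Suc n - c * d * exp (- c * t)) \<le> 0" by simp
      then show "((\<lambda>t. s * exp (l * t) * y p t - exp (l * t) * S t) has_real_derivative
        exp (l * t) * (s * g p t - B * (l * (Q t ^ n + d * exp (- c * t)) - real n * Q t ^ Suc n - c * d * exp (- c * t)))) (at t)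
        \<and> exp (l * t) * (s * g p t - B * (l * (Q t ^ n + d * exp (- c * t)) - real n * Q t ^ Suc n - c * d * exp (- c * t))) \<le> 0"
        using D by (simp add: w_def mult_nonneg_nonpos)
    qed
    have S2: "S (x / 2) \<ge> 0" unfolding S_def using B Q(1)[of "x / 2"] d x by simp
    have "exp (l * x) * \<bar>y p x\<bar> \<le> exp (l * x) * S x + exp (l * (x / 2)) * \<bar>y p (x / 2)\<bar>"
    proof -
      have "0 \<le> exp (l * (x / 2)) * S (x / 2)" using S2 by simp
      then have "\<bar>exp (l * x) * y p x\<bar> \<le> exp (l * x) * S x + \<bar>exp (l * (x / 2)) * y p (x / 2)\<bar>"
        using mono[of 1] mono[of "-1"] by (simp only: abs_minus_cancel abs_one mult_1 mult_minus1 mult_minus_left) linarith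
      then show ?thesis by (simp add: abs_mult)
    qed
    then have e1: "exp (- l * x) * (exp (l * x) * \<bar>y p x\<bar>) \<le> exp (- l * x) * (exp (l * x) * S x + exp (l * (x / 2)) * \<bar>y p (x / 2)\<bar>)"
      by (intro mult_left_mono) auto
    have ee: "exp (- l * x) * exp (l * (x / 2)) = exp (- l * (x / 2))" "exp (- l * x) * exp (l * x) = 1"
      by (simp_all add: exp_add[symmetric])
    have 1: "\<bar>y p x\<bar> \<le> S x + exp (- l * (x / 2)) * \<bar>y p (x / 2)\<bar>"
      using e1 by (simp only: distrib_left mult.assoc[symmetric] ee mult_1_left)
    have "\<bar>y p (x / 2)\<bar> \<le> C1 * W 1 p (x / 2)" using C1(2)[OF p, of "x / 2"] x by simp
    also have "\<dots> \<le> C1 * (2 * d)"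
      using C1(1) Z(2)[OF p, of "x / 2"] e01(2)[OF p, of "x / 2"] x
      by (intro mult_left_mono) (auto simp: W_def d_def)
    finally have "exp (- l * (x / 2)) * \<bar>y p (x / 2)\<bar> \<le> exp (- c * x) * (C1 * (2 * d))"
      using l x c C1(1) d by (intro mult_mono) auto
    moreover have "S x \<le> B * W n p x"
      unfolding S_def W_def using n B Q(3)[OF x] Q(1)[OF x]
      by (auto intro!: mult_left_mono add_mono power_mono simp: d_def)
    moreover have "exp (- c * x) * (C1 * (2 * d)) \<le> 2 * C1 * W n p x"
    proof -
      have "2 * C1 * (d * exp (- c * x)) \<le> 2 * C1 * W n p x"
        unfolding W_def using n C1(1) Z(1)[OF p x] by (intro mult_left_mono) (auto simp: d_def)
      then show ?thesis by (simp add: mult_ac)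
    qed
    ultimately show ?thesis using 1 unfolding distrib_right by linarith
  qed
  then show ?thesis by auto
qed

text \<open>The derivative of y solves the same damped equation with source g', one order higher.
  Induction on K therefore reduces everything to the undifferentiated bound.\<close>

lemma linear_ode:
  assumes Zeq: "\<And>p x. Z p x = \<delta> p / (1 + \<delta> p * x)" and l: "4 * c \<le> l" and n: "n \<ge> 1"
    and dy: "\<And>p x. p \<in> A \<Longrightarrow> x > 0 \<Longrightarrow> (y p has_real_derivative (- l * y p x + g p x)) (at x)"
    and y: "cls 0 1 y" and g: "cls K n g"
  shows "cls K n y"
  using n dy y g
proof (induction K arbitrary: n y g)
  case 0
  show ?case by (rule linear_ode_0[OF Zeq l 0])
next
  case (Suc K)
  obtain g' where g': "\<And>p x. p \<in> A \<Longrightarrow> x > 0 \<Longrightarrow> (g p has_real_derivative g' p x) (at x)" "cls K (Suc n) g'"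
    using Suc.prems(4) by (rule cls_SucE) blast
  have g0: "cls 0 n g" using Suc.prems(4) by (rule cls_0D)
  define z where "z p x = - l * y p x + g p x" for p x
  have z0: "cls 0 1 z" unfolding z_def
    by (rule cls_add[OF cls_cmult[OF Suc.prems(3)] cls_order_le[OF Suc.prems(1) g0]])
  have "cls K (Suc n) z"
  proof (rule Suc.IH[OF _ _ z0 g'(2)])
    fix p x assume p: "p \<in> A" "(x::real) > 0"
    show "(z p has_real_derivative - l * z p x + g' p x) (at x)"
      using DERIV_add[OF DERIV_cmult[OF Suc.prems(2)[OF p], of "- l"] g'(1)[OF p]]
      by (simp add: z_def[abs_def])
  qed simp
  moreover have "cls 0 n y" by (rule linear_ode_0[OF Zeq l Suc.prems(1,2,3) g0])
  moreover have "(y p has_real_derivative z p x) (at x)" if "p \<in> A" "x > 0" for p x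
    using Suc.prems(2)[OF that] by (simp add: z_def)
  ultimately show ?case by (intro cls_SucI[where f'=z]) auto
qed

text \<open>U' is purely quadratic and has order 2 at once. T' contains - l T, of order 1 a priori;
  \<open>linear_ode\<close> with the quadratic source first improves T to order 2, and then T' has
  order 2 as well.\<close>

lemma algebraic_bootstrap:
  assumes Zeq: "\<And>p x. Z p x = \<delta> p / (1 + \<delta> p * x)" and l: "4 * c \<le> l"
    and a_def: "\<And>p x. a p x = \<alpha> * U p x + \<beta> * T p x" and s_def: "\<And>p x. s p x = \<alpha>' * U p x + \<beta>' * T p x"
    and a: "\<And>p x. p \<in> A \<Longrightarrow> x > 0 \<Longrightarrow> a p x \<le> 1/2"
    and dU: "\<And>p x. p \<in> A \<Longrightarrow> x > 0 \<Longrightarrow> (U p has_real_derivative quad A1 B1 (a p x) (s p x)) (at x)"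
    and dT: "\<And>p x. p \<in> A \<Longrightarrow> x > 0 \<Longrightarrow> (T p has_real_derivative (- l * T p x + quad A2 B2 (a p x) (s p x))) (at x)"
    and U0: "cls 0 1 U" and T0: "cls 0 1 T"
  shows "cls K 1 U \<and> cls K 1 T \<and> cls K 1 (\<lambda>p x. a p x / (1 - a p x))"
proof (induction K)
  case 0
  have "cls 0 1 a" unfolding a_def[abs_def] by (rule cls_lin[OF U0 T0])
  then have "cls 0 1 (\<lambda>p x. a p x / (1 - a p x))" by (rule cls_density_0) (rule a)
  then show ?case using U0 T0 by blast
next
  case (Suc K)
  then have UK: "cls K 1 U" and TK: "cls K 1 T" and rK: "cls K 1 (\<lambda>p x. a p x / (1 - a p x))" by auto
  have lt: "a p x < 1" if "p \<in> A" "x > 0" for p x using a[OF that] by simp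
  have aK: "cls K 1 a" and sK: "cls K 1 s"
    unfolding a_def[abs_def] s_def[abs_def] by (rule cls_lin[OF UK TK])+
  have q: "cls K 2 (\<lambda>p x. quad B C (a p x) (s p x))" for B C
    by (rule cls_quad[OF aK sK rK lt])
  have T2: "cls K 2 T" by (rule linear_ode[OF Zeq l _ dT T0 q]) auto
  have T': "cls K 2 (\<lambda>p x. - l * T p x + quad A2 B2 (a p x) (s p x))"
    by (rule cls_add[OF cls_cmult[OF T2] q])
  have "cls (Suc K) 1 U" by (rule cls_SucI[OF U0 dU]) (use q in \<open>simp_all add: numeral_2_eq_2\<close>)
  moreover have "cls (Suc K) 1 T" by (rule cls_SucI[OF T0 dT]) (use T' in \<open>simp_all add: numeral_2_eq_2\<close>)
  moreover have "cls (Suc K) 1 (\<lambda>p x. a p x / (1 - a p x))"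
  proof (rule cls_density_Suc[OF a _ rK])
    show "cls K 2 (\<lambda>p x. \<alpha> * quad A1 B1 (a p x) (s p x) + \<beta> * (- l * T p x + quad A2 B2 (a p x) (s p x)))"
      by (rule cls_lin[OF q T'])
    fix p x assume p: "p \<in> A" "(x::real) > 0"
    show "(a p has_real_derivative \<alpha> * quad A1 B1 (a p x) (s p x) + \<beta> * (- l * T p x + quad A2 B2 (a p x) (s p x))) (at x)"
    proof -
      have "a p = (\<lambda>x. \<alpha> * U p x + \<beta> * T p x)" by (rule ext) (rule a_def)
      then show ?thesis
        using DERIV_add[OF DERIV_cmult[OF dU[OF p], of \<alpha>] DERIV_cmult[OF dT[OF p], of \<beta>]] by (simp only:)
    qed
  qed
  ultimately show ?case by blast
qed

end

section \<open>Integration of the stationary system\<close>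


text \<open>First row of the integrated system, linear and nonlinear part together. The sign in the
  nonlinear part is taken into the denominator 1 - a, so that it is an instance of
  \<open>quad\<close>.\<close>

definition velocity_rate :: "real \<Rightarrow> real \<Rightarrow> real \<Rightarrow> real \<Rightarrow> real \<Rightarrow> real" where
  "velocity_rate \<gamma> \<mu> M a b =
     1 / \<mu> * (1 / (M\<^sup>2 * \<gamma>) - 1) * a + 1 / (\<mu> * M\<^sup>2 * \<gamma>) * b + quad (1 / (\<mu> * M\<^sup>2 * \<gamma>)) 0 a (a + b)"

definition temperature_rate :: "real \<Rightarrow> real \<Rightarrow> real \<Rightarrow> real \<Rightarrow> real \<Rightarrow> real" where
  "temperature_rate \<gamma> \<kappa> M a b =
     1 / (\<kappa> * M\<^sup>2 * \<gamma>) * a + - c_v \<gamma> / (\<kappa> * M\<^sup>2) * b + quad 0 (1 / (2 * \<kappa>)) a (a + b)"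

text \<open>The condition a < 1 means u < 0 and keeps the orbit off the singularity. At x = 0 only
  continuity is asked, as in \<open>stationary_solution\<close>.\<close>

definition orbit :: "real \<Rightarrow> real \<Rightarrow> real \<Rightarrow> real \<Rightarrow> (real \<Rightarrow> real) \<Rightarrow> (real \<Rightarrow> real) \<Rightarrow> bool" where
  "orbit \<gamma> \<mu> \<kappa> M a b \<longleftrightarrow> continuous_on {0..} a \<and> continuous_on {0..} b \<and> (\<forall>x\<ge>0. a x < 1) \<and>
     (\<forall>x>0. (a has_real_derivative velocity_rate \<gamma> \<mu> M (a x) (b x)) (at x) \<and>
            (b has_real_derivative temperature_rate \<gamma> \<kappa> M (a x) (b x)) (at x))"

lemma constant_on_halfline:
  fixes f :: "real \<Rightarrow> real"
  assumes "\<And>x. x > 0 \<Longrightarrow> (f has_real_derivative 0) (at x)"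
  shows "\<exists>c. \<forall>x>0. f x = c"
proof -
  have "\<exists>c. \<forall>x\<in>{0<..}. f x = c"
    by (rule has_field_derivative_zero_constant) (use assms in \<open>auto intro: has_field_derivative_at_within\<close>)
  then show ?thesis by auto
qed

text \<open>By the mean value theorem on [x, x + 1], f' takes values close to 0 arbitrarily far out.
  The problem prescribes limits of the unknowns only; this lemma supplies those of their derivatives
  and so fixes the constants of integration.\<close>

lemma derivative_limit_zero:
  fixes f :: "real \<Rightarrow> real"
  assumes d: "\<And>x. x > 0 \<Longrightarrow> (f has_real_derivative f' x) (at x)"
    and f: "(f \<longlongrightarrow> l) at_top" and f': "(f' \<longlongrightarrow> L) at_top"
  shows "L = 0"
proof (rule ccontr)
  assume L: "L \<noteq> 0"
  have "\<forall>\<^sub>F x in at_top. \<bar>f' x - L\<bar> < \<bar>L\<bar> / 2"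
    using tendstoD[OF f', of "\<bar>L\<bar> / 2"] L by (simp add: dist_real_def)
  then obtain X1 where X1: "\<And>x. x \<ge> X1 \<Longrightarrow> \<bar>f' x - L\<bar> < \<bar>L\<bar> / 2" by (auto simp: eventually_at_top_linorder)
  have "\<forall>\<^sub>F x in at_top. \<bar>f x - l\<bar> < \<bar>L\<bar> / 4"
    using tendstoD[OF f, of "\<bar>L\<bar> / 4"] L by (simp add: dist_real_def)
  then obtain X2 where X2: "\<And>x. x \<ge> X2 \<Longrightarrow> \<bar>f x - l\<bar> < \<bar>L\<bar> / 4" by (auto simp: eventually_at_top_linorder)
  define x where "x = max 1 (max X1 X2)"
  have x: "x > 0" "x \<ge> X1" "x \<ge> X2" by (auto simp: x_def)
  have "\<exists>z. x < z \<and> z < x + 1 \<and> f (x + 1) - f x = (x + 1 - x) * f' z"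
  proof (rule MVT2)
    fix y assume "x \<le> y" "y \<le> x + 1"
    then show "(f has_real_derivative f' y) (at y)" using x(1) by (intro d) simp
  qed simp
  then obtain z where z: "x < z" "f (x + 1) - f x = (x + 1 - x) * f' z" by blast
  have "\<bar>f x - l\<bar> < \<bar>L\<bar> / 4" "\<bar>f (x + 1) - l\<bar> < \<bar>L\<bar> / 4" "\<bar>f' z - L\<bar> < \<bar>L\<bar> / 2"
    using x z(1) by (intro X1 X2; simp)+
  moreover have "f' z = f (x + 1) - f x" using z(2) by simp
  ultimately show False by linarith
qed

lemma has_deriv_of_smooth:
  assumes "smooth_on_halfline f" "x > 0"
  shows "(f has_real_derivative deriv f x) (at x)" "(deriv f has_real_derivative deriv (deriv f) x) (at x)"
proof -
  have "(deriv ^^ 0) f differentiable (at x)" "(deriv ^^ 1) f differentiable (at x)"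
    using assms unfolding smooth_on_halfline_def by blast+
  then show "(f has_real_derivative deriv f x) (at x)" "(deriv f has_real_derivative deriv (deriv f) x) (at x)"
    by (simp_all add: DERIV_deriv_iff_real_differentiable)
qed

text \<open>The subtracted constant is the momentum flux of the far-field state (1, -1, 1).\<close>

lemma velocity_rate_integrated:
  assumes "\<gamma> > 0" "\<mu> > 0" "M > 0" "u < 0"
  shows "\<mu> * velocity_rate \<gamma> \<mu> M (u + 1) (\<theta> - 1)
    = (- 1 / u) * u\<^sup>2 + 1 / M\<^sup>2 * pressure \<gamma> (- 1 / u) \<theta> - (1 + 1 / (M\<^sup>2 * \<gamma>))"
proof -
  have 1: "1 - (u + 1) = - u" by simp
  have "\<mu> * velocity_rate \<gamma> \<mu> M (u + 1) (\<theta> - 1)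
    = (1 / (M\<^sup>2 * \<gamma>) - 1) * (u + 1) + 1 / (M\<^sup>2 * \<gamma>) * (\<theta> - 1) + (1 / (M\<^sup>2 * \<gamma>)) * ((u + 1) * (u + \<theta>) / (- u))"
    using assms unfolding velocity_rate_def quad_def 1 by (simp add: field_simps)
  also have "\<dots> = (- 1 / u) * u\<^sup>2 + 1 / M\<^sup>2 * pressure \<gamma> (- 1 / u) \<theta> - (1 + 1 / (M\<^sup>2 * \<gamma>))"
    using assms unfolding pressure_def by (simp add: field_simps power2_eq_square)
  finally show ?thesis .
qed

text \<open>The added constant is minus the energy flux of the far-field state. The viscous work
  \<mu> u u' is expressed through the momentum identity.\<close>

lemma temperature_rate_integrated:
  assumes "\<gamma> > 1" "\<mu> > 0" "\<kappa> > 0" "M > 0" "u < 0"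
  shows "\<mu> * u * velocity_rate \<gamma> \<mu> M (u + 1) (\<theta> - 1) + \<kappa> * temperature_rate \<gamma> \<kappa> M (u + 1) (\<theta> - 1)
    = (- 1 / u) * u * (c_v \<gamma> / M\<^sup>2 * \<theta> + u\<^sup>2 / 2) + 1 / M\<^sup>2 * pressure \<gamma> (- 1 / u) \<theta> * u
      + (c_v \<gamma> / M\<^sup>2 + 1 / 2 + 1 / (M\<^sup>2 * \<gamma>))"
proof -
  define q where "q = 1 / (M\<^sup>2 * \<gamma>)"
  define v where "v = c_v \<gamma> / M\<^sup>2"
  have t: "\<kappa> * temperature_rate \<gamma> \<kappa> M (u + 1) (\<theta> - 1) = q * (u + 1) - v * (\<theta> - 1) + (u + 1)\<^sup>2 / 2"
    using assms unfolding temperature_rate_def quad_def q_def v_def by (simp add: field_simps)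
  have "\<mu> * u * velocity_rate \<gamma> \<mu> M (u + 1) (\<theta> - 1) = u * (\<mu> * velocity_rate \<gamma> \<mu> M (u + 1) (\<theta> - 1))" by simp
  also have "\<dots> = u * ((- 1 / u) * u\<^sup>2 + 1 / M\<^sup>2 * pressure \<gamma> (- 1 / u) \<theta> - (1 + 1 / (M\<^sup>2 * \<gamma>)))"
    using assms by (subst velocity_rate_integrated) auto
  also have "\<dots> = - u\<^sup>2 - q * \<theta> - u * (1 + q)"
    using assms unfolding pressure_def q_def by (simp add: field_simps power2_eq_square)
  finally have v: "\<mu> * u * velocity_rate \<gamma> \<mu> M (u + 1) (\<theta> - 1) = - u\<^sup>2 - q * \<theta> - u * (1 + q)" .
  have "(- 1 / u) * u * (v * \<theta> + u\<^sup>2 / 2) + 1 / M\<^sup>2 * pressure \<gamma> (- 1 / u) \<theta> * u + (v + 1 / 2 + q)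
    = - (v * \<theta> + u\<^sup>2 / 2) - q * \<theta> + (v + 1 / 2 + q)"
    using assms unfolding pressure_def q_def by (simp add: field_simps)
  moreover have "\<mu> * u * velocity_rate \<gamma> \<mu> M (u + 1) (\<theta> - 1) + \<kappa> * temperature_rate \<gamma> \<kappa> M (u + 1) (\<theta> - 1)
    = - (v * \<theta> + u\<^sup>2 / 2) - q * \<theta> + (v + 1 / 2 + q)"
    unfolding t v by (simp add: field_simps power2_eq_square)
  ultimately show ?thesis unfolding v_def q_def by (simp only:)
qed

text \<open>Needed for arbitrary solutions: it is what reduces uniqueness for the stationary problem
  to uniqueness for the planar system.\<close>

lemma orbit_of_solution:
  assumes "\<gamma> > 1" "\<mu> > 0" "\<kappa> > 0" "M > 0"
    and sol: "stationary_solution \<gamma> \<mu> \<kappa> M ub \<theta>b \<rho> u \<theta>"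
  shows "orbit \<gamma> \<mu> \<kappa> M (\<lambda>x. u x + 1) (\<lambda>x. \<theta> x - 1) \<and> (\<forall>x\<ge>0. \<rho> x = - 1 / u x)"
proof -
  note s = sol[unfolded stationary_solution_def]
  have sm: "smooth_on_halfline \<rho>" "smooth_on_halfline u" "smooth_on_halfline \<theta>" and
    cont: "continuous_on {0..} \<rho>" "continuous_on {0..} u" "continuous_on {0..} \<theta>" and
    lim: "(\<rho> \<longlongrightarrow> 1) at_top" "(u \<longlongrightarrow> -1) at_top" "(\<theta> \<longlongrightarrow> 1) at_top" by (use s in blast)+
  have mass: "\<forall>x>0. deriv (\<lambda>x. \<rho> x * u x) x = 0" using s by blast
  have mom: "\<forall>x>0. deriv (\<lambda>x. \<rho> x * (u x)\<^sup>2 + 1 / M\<^sup>2 * pressure \<gamma> (\<rho> x) (\<theta> x)) x = \<mu> * deriv (deriv u) x"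
    using s by blast
  have ene: "\<forall>x>0. deriv (\<lambda>x. \<rho> x * u x * (c_v \<gamma> / M\<^sup>2 * \<theta> x + (u x)\<^sup>2 / 2)
      + 1 / M\<^sup>2 * pressure \<gamma> (\<rho> x) (\<theta> x) * u x) x = deriv (\<lambda>x. \<mu> * u x * deriv u x + \<kappa> * deriv \<theta> x) x"
    using s by blast
  note d\<rho> = has_deriv_of_smooth[OF sm(1)] and du = has_deriv_of_smooth[OF sm(2)] and d\<theta> = has_deriv_of_smooth[OF sm(3)]
  have ev: "\<forall>\<^sub>F x in at_top. (x::real) > 0" by (rule eventually_gt_at_top)
  have "((\<lambda>x. \<rho> x * u x) has_real_derivative 0) (at x)" if "x > 0" for x
  proof -
    have "((\<lambda>x. \<rho> x * u x) has_real_derivative deriv \<rho> x * u x + deriv u x * \<rho> x) (at x)"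
      using DERIV_mult[OF d\<rho>(1) du(1)] that by simp
    moreover have "deriv (\<lambda>x. \<rho> x * u x) x = 0" using mass that by blast
    ultimately show ?thesis using DERIV_imp_deriv by metis
  qed
  then obtain c where c: "\<And>x. x > 0 \<Longrightarrow> \<rho> x * u x = c" using constant_on_halfline[of "\<lambda>x. \<rho> x * u x"] by blast
  have "((\<lambda>x. \<rho> x * u x) \<longlongrightarrow> 1 * (-1)) at_top" by (intro tendsto_intros lim)
  moreover have "((\<lambda>x. \<rho> x * u x) \<longlongrightarrow> c) at_top"
    by (rule tendsto_eventually, rule eventually_mono[OF ev]) (rule c)
  ultimately have c1: "c = -1" using tendsto_unique[OF trivial_limit_at_top_linorder] by fastforce
  \<comment> \<open>The identity reaches x = 0 by continuity; it determines \<rho> there, where no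
    boundary value is prescribed.\<close>
  have ru: "\<rho> x * u x = -1" if "x \<ge> 0" for x
  proof (cases "x = 0")
    case True
    have "continuous_on {0..} (\<lambda>x. \<rho> x * u x)" by (intro continuous_intros cont)
    then have "((\<lambda>x. \<rho> x * u x) \<longlongrightarrow> \<rho> 0 * u 0) (at 0 within {0..})" by (auto simp: continuous_on_def)
    then have "((\<lambda>x. \<rho> x * u x) \<longlongrightarrow> \<rho> 0 * u 0) (at_right 0)" by (rule tendsto_within_subset) auto
    moreover have "((\<lambda>x. \<rho> x * u x) \<longlongrightarrow> -1) (at_right 0)"
      by (rule tendsto_eventually) (use c c1 in \<open>auto simp: eventually_at_right_less intro: eventually_at_rightI[of 0 1]\<close>)
    ultimately show ?thesis using True tendsto_unique[OF trivial_limit_at_right_real] by blast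
  qed (use c c1 that in auto)
  have une: "u x \<noteq> 0" if "x \<ge> 0" for x using ru[OF that] by auto
  \<comment> \<open>The product \<rho> u = -1 excludes zeros of u, and u tends to -1, so the
    intermediate value theorem excludes positive values.\<close>
  have uneg: "u x < 0" if x: "x \<ge> 0" for x
  proof (rule ccontr)
    assume "\<not> u x < 0"
    have "\<forall>\<^sub>F y in at_top. u y < 0" using lim(2) by (rule order_tendstoD) simp
    then obtain X where X: "\<And>y. y \<ge> X \<Longrightarrow> u y < 0" by (auto simp: eventually_at_top_linorder)
    define y where "y = max x X"
    have "continuous_on {x..y} u" using x by (intro continuous_on_subset[OF cont(2)]) auto
    then obtain z where "x \<le> z" "z \<le> y" "u z = 0"
      using IVT2'[of u y 0 x] X[of y] \<open>\<not> u x < 0\<close> by (force simp: y_def)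
    then show False using une[of z] x by auto
  qed
  have \<rho>: "\<rho> x = - 1 / u x" if "x \<ge> 0" for x using ru[OF that] une[OF that] by (simp add: field_simps)
  define m where "m x = \<rho> x * (u x)\<^sup>2 + 1 / M\<^sup>2 * pressure \<gamma> (\<rho> x) (\<theta> x)" for x
  define en where "en x = \<rho> x * u x * (c_v \<gamma> / M\<^sup>2 * \<theta> x + (u x)\<^sup>2 / 2) + 1 / M\<^sup>2 * pressure \<gamma> (\<rho> x) (\<theta> x) * u x" for x
  have mdiff: "m differentiable (at x)" and ediff: "en differentiable (at x)" if "x > 0" for x
  proof -
    have "\<rho> differentiable (at x)" "u differentiable (at x)" "\<theta> differentiable (at x)"
      using d\<rho>(1)[OF that] du(1)[OF that] d\<theta>(1)[OF that] by (auto simp: real_differentiable_def)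
    then show "m differentiable (at x)" "en differentiable (at x)"
      unfolding m_def[abs_def] en_def[abs_def] pressure_def using assms by (auto intro!: derivative_intros)
  qed
  have "((\<lambda>x. m x - \<mu> * deriv u x) has_real_derivative 0) (at x)" if x: "x > 0" for x
  proof -
    have "(m has_real_derivative \<mu> * deriv (deriv u) x) (at x)"
      using mdiff[OF x] mom[rule_format, OF x] unfolding DERIV_deriv_iff_real_differentiable[symmetric] m_def[abs_def]
      by (simp only:)
    from DERIV_diff[OF this DERIV_cmult[OF du(2)[OF x], of \<mu>]] show ?thesis by simp
  qed
  then obtain c where c: "\<And>x. x > 0 \<Longrightarrow> m x - \<mu> * deriv u x = c"
    using constant_on_halfline[of "\<lambda>x. m x - \<mu> * deriv u x"] by blast
  have mlim: "(m \<longlongrightarrow> 1 + 1 / (M\<^sup>2 * \<gamma>)) at_top"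
  proof -
    have "(m \<longlongrightarrow> 1 * (-1)\<^sup>2 + 1 / M\<^sup>2 * (1 * 1 / \<gamma>)) at_top"
      unfolding m_def[abs_def] pressure_def using assms by (intro tendsto_intros lim) auto
    then show ?thesis by simp
  qed
  \<comment> \<open>The flux m converges, hence so does \<open>deriv u\<close>; its limit can only
    be 0, which determines c.\<close>
  have h1: "((\<lambda>x. (m x - c) / \<mu>) \<longlongrightarrow> (1 + 1 / (M\<^sup>2 * \<gamma>) - c) / \<mu>) at_top"
    using assms by (intro tendsto_intros mlim) auto
  have h2: "(m x - c) / \<mu> = deriv u x" if "x > 0" for x using c[OF that] assms by (simp add: field_simps)
  have dulim: "(deriv u \<longlongrightarrow> (1 + 1 / (M\<^sup>2 * \<gamma>) - c) / \<mu>) at_top"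
    by (rule Lim_transform_eventually[OF h1 eventually_mono[OF ev]]) (rule h2)
  have "(1 + 1 / (M\<^sup>2 * \<gamma>) - c) / \<mu> = 0" using derivative_limit_zero[OF du(1) lim(2) dulim] .
  then have c1: "c = 1 + 1 / (M\<^sup>2 * \<gamma>)" using assms by simp
  have dulim0: "(deriv u \<longlongrightarrow> 0) at_top" using dulim c1 by simp
  have u': "deriv u x = velocity_rate \<gamma> \<mu> M (u x + 1) (\<theta> x - 1)" if x: "x > 0" for x
  proof -
    have "\<mu> * velocity_rate \<gamma> \<mu> M (u x + 1) (\<theta> x - 1) = m x - (1 + 1 / (M\<^sup>2 * \<gamma>))"
      using velocity_rate_integrated[of \<gamma> \<mu> M "u x" "\<theta> x"] assms uneg[of x] x \<rho>[of x] by (simp add: m_def)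
    also have "\<dots> = \<mu> * deriv u x" using c[OF x] c1 by simp
    finally show ?thesis using assms by simp
  qed
  have "((\<lambda>x. en x - (\<mu> * u x * deriv u x + \<kappa> * deriv \<theta> x)) has_real_derivative 0) (at x)" if x: "x > 0" for x
  proof -
    have "(\<lambda>x. \<mu> * u x * deriv u x + \<kappa> * deriv \<theta> x) differentiable (at x)"
    proof -
      have "u differentiable (at x)" "deriv u differentiable (at x)" "deriv \<theta> differentiable (at x)"
        using du[OF x] d\<theta>[OF x] by (auto simp: real_differentiable_def)
      then show ?thesis by (intro derivative_intros)
    qed
    then have "((\<lambda>x. \<mu> * u x * deriv u x + \<kappa> * deriv \<theta> x) has_real_derivative
        deriv (\<lambda>x. \<mu> * u x * deriv u x + \<kappa> * deriv \<theta> x) x) (at x)"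
      by (simp add: DERIV_deriv_iff_real_differentiable)
    moreover have "(en has_real_derivative deriv (\<lambda>x. \<mu> * u x * deriv u x + \<kappa> * deriv \<theta> x) x) (at x)"
      using ediff[OF x] ene[rule_format, OF x] unfolding DERIV_deriv_iff_real_differentiable[symmetric] en_def[abs_def]
      by (simp only:)
    ultimately show ?thesis using DERIV_diff[of en "deriv (\<lambda>x. \<mu> * u x * deriv u x + \<kappa> * deriv \<theta> x) x" x] by fastforce
  qed
  then obtain e where e: "\<And>x. x > 0 \<Longrightarrow> en x - (\<mu> * u x * deriv u x + \<kappa> * deriv \<theta> x) = e"
    using constant_on_halfline[of "\<lambda>x. en x - (\<mu> * u x * deriv u x + \<kappa> * deriv \<theta> x)"] by blast
  have elim: "(en \<longlongrightarrow> - (c_v \<gamma> / M\<^sup>2 + 1 / 2) - 1 / (M\<^sup>2 * \<gamma>)) at_top"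
  proof -
    have "(en \<longlongrightarrow> 1 * (-1) * (c_v \<gamma> / M\<^sup>2 * 1 + (-1)\<^sup>2 / 2) + 1 / M\<^sup>2 * (1 * 1 / \<gamma>) * (-1)) at_top"
      unfolding en_def[abs_def] pressure_def using assms by (intro tendsto_intros lim) auto
    then show ?thesis by simp
  qed
  \<comment> \<open>The factor 0 is the limit of \<open>deriv u\<close>, already known from the
    momentum equation; this is why momentum precedes energy.\<close>
  define L where "L = (- (c_v \<gamma> / M\<^sup>2 + 1 / 2) - 1 / (M\<^sup>2 * \<gamma>) - \<mu> * (-1) * 0 - e) / \<kappa>"
  have h3: "((\<lambda>x. (en x - \<mu> * u x * deriv u x - e) / \<kappa>) \<longlongrightarrow> L) at_top"
    unfolding L_def using assms by (intro tendsto_intros elim lim dulim0) auto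
  have h4: "(en x - \<mu> * u x * deriv u x - e) / \<kappa> = deriv \<theta> x" if "x > 0" for x
  proof -
    have "en x - \<mu> * u x * deriv u x - e = \<kappa> * deriv \<theta> x" using e[OF that] by simp
    then show ?thesis using assms by simp
  qed
  have d\<theta>lim: "(deriv \<theta> \<longlongrightarrow> L) at_top"
    by (rule Lim_transform_eventually[OF h3 eventually_mono[OF ev]]) (rule h4)
  have "L = 0" using derivative_limit_zero[OF d\<theta>(1) lim(3) d\<theta>lim] .
  then have e1: "e = - (c_v \<gamma> / M\<^sup>2 + 1 / 2 + 1 / (M\<^sup>2 * \<gamma>))" using assms by (simp add: L_def)
  have \<theta>': "deriv \<theta> x = temperature_rate \<gamma> \<kappa> M (u x + 1) (\<theta> x - 1)" if x: "x > 0" for x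
  proof -
    have "\<mu> * u x * velocity_rate \<gamma> \<mu> M (u x + 1) (\<theta> x - 1) + \<kappa> * temperature_rate \<gamma> \<kappa> M (u x + 1) (\<theta> x - 1)
       = en x + (c_v \<gamma> / M\<^sup>2 + 1 / 2 + 1 / (M\<^sup>2 * \<gamma>))"
      using temperature_rate_integrated[of \<gamma> \<mu> \<kappa> M "u x" "\<theta> x"] assms uneg[of x] x \<rho>[of x] by (simp add: en_def)
    also have "\<dots> = \<mu> * u x * deriv u x + \<kappa> * deriv \<theta> x" using e[OF x] e1 by simp
    finally show ?thesis using assms u'[OF x] by simp
  qed
  have "orbit \<gamma> \<mu> \<kappa> M (\<lambda>x. u x + 1) (\<lambda>x. \<theta> x - 1)"
    unfolding orbit_def
  proof (intro conjI allI impI)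
    show "continuous_on {0..} (\<lambda>x. u x + 1)" "continuous_on {0..} (\<lambda>x. \<theta> x - 1)" by (intro continuous_intros cont)+
    fix x :: real
    show "x \<ge> 0 \<Longrightarrow> u x + 1 < 1" using uneg[of x] by simp
    assume x: "x > 0"
    show "((\<lambda>x. u x + 1) has_real_derivative velocity_rate \<gamma> \<mu> M (u x + 1) (\<theta> x - 1)) (at x)"
      using du(1)[OF x] u'[OF x] by (auto intro!: derivative_eq_intros)
    show "((\<lambda>x. \<theta> x - 1) has_real_derivative temperature_rate \<gamma> \<kappa> M (u x + 1) (\<theta> x - 1)) (at x)"
      using d\<theta>(1)[OF x] \<theta>'[OF x] by (auto intro!: derivative_eq_intros)
  qed
  then show ?thesis using \<rho> by blast
qed

text \<open>On the open half line each flux equals the viscous term up to a constant, by the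
  integrated identities; differentiating removes the constant.\<close>

lemma solution_of_orbit:
  assumes "\<gamma> > 1" "\<mu> > 0" "\<kappa> > 0" "M > 0"
    and orb: "orbit \<gamma> \<mu> \<kappa> M a b"
    and sm: "smooth_on_halfline (\<lambda>x. 1 / (1 - a x))" "smooth_on_halfline (\<lambda>x. a x - 1)" "smooth_on_halfline (\<lambda>x. b x + 1)"
    and lim: "(a \<longlongrightarrow> 0) at_top" "(b \<longlongrightarrow> 0) at_top"
  shows "stationary_solution \<gamma> \<mu> \<kappa> M (a 0 - 1) (b 0 + 1) (\<lambda>x. 1 / (1 - a x)) (\<lambda>x. a x - 1) (\<lambda>x. b x + 1)"
proof -
  define u where "u x = a x - 1" for x
  define \<theta> where "\<theta> x = b x + 1" for x
  define \<rho> where "\<rho> x = 1 / (1 - a x)" for x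
  have o: "continuous_on {0..} a" "continuous_on {0..} b" "\<And>x. x \<ge> 0 \<Longrightarrow> a x < 1"
     "\<And>x. x > 0 \<Longrightarrow> (a has_real_derivative velocity_rate \<gamma> \<mu> M (a x) (b x)) (at x)"
     "\<And>x. x > 0 \<Longrightarrow> (b has_real_derivative temperature_rate \<gamma> \<kappa> M (a x) (b x)) (at x)"
    using orb by (auto simp: orbit_def)
  have sm': "smooth_on_halfline \<rho>" "smooth_on_halfline u" "smooth_on_halfline \<theta>"
    using sm by (simp_all add: \<rho>_def[abs_def] u_def[abs_def] \<theta>_def[abs_def])
  note du = has_deriv_of_smooth[OF sm'(2)] and d\<theta> = has_deriv_of_smooth[OF sm'(3)]
  have un: "u x < 0" if "x \<ge> 0" for x using o(3)[OF that] by (simp add: u_def)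
  have \<rho>: "\<rho> x = - 1 / u x" for x
    using minus_divide_divide[of "-1" "a x - 1"] by (simp add: \<rho>_def u_def)
  have u': "deriv u x = velocity_rate \<gamma> \<mu> M (u x + 1) (\<theta> x - 1)" if x: "x > 0" for x
    by (rule DERIV_imp_deriv) (use o(4)[OF x] in \<open>auto intro!: derivative_eq_intros simp: u_def[abs_def] \<theta>_def\<close>)
  have \<theta>': "deriv \<theta> x = temperature_rate \<gamma> \<kappa> M (u x + 1) (\<theta> x - 1)" if x: "x > 0" for x
    by (rule DERIV_imp_deriv) (use o(5)[OF x] in \<open>auto intro!: derivative_eq_intros simp: \<theta>_def[abs_def] u_def\<close>)
  have mass: "deriv (\<lambda>x. \<rho> x * u x) x = 0" if x: "x > 0" for x
  proof -
    have "deriv (\<lambda>x. \<rho> x * u x) x = deriv (\<lambda>x. -1) x"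
      using higher_deriv_cong_open[of "{0<..}" "\<lambda>x. \<rho> x * u x" "\<lambda>x. -1" x 1] un x by (simp add: \<rho> less_imp_neq)
    then show ?thesis by simp
  qed
  have mom: "deriv (\<lambda>x. \<rho> x * (u x)\<^sup>2 + 1 / M\<^sup>2 * pressure \<gamma> (\<rho> x) (\<theta> x)) x = \<mu> * deriv (deriv u) x" if x: "x > 0" for x
  proof -
    have "\<rho> y * (u y)\<^sup>2 + 1 / M\<^sup>2 * pressure \<gamma> (\<rho> y) (\<theta> y) = \<mu> * deriv u y + (1 + 1 / (M\<^sup>2 * \<gamma>))" if y: "y > 0" for y
      using velocity_rate_integrated[of \<gamma> \<mu> M "u y" "\<theta> y"] assms un[of y] y u'[OF y] by (simp add: \<rho>)
    then have "deriv (\<lambda>x. \<rho> x * (u x)\<^sup>2 + 1 / M\<^sup>2 * pressure \<gamma> (\<rho> x) (\<theta> x)) x = deriv (\<lambda>x. \<mu> * deriv u x + (1 + 1 / (M\<^sup>2 * \<gamma>))) x"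
      using higher_deriv_cong_open[of "{0<..}" "\<lambda>x. \<rho> x * (u x)\<^sup>2 + 1 / M\<^sup>2 * pressure \<gamma> (\<rho> x) (\<theta> x)"
         "\<lambda>x. \<mu> * deriv u x + (1 + 1 / (M\<^sup>2 * \<gamma>))" x 1] x by simp
    also have "\<dots> = \<mu> * deriv (deriv u) x"
      by (rule DERIV_imp_deriv) (use du(2)[OF x] in \<open>auto intro!: derivative_eq_intros\<close>)
    finally show ?thesis .
  qed
  define k where "k = c_v \<gamma> / M\<^sup>2 + 1 / 2 + 1 / (M\<^sup>2 * \<gamma>)"
  have ene: "deriv (\<lambda>x. \<rho> x * u x * (c_v \<gamma> / M\<^sup>2 * \<theta> x + (u x)\<^sup>2 / 2) + 1 / M\<^sup>2 * pressure \<gamma> (\<rho> x) (\<theta> x) * u x) x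
       = deriv (\<lambda>x. \<mu> * u x * deriv u x + \<kappa> * deriv \<theta> x) x" if x: "x > 0" for x
  proof -
    have "\<rho> y * u y * (c_v \<gamma> / M\<^sup>2 * \<theta> y + (u y)\<^sup>2 / 2) + 1 / M\<^sup>2 * pressure \<gamma> (\<rho> y) (\<theta> y) * u y
      = \<mu> * u y * deriv u y + \<kappa> * deriv \<theta> y - k" if y: "y > 0" for y
      using temperature_rate_integrated[of \<gamma> \<mu> \<kappa> M "u y" "\<theta> y"] assms un[of y] y u'[OF y] \<theta>'[OF y]
      by (simp add: \<rho> k_def)
    then have "deriv (\<lambda>x. \<rho> x * u x * (c_v \<gamma> / M\<^sup>2 * \<theta> x + (u x)\<^sup>2 / 2) + 1 / M\<^sup>2 * pressure \<gamma> (\<rho> x) (\<theta> x) * u x) x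
      = deriv (\<lambda>x. \<mu> * u x * deriv u x + \<kappa> * deriv \<theta> x - k) x"
      using higher_deriv_cong_open[of "{0<..}" "\<lambda>x. \<rho> x * u x * (c_v \<gamma> / M\<^sup>2 * \<theta> x + (u x)\<^sup>2 / 2) + 1 / M\<^sup>2 * pressure \<gamma> (\<rho> x) (\<theta> x) * u x"
         "\<lambda>x. \<mu> * u x * deriv u x + \<kappa> * deriv \<theta> x - k" x 1] x by simp
    also have "\<dots> = deriv (\<lambda>x. \<mu> * u x * deriv u x + \<kappa> * deriv \<theta> x) x"
    proof -
      have D: "((\<lambda>x. \<mu> * u x * deriv u x + \<kappa> * deriv \<theta> x) has_real_derivative
          (\<mu> * deriv u x) * deriv u x + deriv (deriv u) x * (\<mu> * u x) + \<kappa> * deriv (deriv \<theta>) x) (at x)"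
        by (intro DERIV_add DERIV_mult DERIV_cmult du d\<theta> x)
      from DERIV_diff[OF D DERIV_const[of k]] DERIV_imp_deriv[OF D] show ?thesis
        by (simp add: DERIV_imp_deriv)
    qed
    finally show ?thesis .
  qed
  have "continuous_on {0..} \<rho>" "continuous_on {0..} u" "continuous_on {0..} \<theta>"
    unfolding \<rho>_def[abs_def] u_def[abs_def] \<theta>_def[abs_def] using o(3)
    by (auto intro!: continuous_intros o(1,2) simp: less_imp_neq[THEN not_sym])
  moreover have "(\<rho> \<longlongrightarrow> 1 / (1 - 0)) at_top" "(u \<longlongrightarrow> 0 - 1) at_top" "(\<theta> \<longlongrightarrow> 0 + 1) at_top"
    unfolding \<rho>_def[abs_def] u_def[abs_def] \<theta>_def[abs_def] by (intro tendsto_intros lim; simp)+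
  ultimately have "stationary_solution \<gamma> \<mu> \<kappa> M (u 0) (\<theta> 0) \<rho> u \<theta>"
    unfolding stationary_solution_def using sm' mass mom ene by simp
  then show ?thesis by (simp add: \<rho>_def[abs_def] u_def[abs_def] \<theta>_def[abs_def])
qed


section \<open>Uniqueness of orbits with a given initial value\<close>

lemma quad_diff_bound:
  assumes B: "B \<ge> 1" and b: "\<bar>x\<bar> \<le> B" "\<bar>y\<bar> \<le> B" "\<bar>s\<bar> \<le> B" "\<bar>t\<bar> \<le> B" "\<bar>1 / (1 - x)\<bar> \<le> B" "\<bar>1 / (1 - y)\<bar> \<le> B"
    and nz: "x \<noteq> 1" "y \<noteq> 1"
  shows "\<bar>quad A C x s - quad A C y t\<bar> \<le> (3 * \<bar>A\<bar> * B ^ 4 + 2 * \<bar>C\<bar> * B) * (\<bar>x - y\<bar> + \<bar>s - t\<bar>)"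
proof -
  define p where "p = 1 / (1 - x)"
  define q where "q = 1 / (1 - y)"
  define D where "D = \<bar>x - y\<bar> + \<bar>s - t\<bar>"
  have pq: "\<bar>p\<bar> \<le> B" "\<bar>q\<bar> \<le> B" "p - q = (x - y) * p * q" using b nz by (auto simp: p_def q_def field_simps)
  have D: "\<bar>x - y\<bar> \<le> D" "\<bar>s - t\<bar> \<le> D" "0 \<le> D" by (auto simp: D_def)
  have B24: "B ^ 2 \<le> B ^ 4" using B by (intro power_increasing) auto
  have eq: "quad A C x s - quad A C y t = A * ((x - y) * (s * p) + (s - t) * (y * p) + (x - y) * (y * t * p * q)) + C * ((x - y) * (x + y))"
  proof -
    have "A * (x * s * p - y * t * q) = A * ((x - y) * (s * p) + (s - t) * (y * p) + y * t * (p - q))"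
      by (simp add: algebra_simps)
    then show ?thesis unfolding pq(3) quad_def
      by (simp add: p_def[symmetric] q_def[symmetric] divide_inverse algebra_simps power2_eq_square
          p_def[unfolded divide_inverse, simplified, symmetric] q_def[unfolded divide_inverse, simplified, symmetric])
  qed
  have m2: "\<bar>v * w\<bar> \<le> B ^ 2" if "\<bar>v\<bar> \<le> B" "\<bar>w\<bar> \<le> B" for v w
    unfolding abs_mult power2_eq_square using that B by (intro mult_mono) auto
  have 1: "\<bar>(x - y) * (s * p)\<bar> \<le> D * B ^ 4" unfolding abs_mult[of "x - y"]
    using D m2[OF b(3) pq(1)] B24 by (intro mult_mono) auto
  have 2: "\<bar>(s - t) * (y * p)\<bar> \<le> D * B ^ 4" unfolding abs_mult[of "s - t"]
    using D m2[OF b(2) pq(1)] B24 by (intro mult_mono) auto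
  have 3: "\<bar>(x - y) * (y * t * p * q)\<bar> \<le> D * B ^ 4"
  proof -
    have "\<bar>(y * t) * (p * q)\<bar> \<le> B ^ 2 * B ^ 2" unfolding abs_mult[of "y * t"]
      using m2[OF b(2,4)] m2[OF pq(1,2)] by (intro mult_mono) auto
    then have "\<bar>y * t * p * q\<bar> \<le> B ^ 4" by (simp add: mult.assoc power_add[symmetric])
    then show ?thesis unfolding abs_mult[of "x - y"] using D by (intro mult_mono) auto
  qed
  have 4: "\<bar>(x - y) * (x + y)\<bar> \<le> D * (2 * B)" unfolding abs_mult[of "x - y"]
    using D b by (intro mult_mono) auto
  have "\<bar>quad A C x s - quad A C y t\<bar> \<le> \<bar>A\<bar> * \<bar>(x - y) * (s * p) + (s - t) * (y * p) + (x - y) * (y * t * p * q)\<bar> + \<bar>C\<bar> * \<bar>(x - y) * (x + y)\<bar>"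
    unfolding eq abs_mult[of A, symmetric] abs_mult[of C, symmetric] by (rule abs_triangle_ineq)
  also have "\<dots> \<le> \<bar>A\<bar> * (3 * (D * B ^ 4)) + \<bar>C\<bar> * (D * (2 * B))"
    using 1 2 3 4 by (intro add_mono mult_left_mono) linarith+
  also have "\<dots> = (3 * \<bar>A\<bar> * B ^ 4 + 2 * \<bar>C\<bar> * B) * D" by (simp add: algebra_simps)
  finally show ?thesis unfolding D_def .
qed

lemma rate_diff_bound:
  assumes B: "B \<ge> 1"
  shows "\<exists>L\<ge>0. \<forall>x y s t. \<bar>x\<bar> \<le> B \<longrightarrow> \<bar>y\<bar> \<le> B \<longrightarrow> \<bar>x + s\<bar> \<le> B \<longrightarrow> \<bar>y + t\<bar> \<le> B \<longrightarrow> \<bar>1 / (1 - x)\<bar> \<le> B \<longrightarrow> \<bar>1 / (1 - y)\<bar> \<le> B \<longrightarrow> x \<noteq> 1 \<longrightarrow> y \<noteq> 1 \<longrightarrow>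
     \<bar>(j * x + k * s + quad A C x (x + s)) - (j * y + k * t + quad A C y (y + t))\<bar> \<le> L * (\<bar>x - y\<bar> + \<bar>s - t\<bar>)"
proof -
  define Q where "Q = 3 * \<bar>A\<bar> * B ^ 4 + 2 * \<bar>C\<bar> * B"
  have Q: "Q \<ge> 0" using B by (simp add: Q_def)
  define L where "L = \<bar>j\<bar> + \<bar>k\<bar> + 2 * Q"
  have "\<bar>(j * x + k * s + quad A C x (x + s)) - (j * y + k * t + quad A C y (y + t))\<bar> \<le> L * (\<bar>x - y\<bar> + \<bar>s - t\<bar>)"
    if "\<bar>x\<bar> \<le> B" "\<bar>y\<bar> \<le> B" "\<bar>x + s\<bar> \<le> B" "\<bar>y + t\<bar> \<le> B" "\<bar>1 / (1 - x)\<bar> \<le> B" "\<bar>1 / (1 - y)\<bar> \<le> B" "x \<noteq> 1" "y \<noteq> 1" for x y s t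
  proof -
    define D where "D = \<bar>x - y\<bar> + \<bar>s - t\<bar>"
    have D: "\<bar>x - y\<bar> \<le> D" "\<bar>s - t\<bar> \<le> D" by (auto simp: D_def)
    have "\<bar>quad A C x (x + s) - quad A C y (y + t)\<bar> \<le> Q * (\<bar>x - y\<bar> + \<bar>(x + s) - (y + t)\<bar>)"
      unfolding Q_def by (rule quad_diff_bound[OF B that])
    also have "\<dots> \<le> Q * (2 * D)"
    proof (rule mult_left_mono[OF _ Q])
      show "\<bar>x - y\<bar> + \<bar>(x + s) - (y + t)\<bar> \<le> 2 * D"
      proof -
        have "\<bar>(x + s) - (y + t)\<bar> = \<bar>(x - y) + (s - t)\<bar>" by (simp add: algebra_simps)
        also have "\<dots> \<le> D" unfolding D_def by (rule abs_triangle_ineq)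
        finally show ?thesis using D(1) by linarith
      qed
    qed
    finally have 1: "\<bar>quad A C x (x + s) - quad A C y (y + t)\<bar> \<le> 2 * Q * D" by simp
    have 2: "\<bar>j * (x - y)\<bar> \<le> \<bar>j\<bar> * D" "\<bar>k * (s - t)\<bar> \<le> \<bar>k\<bar> * D"
      using D by (simp_all add: abs_mult mult_left_mono)
    have "(j * x + k * s + quad A C x (x + s)) - (j * y + k * t + quad A C y (y + t))
      = j * (x - y) + k * (s - t) + (quad A C x (x + s) - quad A C y (y + t))" by (simp add: algebra_simps)
    then have "\<bar>(j * x + k * s + quad A C x (x + s)) - (j * y + k * t + quad A C y (y + t))\<bar> \<le> \<bar>j\<bar> * D + \<bar>k\<bar> * D + 2 * Q * D"
      using 1 2 by linarith
    then show ?thesis by (simp add: L_def D_def[symmetric] distrib_right)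
  qed
  moreover have "L \<ge> 0" using Q by (simp add: L_def)
  ultimately show ?thesis by blast
qed

text \<open>Neither orbit is assumed small. On [0, t] continuity and a < 1 bound the unknowns and 1
  / (1 - a), which gives a Lipschitz constant for the rates; then the squared distance satisfies a
  Gronwall inequality.\<close>

lemma orbit_unique:
  assumes o1: "orbit \<gamma> \<mu> \<kappa> M a1 b1" and o2: "orbit \<gamma> \<mu> \<kappa> M a2 b2"
    and init: "a1 0 = a2 0" "b1 0 = b2 0" and t: "t \<ge> 0"
  shows "a1 t = a2 t \<and> b1 t = b2 t"
proof -
  have c: "continuous_on {0..} a1" "continuous_on {0..} b1" "continuous_on {0..} a2" "continuous_on {0..} b2"
    and lt: "\<And>x. x \<ge> 0 \<Longrightarrow> a1 x < 1" "\<And>x. x \<ge> 0 \<Longrightarrow> a2 x < 1"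
    using o1 o2 by (auto simp: orbit_def)
  have bd: "\<exists>B. \<forall>x\<in>{0..t}. \<bar>f x\<bar> \<le> B" if "continuous_on {0..} f" for f :: "real \<Rightarrow> real"
  proof -
    have "compact (f ` {0..t})" by (intro compact_continuous_image continuous_on_subset[OF that]) auto
    then have "bounded (f ` {0..t})" by (rule compact_imp_bounded)
    then show ?thesis by (auto simp: bounded_iff)
  qed
  have inv: "continuous_on {0..} (\<lambda>x. 1 / (1 - a1 x))" "continuous_on {0..} (\<lambda>x. 1 / (1 - a2 x))"
    using lt by (auto intro!: continuous_intros c) (metis less_irrefl)+
  obtain B1 where B1: "\<And>x. x \<in> {0..t} \<Longrightarrow> \<bar>a1 x\<bar> \<le> B1" using bd[OF c(1)] by blast
  obtain B2 where B2: "\<And>x. x \<in> {0..t} \<Longrightarrow> \<bar>a2 x\<bar> \<le> B2" using bd[OF c(3)] by blast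
  obtain B3 where B3: "\<And>x. x \<in> {0..t} \<Longrightarrow> \<bar>a1 x + b1 x\<bar> \<le> B3" using bd[OF continuous_on_add[OF c(1,2)]] by blast
  obtain B4 where B4: "\<And>x. x \<in> {0..t} \<Longrightarrow> \<bar>a2 x + b2 x\<bar> \<le> B4" using bd[OF continuous_on_add[OF c(3,4)]] by blast
  obtain B5 where B5: "\<And>x. x \<in> {0..t} \<Longrightarrow> \<bar>1 / (1 - a1 x)\<bar> \<le> B5" using bd[OF inv(1)] by blast
  obtain B6 where B6: "\<And>x. x \<in> {0..t} \<Longrightarrow> \<bar>1 / (1 - a2 x)\<bar> \<le> B6" using bd[OF inv(2)] by blast
  define B where "B = Max {1, B1, B2, B3, B4, B5, B6}"
  have B: "1 \<le> B" "B1 \<le> B" "B2 \<le> B" "B3 \<le> B" "B4 \<le> B" "B5 \<le> B" "B6 \<le> B"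
    unfolding B_def by (rule Max_ge; simp)+
  obtain L1 where L1: "L1 \<ge> 0" "\<And>x y s t. \<bar>x\<bar> \<le> B \<Longrightarrow> \<bar>y\<bar> \<le> B \<Longrightarrow> \<bar>x + s\<bar> \<le> B \<Longrightarrow> \<bar>y + t\<bar> \<le> B \<Longrightarrow> \<bar>1 / (1 - x)\<bar> \<le> B \<Longrightarrow> \<bar>1 / (1 - y)\<bar> \<le> B \<Longrightarrow> x \<noteq> 1 \<Longrightarrow> y \<noteq> 1 \<Longrightarrow>
     \<bar>velocity_rate \<gamma> \<mu> M x s - velocity_rate \<gamma> \<mu> M y t\<bar> \<le> L1 * (\<bar>x - y\<bar> + \<bar>s - t\<bar>)"
    using rate_diff_bound[OF B(1)] unfolding velocity_rate_def by metis
  obtain L2 where L2: "L2 \<ge> 0" "\<And>x y s t. \<bar>x\<bar> \<le> B \<Longrightarrow> \<bar>y\<bar> \<le> B \<Longrightarrow> \<bar>x + s\<bar> \<le> B \<Longrightarrow> \<bar>y + t\<bar> \<le> B \<Longrightarrow> \<bar>1 / (1 - x)\<bar> \<le> B \<Longrightarrow> \<bar>1 / (1 - y)\<bar> \<le> B \<Longrightarrow> x \<noteq> 1 \<Longrightarrow> y \<noteq> 1 \<Longrightarrow>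
     \<bar>temperature_rate \<gamma> \<kappa> M x s - temperature_rate \<gamma> \<kappa> M y t\<bar> \<le> L2 * (\<bar>x - y\<bar> + \<bar>s - t\<bar>)"
    using rate_diff_bound[OF B(1)] unfolding temperature_rate_def by metis
  define L where "L = L1 + L2"
  define E where "E x = (a1 x - a2 x)\<^sup>2 + (b1 x - b2 x)\<^sup>2" for x
  define r1 where "r1 x = velocity_rate \<gamma> \<mu> M (a1 x) (b1 x) - velocity_rate \<gamma> \<mu> M (a2 x) (b2 x)" for x
  define r2 where "r2 x = temperature_rate \<gamma> \<kappa> M (a1 x) (b1 x) - temperature_rate \<gamma> \<kappa> M (a2 x) (b2 x)" for x
  have "E t = 0"
  proof (rule zero_of_gronwall[where s=0 and t=t and V=E and V'="\<lambda>x. 2 * (a1 x - a2 x) * r1 x + 2 * (b1 x - b2 x) * r2 x" and K="4 * L"])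
    show "continuous_on {0..t} E" unfolding E_def by (intro continuous_intros continuous_on_subset[OF c(1)]
       continuous_on_subset[OF c(2)] continuous_on_subset[OF c(3)] continuous_on_subset[OF c(4)]) auto
    show "E 0 = 0" using init by (simp add: E_def)
    fix x assume x: "0 < x" "x < t"
    then have xt: "x \<in> {0..t}" by auto
    have "(a1 has_real_derivative velocity_rate \<gamma> \<mu> M (a1 x) (b1 x)) (at x)" "(a2 has_real_derivative velocity_rate \<gamma> \<mu> M (a2 x) (b2 x)) (at x)"
      "(b1 has_real_derivative temperature_rate \<gamma> \<kappa> M (a1 x) (b1 x)) (at x)" "(b2 has_real_derivative temperature_rate \<gamma> \<kappa> M (a2 x) (b2 x)) (at x)"
      using o1 o2 x by (auto simp: orbit_def)
    then have "(E has_real_derivative 2 * (a1 x - a2 x) * r1 x + 2 * (b1 x - b2 x) * r2 x) (at x)"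
      unfolding E_def r1_def r2_def by (auto intro!: derivative_eq_intros simp: algebra_simps)
    moreover have "\<bar>2 * (a1 x - a2 x) * r1 x + 2 * (b1 x - b2 x) * r2 x\<bar> \<le> 4 * L * \<bar>E x\<bar>"
    proof -
      define D where "D = \<bar>a1 x - a2 x\<bar> + \<bar>b1 x - b2 x\<bar>"
      have D: "\<bar>a1 x - a2 x\<bar> \<le> D" "\<bar>b1 x - b2 x\<bar> \<le> D" "D \<ge> 0" by (auto simp: D_def)
      have ne: "a1 x \<noteq> 1" "a2 x \<noteq> 1" using lt(1)[of x] lt(2)[of x] x by auto
      note bds = order_trans[OF B1[OF xt] B(2)] order_trans[OF B2[OF xt] B(3)] order_trans[OF B3[OF xt] B(4)]
        order_trans[OF B4[OF xt] B(5)] order_trans[OF B5[OF xt] B(6)] order_trans[OF B6[OF xt] B(7)]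
      have r: "\<bar>r1 x\<bar> \<le> L1 * D" "\<bar>r2 x\<bar> \<le> L2 * D"
        unfolding r1_def r2_def D_def by (rule L1(2)[OF bds ne], rule L2(2)[OF bds ne])
      have "\<bar>(a1 x - a2 x) * r1 x\<bar> \<le> D * (L1 * D)" "\<bar>(b1 x - b2 x) * r2 x\<bar> \<le> D * (L2 * D)"
        unfolding abs_mult using D r by (auto intro!: mult_mono)
      then have "\<bar>2 * (a1 x - a2 x) * r1 x + 2 * (b1 x - b2 x) * r2 x\<bar> \<le> 2 * (D * (L1 * D)) + 2 * (D * (L2 * D))"
        unfolding mult.assoc[of 2] by linarith
      also have "\<dots> = 2 * L * D\<^sup>2" by (simp add: L_def power2_eq_square algebra_simps)
      also have "\<dots> \<le> 2 * L * (2 * E x)"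
      proof (rule mult_left_mono)
        show "D\<^sup>2 \<le> 2 * E x" using sum_squares_bound[of "\<bar>a1 x - a2 x\<bar>" "\<bar>b1 x - b2 x\<bar>"]
          by (simp add: D_def E_def power2_sum)
      qed (use L1 L2 in \<open>simp add: L_def\<close>)
      also have "\<dots> = 4 * L * \<bar>E x\<bar>" by (simp add: E_def)
      finally show ?thesis .
    qed
    ultimately show "(E has_real_derivative 2 * (a1 x - a2 x) * r1 x + 2 * (b1 x - b2 x) * r2 x) (at x) \<and>
      \<bar>2 * (a1 x - a2 x) * r1 x + 2 * (b1 x - b2 x) * r2 x\<bar> \<le> 4 * L * \<bar>E x\<bar>" by blast
  qed (use t in auto)
  then show ?thesis by (simp add: E_def sum_power2_eq_zero_iff)
qed

lemma unique_solution_of_orbit: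
  assumes par: "\<gamma> > 1" "\<mu> > 0" "\<kappa> > 0" "M > 0"
    and orb: "orbit \<gamma> \<mu> \<kappa> M a b"
    and sm: "smooth_on_halfline (\<lambda>x. 1 / (1 - a x))" "smooth_on_halfline (\<lambda>x. a x - 1)" "smooth_on_halfline (\<lambda>x. b x + 1)"
    and lim: "(a \<longlongrightarrow> 0) at_top" "(b \<longlongrightarrow> 0) at_top"
  shows "unique_stationary_solution \<gamma> \<mu> \<kappa> M (a 0 - 1) (b 0 + 1) (\<lambda>x. 1 / (1 - a x)) (\<lambda>x. a x - 1) (\<lambda>x. b x + 1)"
  unfolding unique_stationary_solution_def
proof (intro conjI allI impI)
  show "stationary_solution \<gamma> \<mu> \<kappa> M (a 0 - 1) (b 0 + 1) (\<lambda>x. 1 / (1 - a x)) (\<lambda>x. a x - 1) (\<lambda>x. b x + 1)"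
    by (rule solution_of_orbit[OF assms])
  fix \<rho>' u' \<theta>' and x :: real
  assume sol: "stationary_solution \<gamma> \<mu> \<kappa> M (a 0 - 1) (b 0 + 1) \<rho>' u' \<theta>'" and x: "x \<ge> 0"
  have o': "orbit \<gamma> \<mu> \<kappa> M (\<lambda>x. u' x + 1) (\<lambda>x. \<theta>' x - 1)" and \<rho>': "\<rho>' x = - 1 / u' x"
    using orbit_of_solution[OF par sol] x by auto
  have "u' 0 = a 0 - 1" "\<theta>' 0 = b 0 + 1" using sol by (auto simp: stationary_solution_def)
  then have eq: "u' x + 1 = a x \<and> \<theta>' x - 1 = b x"
    using orbit_unique[OF o' orb _ _ x] by simp
  then have u: "u' x = a x - 1" and \<theta>: "\<theta>' x = b x + 1" by auto
  show "u' x = a x - 1" "\<theta>' x = b x + 1" by (rule u, rule \<theta>)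
  show "\<rho>' x = 1 / (1 - a x)" unfolding \<rho>' u using minus_divide_divide[of "-1" "a x - 1"] by simp
qed

section \<open>From decay classes to solutions of the stationary problem\<close>

context decay_weights
begin

lemma cls_smooth:
  assumes "\<And>K. cls K n f" "p \<in> A"
  shows "smooth_on_halfline (f p)"
  using cls_higher_deriv[OF assms(1)] assms(2) unfolding smooth_on_halfline_def by blast

lemma W_tendsto_0:
  assumes "((\<lambda>x. Z p x) \<longlongrightarrow> 0) at_top"
  shows "((\<lambda>x. W 1 p x) \<longlongrightarrow> 0) at_top"
proof -
  have "((\<lambda>x::real. exp (- (c * x))) \<longlongrightarrow> 0) at_top"
    using c by (intro filterlim_compose[OF exp_at_bot]) 
      (auto intro!: filterlim_tendsto_pos_mult_at_top[where c=c] filterlim_ident simp: filterlim_uminus_at_bot)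
  then have "((\<lambda>x. Z p x + \<delta> p * exp (- c * x)) \<longlongrightarrow> 0 + \<delta> p * 0) at_top"
    by (intro tendsto_intros assms) simp
  then show ?thesis by (simp add: W_def)
qed

lemma cls_tendsto_0:
  assumes f: "cls 0 1 f" and p: "p \<in> A" and Z: "((\<lambda>x. Z p x) \<longlongrightarrow> 0) at_top"
  shows "(f p \<longlongrightarrow> 0) at_top"
proof -
  obtain C where C: "\<And>p x. p \<in> A \<Longrightarrow> x > 0 \<Longrightarrow> \<bar>f p x\<bar> \<le> C * W 1 p x" using f by (rule cls_0E) blast
  have "((\<lambda>x. C * W 1 p x) \<longlongrightarrow> C * 0) at_top" by (intro tendsto_intros W_tendsto_0 Z)
  then have 1: "((\<lambda>x. C * W 1 p x) \<longlongrightarrow> 0) at_top" by simp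
  have 2: "\<forall>\<^sub>F x in at_top. norm (f p x) \<le> C * W 1 p x"
    using C[OF p] by (intro eventually_mono[OF eventually_gt_at_top[of 0]]) simp
  show ?thesis by (rule Lim_null_comparison[OF 2 1])
qed

text \<open>The density perturbation is \<rho> - 1 = a / (1 - a), so the three classes cover the
  three components. Smoothness holds because the classes are given for every K.\<close>

lemma unique_solutions_with_decay:
  fixes a b :: "'p \<Rightarrow> real \<Rightarrow> real"
  assumes par: "\<gamma> > 1" "\<mu> > 0" "\<kappa> > 0" "M > 0"
    and orb: "\<And>p. p \<in> A \<Longrightarrow> orbit \<gamma> \<mu> \<kappa> M (a p) (b p)"
    and Z0: "\<And>p. p \<in> A \<Longrightarrow> ((\<lambda>x. Z p x) \<longlongrightarrow> 0) at_top"
    and cls: "\<And>K. cls K 1 a" "\<And>K. cls K 1 b" "\<And>K. cls K 1 (\<lambda>p x. a p x / (1 - a p x))"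
  shows "\<exists>C. (\<forall>k. C k > 0) \<and> (\<forall>p\<in>A. \<exists>\<rho> u \<theta>. unique_stationary_solution \<gamma> \<mu> \<kappa> M (a p 0 - 1) (b p 0 + 1) \<rho> u \<theta> \<and>
     (\<forall>k. \<forall>x>0. norm (perturbation_deriv k \<rho> u \<theta> x) \<le> C k * W (Suc k) p x))"
proof -
  have "\<exists>C. \<forall>p\<in>A. \<forall>x>0. \<bar>(deriv ^^ k) (a p) x\<bar> \<le> C * W (Suc k) p x" for k
    using cls_higher_deriv[OF cls(1), of k] by auto
  then obtain Ca where Ca: "\<And>k p x. p \<in> A \<Longrightarrow> x > 0 \<Longrightarrow> \<bar>(deriv ^^ k) (a p) x\<bar> \<le> Ca k * W (Suc k) p x" by metis
  have "\<exists>C. \<forall>p\<in>A. \<forall>x>0. \<bar>(deriv ^^ k) (b p) x\<bar> \<le> C * W (Suc k) p x" for k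
    using cls_higher_deriv[OF cls(2), of k] by auto
  then obtain Cb where Cb: "\<And>k p x. p \<in> A \<Longrightarrow> x > 0 \<Longrightarrow> \<bar>(deriv ^^ k) (b p) x\<bar> \<le> Cb k * W (Suc k) p x" by metis
  have "\<exists>C. \<forall>p\<in>A. \<forall>x>0. \<bar>(deriv ^^ k) (\<lambda>x. a p x / (1 - a p x)) x\<bar> \<le> C * W (Suc k) p x" for k
    using cls_higher_deriv[OF cls(3), of k] by auto
  then obtain Cr where Cr: "\<And>k p x. p \<in> A \<Longrightarrow> x > 0 \<Longrightarrow> \<bar>(deriv ^^ k) (\<lambda>x. a p x / (1 - a p x)) x\<bar> \<le> Cr k * W (Suc k) p x" by metis
  define C where "C k = \<bar>Ca k\<bar> + \<bar>Cb k\<bar> + \<bar>Cr k\<bar> + 1" for k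
  have "\<exists>\<rho> u \<theta>. unique_stationary_solution \<gamma> \<mu> \<kappa> M (a p 0 - 1) (b p 0 + 1) \<rho> u \<theta> \<and>
     (\<forall>k. \<forall>x>0. norm (perturbation_deriv k \<rho> u \<theta> x) \<le> C k * W (Suc k) p x)" if p: "p \<in> A" for p
  proof (intro exI conjI allI impI)
    have lt: "a p x < 1" if "x \<ge> 0" for x using orb[OF p] that by (simp add: orbit_def)
    have r: "1 / (1 - a p x) = 1 + a p x / (1 - a p x)" if "x > 0" for x
    proof -
      have "1 - a p x \<noteq> 0" using lt[of x] that by auto
      then show ?thesis by (simp add: field_simps)
    qed
    have "cls K 0 a" "cls K 0 b" "cls K 0 (\<lambda>p x. a p x / (1 - a p x))" for K
      using cls_order[of K 0] cls by auto
    note c = this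
    have c0: "cls K 0 (\<lambda>p x. -1 + a p x)" "cls K 0 (\<lambda>p x. 1 + b p x)" "cls K 0 (\<lambda>p x. 1 + a p x / (1 - a p x))" for K
      by (rule cls_add[OF cls_const c(1)], rule cls_add[OF cls_const c(2)], rule cls_add[OF cls_const c(3)])
    have lt': "a p x < 1" if "p \<in> A" "x > 0" for p x using orb[OF that(1)] that(2) by (simp add: orbit_def)
    have "cls K 0 (\<lambda>p x. 1 / (1 - a p x))" for K
    proof (rule cls_cong[OF c0(3)])
      fix p x assume "p \<in> A" "(x::real) > 0"
      then have "1 - a p x \<noteq> 0" using lt'[of p x] by auto
      then show "1 + a p x / (1 - a p x) = 1 / (1 - a p x)" by (simp add: field_simps)
    qed
    moreover have "cls K 0 (\<lambda>p x. a p x - 1)" "cls K 0 (\<lambda>p x. b p x + 1)" for K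
      by (rule cls_cong[OF c0(1)], simp, rule cls_cong[OF c0(2)], simp)
    ultimately have sm: "smooth_on_halfline (\<lambda>x. 1 / (1 - a p x))" "smooth_on_halfline (\<lambda>x. a p x - 1)" "smooth_on_halfline (\<lambda>x. b p x + 1)"
      using cls_smooth[OF _ p] by blast+
    show "unique_stationary_solution \<gamma> \<mu> \<kappa> M (a p 0 - 1) (b p 0 + 1) (\<lambda>x. 1 / (1 - a p x)) (\<lambda>x. a p x - 1) (\<lambda>x. b p x + 1)"
      using cls(1)[of 0] cls(2)[of 0] p Z0[OF p]
      by (intro unique_solution_of_orbit par orb sm) (auto intro: cls_tendsto_0 simp del: cls.simps)
    fix k and x :: real assume x: "x > 0"
    have "(deriv ^^ k) (\<lambda>x. 1 / (1 - a p x) - 1) x = (deriv ^^ k) (\<lambda>x. a p x / (1 - a p x)) x"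
      by (rule higher_deriv_cong_open[of "{0<..}"]) (use x r in auto)
    then have "perturbation_deriv k (\<lambda>x. 1 / (1 - a p x)) (\<lambda>x. a p x - 1) (\<lambda>x. b p x + 1) x
      = ((deriv ^^ k) (\<lambda>x. a p x / (1 - a p x)) x, (deriv ^^ k) (a p) x, (deriv ^^ k) (b p) x)"
      by (simp add: perturbation_deriv_def)
    then have "norm (perturbation_deriv k (\<lambda>x. 1 / (1 - a p x)) (\<lambda>x. a p x - 1) (\<lambda>x. b p x + 1) x)
      \<le> \<bar>(deriv ^^ k) (\<lambda>x. a p x / (1 - a p x)) x\<bar> + (\<bar>(deriv ^^ k) (a p) x\<bar> + \<bar>(deriv ^^ k) (b p) x\<bar>)"
      using norm_Pair_le[of "(deriv ^^ k) (\<lambda>x. a p x / (1 - a p x)) x" "((deriv ^^ k) (a p) x, (deriv ^^ k) (b p) x)"]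
        norm_Pair_le[of "(deriv ^^ k) (a p) x" "(deriv ^^ k) (b p) x"] by simp
    also have "\<dots> \<le> Cr k * W (Suc k) p x + (Ca k * W (Suc k) p x + Cb k * W (Suc k) p x)"
      by (intro add_mono Ca Cb Cr p x)
    also have "\<dots> = (Cr k + Ca k + Cb k) * W (Suc k) p x" by (simp add: algebra_simps)
    also have "\<dots> \<le> C k * W (Suc k) p x" using W_nonneg[OF p x] by (intro mult_right_mono) (auto simp: C_def)
    finally show "norm (perturbation_deriv k (\<lambda>x. 1 / (1 - a p x)) (\<lambda>x. a p x - 1) (\<lambda>x. b p x + 1) x) \<le> C k * W (Suc k) p x" .
  qed
  moreover have "C k > 0" for k by (simp add: C_def add_nonneg_pos)
  ultimately show ?thesis by blast
qed

end

section \<open>Supersonic orbits\<close>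


text \<open>The left-hand side is the determinant of diag(\<mu>, \<kappa>) J. The value of
  \<open>c_v\<close> makes it factor, so its sign is that of M - 1 in all three regimes.\<close>

lemma sound_discriminant:
  fixes \<gamma> M :: real
  assumes "\<gamma> > 1" "M > 0"
  shows "(1 - 1 / (M\<^sup>2 * \<gamma>)) * (c_v \<gamma> / M\<^sup>2) - (1 / (M\<^sup>2 * \<gamma>))\<^sup>2 = c_v \<gamma> / M\<^sup>2 * (1 - 1 / M\<^sup>2)"
  using assms unfolding c_v_def by (simp add: field_simps power2_eq_square)

text \<open>For the symmetric matrix S of the form, Cayley-Hamilton gives tr(S) S - det(S) = S^2,
  which is nonnegative. So det / trace is a lower bound, with the two squares being those of the
  components of S (x, y).\<close>

lemma positive_definite_form:
  fixes p q v x y :: real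
  assumes "p > 0" "v > 0" "p * v - q\<^sup>2 > 0"
  shows "(p * v - q\<^sup>2) / (p + v) * (x\<^sup>2 + y\<^sup>2) \<le> p * x\<^sup>2 - 2 * q * x * y + v * y\<^sup>2"
proof -
  have "(p + v) * (p * x\<^sup>2 - 2 * q * x * y + v * y\<^sup>2) - (p * v - q\<^sup>2) * (x\<^sup>2 + y\<^sup>2) = (p * x - q * y)\<^sup>2 + (q * x - v * y)\<^sup>2"
    by (simp add: power2_eq_square algebra_simps)
  then have "(p * v - q\<^sup>2) * (x\<^sup>2 + y\<^sup>2) \<le> (p + v) * (p * x\<^sup>2 - 2 * q * x * y + v * y\<^sup>2)"
    by (smt (verit) zero_le_power2)
  then show ?thesis using assms by (simp add: divide_le_eq mult.commute)
qed

lemma supersonic_orbit: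
  assumes par: "\<gamma> > 1" "\<mu> > 0" "\<kappa> > 0" "M > 1"
  shows "\<exists>e>0. \<exists>c>0. \<exists>C. \<forall>a0 b0. norm (a0, b0) < e \<longrightarrow> (\<exists>a b. orbit \<gamma> \<mu> \<kappa> M a b \<and> a 0 = a0 \<and> b 0 = b0 \<and>
    (\<forall>x\<ge>0. a x \<le> 1/2 \<and> norm (a x, b x) \<le> C * (norm (a0, b0) * exp (- c * x))))"
proof -
  define q where "q = 1 / (M\<^sup>2 * \<gamma>)"
  define v where "v = c_v \<gamma> / M\<^sup>2"
  define j11 where "j11 = 1 / \<mu> * (1 / (M\<^sup>2 * \<gamma>) - 1)"
  define j12 where "j12 = 1 / (\<mu> * M\<^sup>2 * \<gamma>)"
  define j21 where "j21 = 1 / (\<kappa> * M\<^sup>2 * \<gamma>)"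
  define j22 where "j22 = - c_v \<gamma> / (\<kappa> * M\<^sup>2)"
  \<comment> \<open>Identity coordinates: U = a, T = b. The locale supplies F1, F2 and
    \<open>ball_flow\<close>, to which the full matrix J is passed; 0 and -1 meet the sign
    assumptions.\<close>
  interpret planar_field 0 "-1" 1 0 1 1 j12 0 0 "1 / (2 * \<kappa>)" by unfold_locales auto
  have rates: "velocity_rate \<gamma> \<mu> M a b = j11 * a + j12 * b + F1 a b"
    "temperature_rate \<gamma> \<kappa> M a b = j21 * a + j22 * b + F2 a b" for a b
    unfolding velocity_rate_def temperature_rate_def F1_def F2_def
    by (simp_all add: j11_def j12_def j21_def j22_def)
  have M2: "M\<^sup>2 > 1" using par by (simp add: one_less_power)
  have "1 < M\<^sup>2 * \<gamma>" using less_1_mult[OF M2 par(1)] .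
  then have p: "1 - q > 0" by (simp add: q_def)
  have v: "v > 0" using par by (simp add: v_def c_v_def)
  have disc: "(1 - q) * v - q\<^sup>2 > 0"
  proof -
    have "v * (1 - 1 / M\<^sup>2) > 0" using v M2 by (intro mult_pos_pos) (auto simp: divide_less_eq)
    then show ?thesis using sound_discriminant[of \<gamma> M] par by (simp only: q_def v_def)
  qed
  define \<eta> where "\<eta> = ((1 - q) * v - q\<^sup>2) / ((1 - q) + v)"
  have \<eta>: "\<eta> > 0" using disc p v by (simp add: \<eta>_def)
  \<comment> \<open>Small enough for the nonlinear terms to consume at most half of the negative
    definite part \<eta>.\<close>
  define R where "R = min (1 / (2 * N)) (\<eta> / (4 * (\<mu> + \<kappa>) * (K + 1)))"
  have R: "R > 0" "N * R \<le> 1/2" "4 * (\<mu> + \<kappa>) * (K * R) \<le> \<eta>"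
  proof -
    have d: "4 * (\<mu> + \<kappa>) * (K + 1) > 0" using par K by (intro mult_pos_pos) auto
    show R0: "R > 0" unfolding R_def using N \<eta> d by simp
    have "R \<le> 1 / (2 * N)" by (simp add: R_def)
    then have "R * (2 * N) \<le> 1" using N by (subst (asm) le_divide_eq) auto
    then show "N * R \<le> 1/2" by (simp add: mult_ac)
    have "R \<le> \<eta> / (4 * (\<mu> + \<kappa>) * (K + 1))" by (simp add: R_def)
    then have "R * (4 * (\<mu> + \<kappa>) * (K + 1)) \<le> \<eta>" using d by (subst (asm) le_divide_eq) auto
    moreover have "0 \<le> R * (4 * (\<mu> + \<kappa>))" using R0 par by simp
    ultimately show "4 * (\<mu> + \<kappa>) * (K * R) \<le> \<eta>" by (simp add: algebra_simps)
  qed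
  define m where "m = min \<mu> \<kappa>"
  have m: "m > 0" "m \<le> \<mu>" "m \<le> \<kappa>" using par by (auto simp: m_def)
  \<comment> \<open>E is at most (\<mu> + \<kappa>) times the squared norm, so E' \<le> - \<eta>
    (a^2 + b^2) gives E' \<le> - 2 c E.\<close>
  define c where "c = \<eta> / (2 * (\<mu> + \<kappa>))"
  have c: "c > 0" using \<eta> par by (simp add: c_def)
  \<comment> \<open>The loss in passing from the Euclidean norm to E and back.\<close>
  define Q where "Q = sqrt ((\<mu> + \<kappa>) / m)"
  have Q: "Q \<ge> 1" "Q\<^sup>2 = (\<mu> + \<kappa>) / m" using m par by (auto simp: Q_def)
  have nsq: "(norm (a, b))\<^sup>2 = a\<^sup>2 + b\<^sup>2" for a b :: real by (simp add: norm_Pair)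
  have "\<exists>a b. orbit \<gamma> \<mu> \<kappa> M a b \<and> a 0 = a0 \<and> b 0 = b0 \<and>
    (\<forall>x\<ge>0. a x \<le> 1/2 \<and> norm (a x, b x) \<le> Q * (norm (a0, b0) * exp (- c * x)))"
    if small: "norm (a0, b0) < R / Q" for a0 b0
  proof -
    obtain a b where ab: "a 0 = a0" "b 0 = b0" "continuous_on {0..} a" "continuous_on {0..} b"
      and fl: "\<And>x. x \<ge> 0 \<Longrightarrow> norm (a x, b x) \<le> R \<Longrightarrow> flow j11 j12 j21 j22 a b x"
      using ball_flow[OF R(1,2), of a0 b0 j11 j12 j21 j22] by blast
    have der: "(a has_real_derivative velocity_rate \<gamma> \<mu> M (a x) (b x)) (at x)"
      "(b has_real_derivative temperature_rate \<gamma> \<kappa> M (a x) (b x)) (at x)" if x: "x > 0" "norm (a x, b x) \<le> R" for x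
    proof -
      have "at x within {0..} = at x" using x by (intro at_within_interior) auto
      then show "(a has_real_derivative velocity_rate \<gamma> \<mu> M (a x) (b x)) (at x)"
      "(b has_real_derivative temperature_rate \<gamma> \<kappa> M (a x) (b x)) (at x)"
        using fl[of x] x by (auto simp: flow_def rates)
    qed
    have comp: "\<bar>a x\<bar> \<le> norm (a x, b x)" "\<bar>b x\<bar> \<le> norm (a x, b x)" for x
      using norm_fst_le[of "a x" "b x"] norm_snd_le[of "b x" "a x"] by auto
    have decay: "norm (a \<tau>, b \<tau>) \<le> Q * (norm (a0, b0) * exp (- c * \<tau>))"
      if \<tau>: "\<tau> \<ge> 0" and inR: "\<And>x. 0 \<le> x \<Longrightarrow> x \<le> \<tau> \<Longrightarrow> norm (a x, b x) \<le> R" for \<tau>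
    proof -
      define E where "E x = \<mu> * (a x)\<^sup>2 + \<kappa> * (b x)\<^sup>2" for x
      have "E \<tau> \<le> exp (- (2 * c) * (\<tau> - 0)) * E 0"
      proof (rule gronwall_decay[OF _ \<tau>, where E'="\<lambda>x. 2 * (\<mu> * a x * velocity_rate \<gamma> \<mu> M (a x) (b x) + \<kappa> * b x * temperature_rate \<gamma> \<kappa> M (a x) (b x))"])
        show "continuous_on {0..\<tau>} E" unfolding E_def
          by (intro continuous_intros continuous_on_subset[OF ab(3)] continuous_on_subset[OF ab(4)]) auto
        fix x assume x: "0 < x" "x < \<tau>"
        then have nR: "norm (a x, b x) \<le> R" using inR by simp
        have bd: "\<bar>a x\<bar> \<le> R" "\<bar>b x\<bar> \<le> R" using comp[of x] nR by auto
        define s where "s = (a x)\<^sup>2 + (b x)\<^sup>2"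
        have D: "(E has_real_derivative 2 * (\<mu> * a x * velocity_rate \<gamma> \<mu> M (a x) (b x) + \<kappa> * b x * temperature_rate \<gamma> \<kappa> M (a x) (b x))) (at x)"
          unfolding E_def using der[OF x(1) nR] by (auto intro!: derivative_eq_intros simp: algebra_simps)
        have lin: "\<mu> * a x * (j11 * a x + j12 * b x) + \<kappa> * b x * (j21 * a x + j22 * b x)
          = - ((1 - q) * (a x)\<^sup>2 - 2 * q * a x * b x + v * (b x)\<^sup>2)"
          unfolding j11_def j12_def j21_def j22_def q_def v_def using par
          by (simp add: field_simps power2_eq_square)
        have neg: "- ((1 - q) * (a x)\<^sup>2 - 2 * q * a x * b x + v * (b x)\<^sup>2) \<le> - \<eta> * s"
          using positive_definite_form[OF p v disc, of "a x" "b x"] by (simp add: \<eta>_def s_def)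
        define t where "t = \<bar>a x\<bar> + \<bar>b x\<bar>"
        have ts: "t\<^sup>2 \<le> 2 * s" using sum_squares_bound[of "\<bar>a x\<bar>" "\<bar>b x\<bar>"] by (simp add: t_def s_def power2_sum)
        have F: "\<bar>F1 (a x) (b x)\<bar> \<le> K * R * t" "\<bar>F2 (a x) (b x)\<bar> \<le> K * R * t"
          using F_bound[OF R(2) bd] by (auto simp: t_def)
        have t0: "t \<ge> 0" "\<bar>a x\<bar> \<le> t" "\<bar>b x\<bar> \<le> t" by (auto simp: t_def)
        have prod_le: "y * z \<le> t * (K * R * t)" if "\<bar>y\<bar> \<le> t" "\<bar>z\<bar> \<le> K * R * t" for y z
        proof -
          have "y * z \<le> \<bar>y\<bar> * \<bar>z\<bar>" unfolding abs_mult[symmetric] by (rule abs_ge_self)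
          also have "\<dots> \<le> t * (K * R * t)" using that t0(1) by (intro mult_mono) auto
          finally show ?thesis .
        qed
        note prod_le[OF t0(2) F(1)] prod_le[OF t0(3) F(2)]
        then have "\<mu> * (a x * F1 (a x) (b x)) + \<kappa> * (b x * F2 (a x) (b x)) \<le> \<mu> * (t * (K * R * t)) + \<kappa> * (t * (K * R * t))"
          using par by (intro add_mono mult_left_mono) auto
        also have "\<dots> = ((\<mu> + \<kappa>) * (K * R)) * t\<^sup>2" by (simp add: algebra_simps power2_eq_square)
        also have "\<dots> \<le> ((\<mu> + \<kappa>) * (K * R)) * (2 * s)" using ts par K R(1) by (intro mult_left_mono) auto
        also have "\<dots> = (4 * (\<mu> + \<kappa>) * (K * R)) * (s / 2)" by simp
        also have "\<dots> \<le> \<eta> * (s / 2)" using R(3) by (intro mult_right_mono) (auto simp: s_def)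
        finally have nl: "\<mu> * (a x * F1 (a x) (b x)) + \<kappa> * (b x * F2 (a x) (b x)) \<le> \<eta> / 2 * s" by simp
        have "\<mu> * a x * velocity_rate \<gamma> \<mu> M (a x) (b x) + \<kappa> * b x * temperature_rate \<gamma> \<kappa> M (a x) (b x)
          = (\<mu> * a x * (j11 * a x + j12 * b x) + \<kappa> * b x * (j21 * a x + j22 * b x)) + (\<mu> * (a x * F1 (a x) (b x)) + \<kappa> * (b x * F2 (a x) (b x)))"
          unfolding rates by (simp add: algebra_simps)
        also have "\<dots> \<le> - \<eta> * s + \<eta> / 2 * s" using lin neg nl by linarith
        finally have "2 * (\<mu> * a x * velocity_rate \<gamma> \<mu> M (a x) (b x) + \<kappa> * b x * temperature_rate \<gamma> \<kappa> M (a x) (b x)) \<le> - \<eta> * s" by simp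
        also have "\<dots> \<le> - (2 * c) * E x"
        proof -
          have "E x \<le> (\<mu> + \<kappa>) * s" using par by (simp add: E_def s_def algebra_simps)
          then have "2 * c * E x \<le> 2 * c * ((\<mu> + \<kappa>) * s)" using c by (intro mult_left_mono) auto
          also have "\<dots> = (c * (2 * (\<mu> + \<kappa>))) * s" by simp
          also have "c * (2 * (\<mu> + \<kappa>)) = \<eta>" using par by (simp only: c_def) simp
          finally show ?thesis by simp
        qed
        finally show "(E has_real_derivative 2 * (\<mu> * a x * velocity_rate \<gamma> \<mu> M (a x) (b x) + \<kappa> * b x * temperature_rate \<gamma> \<kappa> M (a x) (b x))) (at x) \<and>
          2 * (\<mu> * a x * velocity_rate \<gamma> \<mu> M (a x) (b x) + \<kappa> * b x * temperature_rate \<gamma> \<kappa> M (a x) (b x)) \<le> - (2 * c) * E x"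
          using D by blast
      qed
      also have "E 0 \<le> (\<mu> + \<kappa>) * (norm (a0, b0))\<^sup>2" using par by (simp add: E_def nsq ab algebra_simps)
      finally have "E \<tau> \<le> exp (- (2 * c) * \<tau>) * ((\<mu> + \<kappa>) * (norm (a0, b0))\<^sup>2)" by (simp add: mult_left_mono)
      moreover have "m * (norm (a \<tau>, b \<tau>))\<^sup>2 \<le> E \<tau>"
        using m by (simp add: nsq E_def distrib_left add_mono mult_right_mono)
      ultimately have "m * (norm (a \<tau>, b \<tau>))\<^sup>2 \<le> exp (- (2 * c) * \<tau>) * ((\<mu> + \<kappa>) * (norm (a0, b0))\<^sup>2)" by linarith
      then have "(norm (a \<tau>, b \<tau>))\<^sup>2 \<le> exp (- (2 * c) * \<tau>) * ((\<mu> + \<kappa>) * (norm (a0, b0))\<^sup>2) / m"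
        using m by (simp add: le_divide_eq mult.commute)
      also have "\<dots> = (Q * (norm (a0, b0) * exp (- c * \<tau>)))\<^sup>2"
        by (simp add: power_mult_distrib Q(2) exp_double[symmetric] mult_ac)
      finally show ?thesis by (rule power2_le_imp_le) (use Q in simp)
    qed
    have "norm (a x, b x) < R" if "x \<ge> 0" for x
    proof (rule trapping[OF _ _ _ that, where \<phi>="\<lambda>x. norm (a x, b x)"])
      show "continuous_on {0..} (\<lambda>x. norm (a x, b x))" by (intro continuous_intros ab)
      have QR: "Q * norm (a0, b0) < R" using small Q(1) by (simp add: less_divide_eq mult.commute)
      have "1 * norm (a0, b0) \<le> Q * norm (a0, b0)" using Q(1) by (intro mult_right_mono) auto
      then show "norm (a 0, b 0) < R" using QR by (simp add: ab)
      fix \<tau> :: real assume \<tau>: "\<tau> \<ge> 0" and *: "\<And>x. 0 \<le> x \<Longrightarrow> x \<le> \<tau> \<Longrightarrow> norm (a x, b x) \<le> R"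
      have "norm (a \<tau>, b \<tau>) \<le> Q * (norm (a0, b0) * exp (- c * \<tau>))" using decay[OF \<tau> *] .
      also have "\<dots> \<le> Q * (norm (a0, b0) * 1)" using c \<tau> Q(1) by (intro mult_left_mono) auto
      finally show "norm (a \<tau>, b \<tau>) < R" using QR by simp
    qed
    then have inR: "norm (a x, b x) \<le> R" if "x \<ge> 0" for x using that by (simp add: less_imp_le)
    have half: "a x \<le> 1/2" if "x \<ge> 0" for x
    proof -
      have "R \<le> N * R" using N R(1) by simp
      then show ?thesis using comp(1)[of x] inR[OF that] R(2) by linarith
    qed
    have "orbit \<gamma> \<mu> \<kappa> M a b" unfolding orbit_def
    proof (intro conjI allI impI)
      fix x :: real
      show "x \<ge> 0 \<Longrightarrow> a x < 1" using half[of x] by simp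
    qed (use ab der inR in auto)
    then show ?thesis using ab half decay inR by (intro exI[of _ a] exI[of _ b]) auto
  qed
  moreover have "R / Q > 0" using R Q by simp
  ultimately show ?thesis using c by blast
qed

text \<open>C precedes the quantifier over the boundary data. The rate w receives k, the distance
  \<delta> of the data and x, so one notion serves the exponential and the algebraic
  estimates.\<close>

definition solvable_with_decay ::
  "real \<Rightarrow> real \<Rightarrow> real \<Rightarrow> real \<Rightarrow> (real \<times> real) set \<Rightarrow> (nat \<Rightarrow> real \<Rightarrow> real \<Rightarrow> real) \<Rightarrow> bool" where
  "solvable_with_decay \<gamma> \<mu> \<kappa> M A w \<longleftrightarrow> (\<exists>C. (\<forall>k. C k > 0) \<and> (\<forall>p\<in>A. \<exists>\<rho> u \<theta>.
     unique_stationary_solution \<gamma> \<mu> \<kappa> M (fst p) (snd p) \<rho> u \<theta> \<and>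
     (\<forall>k. \<forall>x>0. norm (perturbation_deriv k \<rho> u \<theta> x) \<le> C k * w k (norm (fst p + 1, snd p - 1)) x)))"

lemma solvable_with_decayE:
  assumes "solvable_with_decay \<gamma> \<mu> \<kappa> M A w"
  obtains C where "\<forall>k. C k > 0"
    "\<And>ub \<theta>b \<delta>. ub < 0 \<and> \<theta>b > 0 \<and> (ub, \<theta>b) \<in> A \<and> \<delta> = norm (ub + 1, \<theta>b - 1) \<Longrightarrow>
      \<exists>\<rho> u \<theta>. unique_stationary_solution \<gamma> \<mu> \<kappa> M ub \<theta>b \<rho> u \<theta> \<and>
        (\<forall>k. \<forall>x>0. norm (perturbation_deriv k \<rho> u \<theta> x) \<le> C k * w k \<delta> x)"
proof -
  obtain C where C: "\<forall>k. C k > 0" "\<forall>p\<in>A. \<exists>\<rho> u \<theta>. unique_stationary_solution \<gamma> \<mu> \<kappa> M (fst p) (snd p) \<rho> u \<theta> \<and>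
     (\<forall>k. \<forall>x>0. norm (perturbation_deriv k \<rho> u \<theta> x) \<le> C k * w k (norm (fst p + 1, snd p - 1)) x)"
    using assms unfolding solvable_with_decay_def by blast
  show thesis
  proof (rule that[OF C(1)], elim conjE, hypsubst)
    fix ub \<theta>b assume "(ub, \<theta>b) \<in> A"
    from bspec[OF C(2) this, unfolded fst_conv snd_conv]
    show "\<exists>\<rho> u \<theta>. unique_stationary_solution \<gamma> \<mu> \<kappa> M ub \<theta>b \<rho> u \<theta> \<and>
      (\<forall>k. \<forall>x>0. norm (perturbation_deriv k \<rho> u \<theta> x) \<le> C k * w k (norm (ub + 1, \<theta>b - 1)) x)" .
  qed
qed

lemma exponential_family:
  assumes par: "\<gamma> > 1" "\<mu> > 0" "\<kappa> > 0" "M > 0" and c: "c > 0"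
    and small: "\<And>p. p \<in> A \<Longrightarrow> norm (fst p + 1, snd p - 1) \<le> 1"
    and ex: "\<And>p. p \<in> A \<Longrightarrow> \<exists>a b. orbit \<gamma> \<mu> \<kappa> M a b \<and> a 0 = fst p + 1 \<and> b 0 = snd p - 1 \<and>
      (\<forall>x\<ge>0. a x \<le> 1/2 \<and> \<bar>a x\<bar> \<le> B * (norm (fst p + 1, snd p - 1) * exp (- c * x)) \<and> \<bar>b x\<bar> \<le> B * (norm (fst p + 1, snd p - 1) * exp (- c * x)))"
  shows "solvable_with_decay \<gamma> \<mu> \<kappa> M A (\<lambda>k \<delta> x. \<delta> * exp (- c * x))"
proof -
  define \<delta> where "\<delta> p = norm (fst p + 1, snd p - 1)" for p :: "real \<times> real"
  obtain a b where ab: "\<And>p. p \<in> A \<Longrightarrow> orbit \<gamma> \<mu> \<kappa> M (a p) (b p)" "\<And>p. p \<in> A \<Longrightarrow> a p 0 = fst p + 1" "\<And>p. p \<in> A \<Longrightarrow> b p 0 = snd p - 1"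
    "\<And>p x. p \<in> A \<Longrightarrow> x \<ge> 0 \<Longrightarrow> a p x \<le> 1/2 \<and> \<bar>a p x\<bar> \<le> B * (\<delta> p * exp (- c * x)) \<and> \<bar>b p x\<bar> \<le> B * (\<delta> p * exp (- c * x))"
    using ex unfolding \<delta>_def by metis
  \<comment> \<open>With Z = 0 every weight of positive order is \<delta> exp (- c x), so
    derivatives of all orders obey the same bound.\<close>
  interpret decay_weights A \<delta> "\<lambda>_ _. 0" c
    by unfold_locales (use small c in \<open>auto simp: \<delta>_def\<close>)
  have W1: "W (Suc k) p x = \<delta> p * exp (- c * x)" for k p x by (simp add: W_def)
  have ab0: "cls 0 1 a" "cls 0 1 b" unfolding cls.simps One_nat_def W1 using ab(4) by (meson less_imp_le)+
  have da: "(a p has_real_derivative 1 / \<mu> * (1 / (M\<^sup>2 * \<gamma>) - 1) * a p x + 1 / (\<mu> * M\<^sup>2 * \<gamma>) * b p x + quad (1 / (\<mu> * M\<^sup>2 * \<gamma>)) 0 (a p x) (a p x + b p x)) (at x)"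
    and db: "(b p has_real_derivative 1 / (\<kappa> * M\<^sup>2 * \<gamma>) * a p x + - c_v \<gamma> / (\<kappa> * M\<^sup>2) * b p x + quad 0 (1 / (2 * \<kappa>)) (a p x) (a p x + b p x)) (at x)"
    if "p \<in> A" "x > 0" for p x
    using ab(1)[OF that(1)] that(2) unfolding orbit_def velocity_rate_def temperature_rate_def by blast+
  have half: "a p x \<le> 1/2" if "p \<in> A" "x > 0" for p x using ab(4)[of p x] that by simp
  have cls: "cls K 1 a" "cls K 1 b" "cls K 1 (\<lambda>p x. a p x / (1 - a p x))" for K
    using exponential_bootstrap[OF refl half da db ab0, of K] by blast+
  obtain C where C: "\<forall>k. C k > 0" "\<forall>p\<in>A. \<exists>\<rho> u \<theta>. unique_stationary_solution \<gamma> \<mu> \<kappa> M (a p 0 - 1) (b p 0 + 1) \<rho> u \<theta> \<and>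
     (\<forall>k. \<forall>x>0. norm (perturbation_deriv k \<rho> u \<theta> x) \<le> C k * W (Suc k) p x)"
    using unique_solutions_with_decay[OF par ab(1) tendsto_const cls] by blast
  show ?thesis using C ab(2,3) unfolding solvable_with_decay_def W1 \<delta>_def by (intro exI[of _ C]) auto
qed

section \<open>Diagonal coordinates\<close>


text \<open>Comparing J P with P diag(l1, l2) identifies l1 l2 and l1 + l2 with determinant and
  trace, whatever the scaling of P. For M < 1 the determinant is negative; for M = 1 it vanishes and
  the trace is negative, so the larger eigenvalue is 0.\<close>

lemma eigen_data:
  assumes par: "\<gamma> > 1" "\<mu> > 0" "\<kappa> > 0" "M > 0" and M: "M \<le> 1" and ev: "eigenvector_matrix \<gamma> \<mu> \<kappa> M P"
  obtains l1 l2 where "0 \<le> l1" "l2 < 0" "M = 1 \<Longrightarrow> l1 = 0"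
    "1 / \<mu> * (1 / (M\<^sup>2 * \<gamma>) - 1) * P$1$1 + 1 / (\<mu> * M\<^sup>2 * \<gamma>) * P$2$1 = l1 * P$1$1"
    "1 / (\<kappa> * M\<^sup>2 * \<gamma>) * P$1$1 + - c_v \<gamma> / (\<kappa> * M\<^sup>2) * P$2$1 = l1 * P$2$1"
    "1 / \<mu> * (1 / (M\<^sup>2 * \<gamma>) - 1) * P$1$2 + 1 / (\<mu> * M\<^sup>2 * \<gamma>) * P$2$2 = l2 * P$1$2"
    "1 / (\<kappa> * M\<^sup>2 * \<gamma>) * P$1$2 + - c_v \<gamma> / (\<kappa> * M\<^sup>2) * P$2$2 = l2 * P$2$2"
proof -
  define j11 where "j11 = 1 / \<mu> * (1 / (M\<^sup>2 * \<gamma>) - 1)"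
  define j12 where "j12 = 1 / (\<mu> * M\<^sup>2 * \<gamma>)"
  define j21 where "j21 = 1 / (\<kappa> * M\<^sup>2 * \<gamma>)"
  define j22 where "j22 = - c_v \<gamma> / (\<kappa> * M\<^sup>2)"
  obtain l1 l2 where l: "l1 \<ge> l2" and e1: "linear_part \<gamma> \<mu> \<kappa> M *v column 1 P = l1 *s column 1 P"
    and e2: "linear_part \<gamma> \<mu> \<kappa> M *v column 2 P = l2 *s column 2 P"
    using ev unfolding eigenvector_matrix_def by blast
  have E: "j11 * P$1$1 + j12 * P$2$1 = l1 * P$1$1" "j21 * P$1$1 + j22 * P$2$1 = l1 * P$2$1"
    "j11 * P$1$2 + j12 * P$2$2 = l2 * P$1$2" "j21 * P$1$2 + j22 * P$2$2 = l2 * P$2$2"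
    using e1 e2 unfolding vec_eq_iff forall_2
    by (simp_all add: linear_part_def matrix_vector_mult_def sum_2 column_def j11_def j12_def j21_def j22_def vector_scalar_mult_def)
  define \<Delta> where "\<Delta> = P$1$1 * P$2$2 - P$1$2 * P$2$1"
  have \<Delta>: "\<Delta> \<noteq> 0" using ev unfolding eigenvector_matrix_def invertible_det_nz det_2 \<Delta>_def by auto
  have "(j11 * j22 - j12 * j21) * \<Delta> = (j11 * P$1$1 + j12 * P$2$1) * (j21 * P$1$2 + j22 * P$2$2) - (j11 * P$1$2 + j12 * P$2$2) * (j21 * P$1$1 + j22 * P$2$1)"
    by (simp add: \<Delta>_def algebra_simps)
  also have "\<dots> = (l1 * l2) * \<Delta>" unfolding E by (simp add: \<Delta>_def algebra_simps)
  finally have det: "j11 * j22 - j12 * j21 = l1 * l2" using \<Delta> by simp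
  have "(j11 + j22) * \<Delta> = (j11 * P$1$1 + j12 * P$2$1) * P$2$2 - (j21 * P$1$1 + j22 * P$2$1) * P$1$2
     + (j21 * P$1$2 + j22 * P$2$2) * P$1$1 - (j11 * P$1$2 + j12 * P$2$2) * P$2$1"
    by (simp add: \<Delta>_def algebra_simps)
  also have "\<dots> = (l1 + l2) * \<Delta>" unfolding E by (simp add: \<Delta>_def algebra_simps)
  finally have tr: "j11 + j22 = l1 + l2" using \<Delta> by simp
  define v where "v = c_v \<gamma> / M\<^sup>2"
  have v: "v > 0" using par by (simp add: v_def c_v_def)
  have "j11 * j22 - j12 * j21 = ((1 - 1 / (M\<^sup>2 * \<gamma>)) * (c_v \<gamma> / M\<^sup>2) - (1 / (M\<^sup>2 * \<gamma>))\<^sup>2) / (\<mu> * \<kappa>)"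
    unfolding j11_def j12_def j21_def j22_def using par by (simp add: field_simps power2_eq_square)
  also have "\<dots> = v * (1 - 1 / M\<^sup>2) / (\<mu> * \<kappa>)" using sound_discriminant[of \<gamma> M] par by (simp add: v_def)
  finally have det': "l1 * l2 = v * (1 - 1 / M\<^sup>2) / (\<mu> * \<kappa>)" using det by simp
  have signs: "0 \<le> l1 \<and> l2 < 0 \<and> (M = 1 \<longrightarrow> l1 = 0)"
  proof (cases "M = 1")
    case True
    have "1 / \<gamma> < 1" using par by simp
    then have "j11 < 0" unfolding j11_def using True par by (simp add: mult_pos_neg divide_neg_pos)
    moreover have "j22 < 0" using v par True by (simp add: j22_def v_def divide_neg_pos)
    ultimately have "l1 + l2 < 0" using tr by linarith
    moreover have "l1 = 0 \<or> l2 = 0" using det' True by simp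
    ultimately show ?thesis using l by auto
  next
    case False
    then have "M\<^sup>2 < 1" using M par by (simp add: power_less_one_iff)
    then have "1 - 1 / M\<^sup>2 < 0" using par by simp
    then have "l1 * l2 < 0" unfolding det' using v par by (intro divide_neg_pos mult_pos_neg) auto
    then show ?thesis using l False by (auto simp: mult_less_0_iff)
  qed
  show thesis using that[of l1 l2] signs E unfolding j11_def j12_def j21_def j22_def by blast
qed

lemma matrix_inv_inverse:
  assumes "invertible P"
  shows "P ** matrix_inv P = mat 1 \<and> matrix_inv P ** P = mat 1"
  using assms unfolding invertible_def matrix_inv_def by (rule someI_ex)

lemma inverse_entries:
  fixes P :: "real^2^2"
  assumes "invertible P"
  shows "P$1$1 * matrix_inv P$1$1 + P$1$2 * matrix_inv P$2$1 = 1" "P$1$1 * matrix_inv P$1$2 + P$1$2 * matrix_inv P$2$2 = 0"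
    "P$2$1 * matrix_inv P$1$1 + P$2$2 * matrix_inv P$2$1 = 0" "P$2$1 * matrix_inv P$1$2 + P$2$2 * matrix_inv P$2$2 = 1"
proof -
  have "P ** matrix_inv P = mat 1" using matrix_inv_inverse[OF assms] by simp
  then show "P$1$1 * matrix_inv P$1$1 + P$1$2 * matrix_inv P$2$1 = 1" "P$1$1 * matrix_inv P$1$2 + P$1$2 * matrix_inv P$2$2 = 0"
    "P$2$1 * matrix_inv P$1$1 + P$2$2 * matrix_inv P$2$1 = 0" "P$2$1 * matrix_inv P$1$2 + P$2$2 * matrix_inv P$2$2 = 1"
    by (auto simp: vec_eq_iff forall_2 matrix_matrix_mult_def sum_2 mat_def)
qed

lemma quad_split: "quad (A / C) (B / D) x s = A * quad (1 / C) 0 x s + B * quad 0 (1 / D) x s"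
  by (simp add: quad_def)

text \<open>The stationary system in the coordinates \<open>(U, \<Theta>)\<close> of the eigenvectors.\<close>

locale diagonal_system = planar_field l1 l2 "P$1$1" "P$1$2" "P$1$1 + P$2$1" "P$1$2 + P$2$2"
    "matrix_inv P$1$1 / (\<mu> * M\<^sup>2 * \<gamma>)" "matrix_inv P$1$2 / (2 * \<kappa>)" "matrix_inv P$2$1 / (\<mu> * M\<^sup>2 * \<gamma>)" "matrix_inv P$2$2 / (2 * \<kappa>)"
    for l1 l2 \<gamma> \<mu> \<kappa> M :: real and P :: "real^2^2" +
  assumes par: "\<gamma> > 1" "\<mu> > 0" "\<kappa> > 0" "M > 0"
    and inv: "invertible P"
    and eig: "1 / \<mu> * (1 / (M\<^sup>2 * \<gamma>) - 1) * P$1$1 + 1 / (\<mu> * M\<^sup>2 * \<gamma>) * P$2$1 = l1 * P$1$1"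
    "1 / (\<kappa> * M\<^sup>2 * \<gamma>) * P$1$1 + - c_v \<gamma> / (\<kappa> * M\<^sup>2) * P$2$1 = l1 * P$2$1"
    "1 / \<mu> * (1 / (M\<^sup>2 * \<gamma>) - 1) * P$1$2 + 1 / (\<mu> * M\<^sup>2 * \<gamma>) * P$2$2 = l2 * P$1$2"
    "1 / (\<kappa> * M\<^sup>2 * \<gamma>) * P$1$2 + - c_v \<gamma> / (\<kappa> * M\<^sup>2) * P$2$2 = l2 * P$2$2"
begin

abbreviation "ubar U T \<equiv> P$1$1 * U + P$1$2 * T"
abbreviation "tbar U T \<equiv> P$2$1 * U + P$2$2 * T"

lemma s_eq: "(P$1$1 + P$2$1) * U + (P$1$2 + P$2$2) * T = ubar U T + tbar U T"
  by (simp add: algebra_simps)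

text \<open>The coefficients chosen for the locale are the inverse of P applied to the nonlinear
  part. Multiplying by P undoes this, and the eigenvector equations do the same for the linear
  part.\<close>

lemma rates:
  "velocity_rate \<gamma> \<mu> M (ubar U T) (tbar U T) = P$1$1 * (l1 * U + F1 U T) + P$1$2 * (l2 * T + F2 U T)"
  "temperature_rate \<gamma> \<kappa> M (ubar U T) (tbar U T) = P$2$1 * (l1 * U + F1 U T) + P$2$2 * (l2 * T + F2 U T)"
proof -
  note i = inverse_entries[OF inv]
  define X where "X = quad (1 / (\<mu> * M\<^sup>2 * \<gamma>)) 0 (ubar U T) (ubar U T + tbar U T)"
  define Y where "Y = quad 0 (1 / (2 * \<kappa>)) (ubar U T) (ubar U T + tbar U T)"
  have F: "F1 U T = matrix_inv P$1$1 * X + matrix_inv P$1$2 * Y" "F2 U T = matrix_inv P$2$1 * X + matrix_inv P$2$2 * Y"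
    unfolding F1_def F2_def s_eq X_def Y_def by (rule quad_split)+
  have "P$1$1 * (l1 * U + F1 U T) + P$1$2 * (l2 * T + F2 U T)
    = (l1 * P$1$1) * U + (l2 * P$1$2) * T + (P$1$1 * matrix_inv P$1$1 + P$1$2 * matrix_inv P$2$1) * X
      + (P$1$1 * matrix_inv P$1$2 + P$1$2 * matrix_inv P$2$2) * Y"
    unfolding F by (simp add: algebra_simps)
  also have "\<dots> = velocity_rate \<gamma> \<mu> M (ubar U T) (tbar U T)"
    unfolding i eig(1,3)[symmetric] velocity_rate_def X_def[symmetric] by (simp add: algebra_simps)
  finally show "velocity_rate \<gamma> \<mu> M (ubar U T) (tbar U T) = P$1$1 * (l1 * U + F1 U T) + P$1$2 * (l2 * T + F2 U T)" by simp
  have "P$2$1 * (l1 * U + F1 U T) + P$2$2 * (l2 * T + F2 U T)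
    = (l1 * P$2$1) * U + (l2 * P$2$2) * T + (P$2$1 * matrix_inv P$1$1 + P$2$2 * matrix_inv P$2$1) * X
      + (P$2$1 * matrix_inv P$1$2 + P$2$2 * matrix_inv P$2$2) * Y"
    unfolding F by (simp add: algebra_simps)
  also have "\<dots> = temperature_rate \<gamma> \<kappa> M (ubar U T) (tbar U T)"
    unfolding i eig(2,4)[symmetric] temperature_rate_def Y_def[symmetric] by (simp add: algebra_simps)
  finally show "temperature_rate \<gamma> \<kappa> M (ubar U T) (tbar U T) = P$2$1 * (l1 * U + F1 U T) + P$2$2 * (l2 * T + F2 U T)" by simp
qed

lemma flow_rates:
  assumes "flow l1 0 0 l2 U T x"
  shows "((\<lambda>x. ubar (U x) (T x)) has_real_derivative velocity_rate \<gamma> \<mu> M (ubar (U x) (T x)) (tbar (U x) (T x))) (at x within {0..})"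
    "((\<lambda>x. tbar (U x) (T x)) has_real_derivative temperature_rate \<gamma> \<kappa> M (ubar (U x) (T x)) (tbar (U x) (T x))) (at x within {0..})"
proof -
  have f: "(U has_real_derivative l1 * U x + F1 (U x) (T x)) (at x within {0..})"
    "(T has_real_derivative l2 * T x + F2 (U x) (T x)) (at x within {0..})"
    using assms by (simp_all add: flow_def)
  show "((\<lambda>x. ubar (U x) (T x)) has_real_derivative velocity_rate \<gamma> \<mu> M (ubar (U x) (T x)) (tbar (U x) (T x))) (at x within {0..})"
    "((\<lambda>x. tbar (U x) (T x)) has_real_derivative temperature_rate \<gamma> \<kappa> M (ubar (U x) (T x)) (tbar (U x) (T x))) (at x within {0..})"
    unfolding rates by (intro DERIV_add DERIV_cmult f)+
qed

lemma orbit_of_flow: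
  assumes "continuous_on {0..} U" "continuous_on {0..} T" "\<And>x. x \<ge> 0 \<Longrightarrow> flow l1 0 0 l2 U T x"
    and "\<And>x. x \<ge> 0 \<Longrightarrow> ubar (U x) (T x) < 1"
  shows "orbit \<gamma> \<mu> \<kappa> M (\<lambda>x. ubar (U x) (T x)) (\<lambda>x. tbar (U x) (T x))"
  unfolding orbit_def
proof (intro conjI allI impI)
  fix x :: real assume x: "x > 0"
  have "at x within {0..} = at x" using x by (intro at_within_interior) auto
  then show "((\<lambda>x. ubar (U x) (T x)) has_real_derivative velocity_rate \<gamma> \<mu> M (ubar (U x) (T x)) (tbar (U x) (T x))) (at x)"
    "((\<lambda>x. tbar (U x) (T x)) has_real_derivative temperature_rate \<gamma> \<kappa> M (ubar (U x) (T x)) (tbar (U x) (T x))) (at x)"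
    using flow_rates[OF assms(3)[of x]] x by auto
qed (use assms in \<open>auto intro!: continuous_intros\<close>)

lemma tbar_le:
  assumes "\<bar>U\<bar> \<le> e" "\<bar>T\<bar> \<le> e"
  shows "\<bar>tbar U T\<bar> \<le> 2 * N * e"
  using coords_le[OF assms] unfolding s_eq by linarith

lemma hat_eq:
  "U_hat P u \<theta> = matrix_inv P$1$1 * (u + 1) + matrix_inv P$1$2 * (\<theta> - 1)"
  "\<Theta>_hat P u \<theta> = matrix_inv P$2$1 * (u + 1) + matrix_inv P$2$2 * (\<theta> - 1)"
  by (simp_all add: U_hat_def \<Theta>_hat_def matrix_vector_mult_def sum_2)

lemma hat_inverse:
  "ubar (U_hat P u \<theta>) (\<Theta>_hat P u \<theta>) = u + 1" "tbar (U_hat P u \<theta>) (\<Theta>_hat P u \<theta>) = \<theta> - 1"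
proof -
  note i = inverse_entries[OF inv]
  have "ubar (U_hat P u \<theta>) (\<Theta>_hat P u \<theta>) = (P$1$1 * matrix_inv P$1$1 + P$1$2 * matrix_inv P$2$1) * (u + 1)
     + (P$1$1 * matrix_inv P$1$2 + P$1$2 * matrix_inv P$2$2) * (\<theta> - 1)"
    unfolding hat_eq by (simp add: algebra_simps)
  then show "ubar (U_hat P u \<theta>) (\<Theta>_hat P u \<theta>) = u + 1" unfolding i by simp
  have "tbar (U_hat P u \<theta>) (\<Theta>_hat P u \<theta>) = (P$2$1 * matrix_inv P$1$1 + P$2$2 * matrix_inv P$2$1) * (u + 1)
     + (P$2$1 * matrix_inv P$1$2 + P$2$2 * matrix_inv P$2$2) * (\<theta> - 1)"
    unfolding hat_eq by (simp add: algebra_simps)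
  then show "tbar (U_hat P u \<theta>) (\<Theta>_hat P u \<theta>) = \<theta> - 1" unfolding i by simp
qed

definition Q :: real where
  "Q = \<bar>matrix_inv P$1$1\<bar> + \<bar>matrix_inv P$1$2\<bar> + \<bar>matrix_inv P$2$1\<bar> + \<bar>matrix_inv P$2$2\<bar> + 1"

lemma Q: "Q \<ge> 1" by (simp add: Q_def)

lemma hat_le: "\<bar>U_hat P u \<theta>\<bar> + \<bar>\<Theta>_hat P u \<theta>\<bar> \<le> Q * norm (u + 1, \<theta> - 1)"
proof -
  have n: "\<bar>u + 1\<bar> \<le> norm (u + 1, \<theta> - 1)" "\<bar>\<theta> - 1\<bar> \<le> norm (u + 1, \<theta> - 1)"
    using norm_fst_le[of "u + 1" "\<theta> - 1"] norm_snd_le[of "\<theta> - 1" "u + 1"] by auto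
  have "\<bar>U_hat P u \<theta>\<bar> \<le> (\<bar>matrix_inv P$1$1\<bar> + \<bar>matrix_inv P$1$2\<bar>) * norm (u + 1, \<theta> - 1)"
    "\<bar>\<Theta>_hat P u \<theta>\<bar> \<le> (\<bar>matrix_inv P$2$1\<bar> + \<bar>matrix_inv P$2$2\<bar>) * norm (u + 1, \<theta> - 1)"
    unfolding hat_eq by (rule abs_lin_le[OF n])+
  then show ?thesis unfolding Q_def distrib_right using norm_ge_zero[of "(u + 1, \<theta> - 1)"] by linarith
qed

text \<open>The orbit required through each point is the image under P of (h T, T) with T from
  \<open>graph_orbit\<close>. Tangency at 0 is h' 0 = 0, from \<bar>h' t\<bar> \<le> C
  \<bar>t\<bar>.\<close>

lemma local_stable_manifold_graph:
  assumes ig: "invariant_graph r C h h'"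
  shows "local_stable_manifold \<gamma> \<mu> \<kappa> M P r h"
proof -
  have ig': "0 < r" "N * r \<le> 1/2" "continuous_on {-r<..<r} h'" "\<And>t. \<bar>t\<bar> < r \<Longrightarrow> (h has_real_derivative h' t) (at t)"
    "\<And>t. \<bar>t\<bar> < r \<Longrightarrow> \<bar>h' t\<bar> \<le> C * \<bar>t\<bar>"
    using ig by (auto simp: invariant_graph_def)
  note hle = invariant_graph_abs_le[OF ig]
  have h0: "h 0 = 0" "h' 0 = 0" using hle[of 0] ig'(5)[of 0] ig'(1) by auto
  have "h C1_differentiable_on {-r<..<r}"
    unfolding C1_differentiable_on_def
  proof (intro exI[of _ h'] conjI ballI)
    fix t assume "t \<in> {-r<..<r}"
    then show "(h has_vector_derivative h' t) (at t)"
      using ig'(4)[of t] by (simp add: has_real_derivative_iff_has_vector_derivative abs_less_iff)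
  qed (rule ig'(3))
  moreover have "(h has_real_derivative 0) (at 0)" using ig'(4)[of 0] ig'(1) h0 by simp
  moreover have "\<exists>w :: real \<Rightarrow> real^2.
        w 0 = P *v vector [h s, s] \<and>
        (\<forall>x\<ge>0. w x $ 1 < 1 \<and>
           (w has_vector_derivative
              linear_part \<gamma> \<mu> \<kappa> M *v w x + nonlinear_part \<gamma> \<mu> \<kappa> M (w x)) (at x within {0..}) \<and>
           \<bar>(matrix_inv P *v w x) $ 2\<bar> < r \<and>
           (matrix_inv P *v w x) $ 1 = h ((matrix_inv P *v w x) $ 2)) \<and>
        (w \<longlongrightarrow> 0) at_top" if s: "s \<in> {-r<..<r}" for s
  proof -
    have sr: "\<bar>s\<bar> < r" using s by auto
    obtain T where T: "T 0 = s" "continuous_on {0..} T" "\<And>x. x \<ge> 0 \<Longrightarrow> \<bar>T x\<bar> \<le> \<bar>s\<bar> * exp (l2 / 2 * x)"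
      and fl: "\<And>x. x \<ge> 0 \<Longrightarrow> flow l1 0 0 l2 (\<lambda>x. h (T x)) T x"
      using graph_orbit[OF ig sr] by blast
    have Ts: "\<bar>T x\<bar> \<le> \<bar>s\<bar>" if "x \<ge> 0" for x
    proof -
      have "\<bar>s\<bar> * exp (l2 / 2 * x) \<le> \<bar>s\<bar> * 1" using that l2 by (intro mult_left_mono) (auto simp: mult_nonpos_nonneg)
      then show ?thesis using T(3)[OF that] by simp
    qed
    have Tr: "\<bar>T x\<bar> < r" if "x \<ge> 0" for x using Ts[OF that] sr by simp
    define w :: "real \<Rightarrow> real^2" where "w x = P *v vector [h (T x), T x]" for x
    have w12: "w x $ 1 = ubar (h (T x)) (T x)" "w x $ 2 = tbar (h (T x)) (T x)" for x
      by (simp_all add: w_def matrix_vector_mult_def sum_2)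
    have coords: "matrix_inv P *v w x = vector [h (T x), T x]" for x
      unfolding w_def matrix_vector_mul_assoc matrix_inv_inverse[OF inv, THEN conjunct2] by simp
    have T0: "(T \<longlongrightarrow> 0) at_top"
    proof (rule Lim_null_comparison)
      show "\<forall>\<^sub>F x in at_top. norm (T x) \<le> \<bar>s\<bar> * exp (l2 / 2 * x)"
        using T(3) by (intro eventually_mono[OF eventually_ge_at_top[of 0]]) simp
      have "filterlim (\<lambda>x. (- l2 / 2) * x) at_top at_top"
        using l2 by (intro filterlim_tendsto_pos_mult_at_top[OF tendsto_const _ filterlim_ident]) simp
      then have "filterlim (\<lambda>x. l2 / 2 * x) at_bot at_top"
        by (simp add: filterlim_uminus_at_top)
      then have "((\<lambda>x. exp (l2 / 2 * x)) \<longlongrightarrow> 0) at_top" by (rule filterlim_compose[OF exp_at_bot])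
      then have "((\<lambda>x. \<bar>s\<bar> * exp (l2 / 2 * x)) \<longlongrightarrow> \<bar>s\<bar> * 0) at_top" by (intro tendsto_intros)
      then show "((\<lambda>x. \<bar>s\<bar> * exp (l2 / 2 * x)) \<longlongrightarrow> 0) at_top" by simp
    qed
    have H0: "((\<lambda>x. h (T x)) \<longlongrightarrow> 0) at_top"
    proof (rule Lim_null_comparison)
      show "\<forall>\<^sub>F x in at_top. norm (h (T x)) \<le> \<bar>T x\<bar>"
        using hle[OF Tr] by (intro eventually_mono[OF eventually_ge_at_top[of 0]]) simp
      show "((\<lambda>x. \<bar>T x\<bar>) \<longlongrightarrow> 0) at_top" using T0 by (rule tendsto_rabs_zero)
    qed
    have lim: "(w \<longlongrightarrow> 0) at_top"
    proof (rule vec_tendstoI)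
      fix i :: "2"
      have "((\<lambda>x. ubar (h (T x)) (T x)) \<longlongrightarrow> ubar 0 0) at_top" "((\<lambda>x. tbar (h (T x)) (T x)) \<longlongrightarrow> tbar 0 0) at_top"
        by (intro tendsto_intros H0 T0)+
      then show "((\<lambda>x. w x $ i) \<longlongrightarrow> 0 $ i) at_top" using exhaust_2[of i] by (auto simp: w12)
    qed
    have small: "w x $ 1 < 1" if "x \<ge> 0" for x
    proof -
      have "\<bar>ubar (h (T x)) (T x)\<bar> \<le> N * r"
        using hle[OF Tr[OF that]] Tr[OF that] by (intro coords_le) auto
      then show ?thesis using ig'(2) by (simp add: w12)
    qed
    have der: "(w has_vector_derivative linear_part \<gamma> \<mu> \<kappa> M *v w x + nonlinear_part \<gamma> \<mu> \<kappa> M (w x)) (at x within {0..})" if x: "x \<ge> 0" for x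
    proof -
      have nz: "w x $ 1 \<noteq> 1" using small[OF x] by simp
      have c1: "(linear_part \<gamma> \<mu> \<kappa> M *v w x + nonlinear_part \<gamma> \<mu> \<kappa> M (w x)) $ 1 = velocity_rate \<gamma> \<mu> M (w x $ 1) (w x $ 2)"
        using par nz by (simp add: linear_part_def nonlinear_part_def matrix_vector_mult_def sum_2 velocity_rate_def quad_def divide_simps)
          (simp add: algebra_simps)
      have c2: "(linear_part \<gamma> \<mu> \<kappa> M *v w x + nonlinear_part \<gamma> \<mu> \<kappa> M (w x)) $ 2 = temperature_rate \<gamma> \<kappa> M (w x $ 1) (w x $ 2)"
        by (simp add: linear_part_def nonlinear_part_def matrix_vector_mult_def sum_2 temperature_rate_def quad_def)
      define U' where "U' = l1 * h (T x) + F1 (h (T x)) (T x)"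
      define T' where "T' = l2 * T x + F2 (h (T x)) (T x)"
      have "((\<lambda>x. h (T x)) has_real_derivative U') (at x within {0..})" "(T has_real_derivative T') (at x within {0..})"
        using fl[OF x] by (simp_all add: flow_def U'_def T'_def)
      then have "((\<lambda>x. h (T x) *\<^sub>R column 1 P + T x *\<^sub>R column 2 P) has_vector_derivative U' *\<^sub>R column 1 P + T' *\<^sub>R column 2 P) (at x within {0..})"
        unfolding has_real_derivative_iff_has_vector_derivative
        by (auto intro!: has_vector_derivative_add bounded_linear.has_vector_derivative[OF bounded_linear_scaleR_left])
      moreover have "(\<lambda>x. h (T x) *\<^sub>R column 1 P + T x *\<^sub>R column 2 P) = w"
        by (simp add: fun_eq_iff vec_eq_iff forall_2 w12 column_def mult.commute)
      moreover have "U' *\<^sub>R column 1 P + T' *\<^sub>R column 2 P = linear_part \<gamma> \<mu> \<kappa> M *v w x + nonlinear_part \<gamma> \<mu> \<kappa> M (w x)"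
        unfolding vec_eq_iff forall_2 c1 c2
        unfolding w12 rates by (simp add: column_def U'_def T'_def mult.commute)
      ultimately show ?thesis by simp
    qed
    show ?thesis
      using small der lim Tr by (intro exI[of _ w]) (auto simp: coords w_def[of 0] T)
  qed
  ultimately show ?thesis unfolding local_stable_manifold_def using ig'(1) h0 by blast
qed

text \<open>Membership in \<open>M_minus\<close> says that the initial point lies on the graph; Q e
  \<le> r puts it in the domain of h, and the decay of T carries over to all unknowns.\<close>

lemma stable_family:
  assumes ig: "invariant_graph r C h h'" and e: "0 < e" "e \<le> 1" "Q * e \<le> r"
  shows "\<exists>c>0. solvable_with_decay \<gamma> \<mu> \<kappa> M (M_minus P h e) (\<lambda>k \<delta> x. \<delta> * exp (- c * x))"
proof -
  have ig': "0 < r" "N * r \<le> 1/2" using ig by (auto simp: invariant_graph_def)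
  note hle = invariant_graph_abs_le[OF ig]
  have "- l2 / 2 > 0" using l2 by simp
  moreover have "solvable_with_decay \<gamma> \<mu> \<kappa> M (M_minus P h e) (\<lambda>k \<delta> x. \<delta> * exp (- (- l2 / 2) * x))"
  proof (rule exponential_family[OF par \<open>- l2 / 2 > 0\<close>, where B="2 * N * Q"])
    fix p assume "p \<in> M_minus P h e"
    then obtain u \<theta> where p: "p = (u, \<theta>)" and d: "norm (u + 1, \<theta> - 1) < e" and on: "U_hat P u \<theta> = h (\<Theta>_hat P u \<theta>)"
      by (auto simp: M_minus_def M_plus_def)
    show "norm (fst p + 1, snd p - 1) \<le> 1" using d e p by simp
    define s where "s = \<Theta>_hat P u \<theta>"
    have sQ: "\<bar>s\<bar> \<le> Q * norm (u + 1, \<theta> - 1)" using hat_le[of u \<theta>] by (simp add: s_def)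
    also have "\<dots> < Q * e" using d Q by (intro mult_strict_left_mono) auto
    finally have sr: "\<bar>s\<bar> < r" using e by simp
    obtain T where T: "T 0 = s" "continuous_on {0..} T" "\<And>x. x \<ge> 0 \<Longrightarrow> \<bar>T x\<bar> \<le> \<bar>s\<bar> * exp (l2 / 2 * x)"
      and fl: "\<And>x. x \<ge> 0 \<Longrightarrow> flow l1 0 0 l2 (\<lambda>x. h (T x)) T x"
      using graph_orbit[OF ig sr] by blast
    have Tr: "\<bar>T x\<bar> < r" if "x \<ge> 0" for x
    proof -
      have "\<bar>s\<bar> * exp (l2 / 2 * x) \<le> \<bar>s\<bar> * 1" using that l2 by (intro mult_left_mono) (auto simp: mult_nonpos_nonneg)
      then show ?thesis using T(3)[OF that] sr by simp
    qed
    have hc: "continuous_on {0..} (\<lambda>x. h (T x))"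
      using fl unfolding flow_def continuous_on_eq_continuous_within
      by (auto intro: DERIV_continuous)
    define a where "a x = ubar (h (T x)) (T x)" for x
    define b where "b x = tbar (h (T x)) (T x)" for x
    have bd: "\<bar>a x\<bar> \<le> N * \<bar>T x\<bar>" "\<bar>b x\<bar> \<le> 2 * N * \<bar>T x\<bar>" "a x \<le> 1/2" if x: "x \<ge> 0" for x
    proof -
      show 1: "\<bar>a x\<bar> \<le> N * \<bar>T x\<bar>" unfolding a_def using hle[OF Tr[OF x]] by (intro coords_le) auto
      show "\<bar>b x\<bar> \<le> 2 * N * \<bar>T x\<bar>" unfolding b_def using hle[OF Tr[OF x]] by (intro tbar_le) auto
      have "N * \<bar>T x\<bar> \<le> N * r" using Tr[OF x] N by (intro mult_left_mono) auto
      then show "a x \<le> 1/2" using 1 ig'(2) by linarith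
    qed
    have "orbit \<gamma> \<mu> \<kappa> M a b" unfolding a_def b_def
      by (rule orbit_of_flow[OF hc T(2) fl]) (use bd(3) in \<open>force simp: a_def\<close>)+
    moreover have "a 0 = fst p + 1" "b 0 = snd p - 1"
      using hat_inverse[of u \<theta>] on by (simp_all add: a_def b_def T(1) p s_def)
    moreover have "a x \<le> 1/2 \<and> \<bar>a x\<bar> \<le> 2 * N * Q * (norm (fst p + 1, snd p - 1) * exp (- (- l2 / 2) * x)) \<and>
      \<bar>b x\<bar> \<le> 2 * N * Q * (norm (fst p + 1, snd p - 1) * exp (- (- l2 / 2) * x))" if x: "x \<ge> 0" for x
    proof -
      have "\<bar>T x\<bar> \<le> (Q * norm (u + 1, \<theta> - 1)) * exp (l2 / 2 * x)"
        by (rule order_trans[OF T(3)[OF x] mult_right_mono[OF sQ]]) simp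
      then have "2 * N * \<bar>T x\<bar> \<le> 2 * N * ((Q * norm (u + 1, \<theta> - 1)) * exp (l2 / 2 * x))"
        using N by (intro mult_left_mono) auto
      moreover have "N * \<bar>T x\<bar> \<le> 2 * N * \<bar>T x\<bar>" using N by simp
      ultimately show ?thesis using bd[OF x] by (simp add: p mult_ac)
    qed
    ultimately show "\<exists>a b. orbit \<gamma> \<mu> \<kappa> M a b \<and> a 0 = fst p + 1 \<and> b 0 = snd p - 1 \<and>
      (\<forall>x\<ge>0. a x \<le> 1/2 \<and> \<bar>a x\<bar> \<le> 2 * N * Q * (norm (fst p + 1, snd p - 1) * exp (- (- l2 / 2) * x)) \<and>
        \<bar>b x\<bar> \<le> 2 * N * Q * (norm (fst p + 1, snd p - 1) * exp (- (- l2 / 2) * x)))" by blast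
  qed
  ultimately show ?thesis by blast
qed

text \<open>The inequality defining \<open>M_zero\<close> is V \<ge> 0 at x = 0, and
  \<open>neg\<close> is the coefficient of U^2 in U'. All radii up to e0 are covered, because the
  final radius must also respect the domain of the graph.\<close>

lemma transonic_family:
  assumes ig: "invariant_graph r C h h'" and l10: "l1 = 0"
    and neg: "matrix_inv P$1$1 / (\<mu> * M\<^sup>2 * \<gamma>) * P$1$1 * (P$1$1 + P$2$1) + matrix_inv P$1$2 / (2 * \<kappa>) * (P$1$1)\<^sup>2 < 0"
  shows "\<exists>e0>0. \<forall>e. 0 < e \<longrightarrow> e \<le> e0 \<longrightarrow> (\<exists>c>0. solvable_with_decay \<gamma> \<mu> \<kappa> M (M_zero P h e)
      (\<lambda>k \<delta> x. (\<delta> / (1 + \<delta> * x)) ^ Suc k + \<delta> * exp (- c * x)))"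
proof -
  obtain e1 C1 where e1: "e1 > 0" and C1: "\<And>U0 T0. \<bar>U0\<bar> + \<bar>T0\<bar> < e1 \<Longrightarrow> h T0 \<le> U0 \<Longrightarrow>
    (\<exists>U T. U 0 = U0 \<and> T 0 = T0 \<and> continuous_on {0..} U \<and> continuous_on {0..} T \<and>
      (\<forall>x\<ge>0. flow 0 0 0 l2 U T x \<and> \<bar>U x\<bar> + \<bar>T x\<bar> \<le> C1 * ((\<bar>U0\<bar> + \<bar>T0\<bar>) / (1 + (\<bar>U0\<bar> + \<bar>T0\<bar>) * x))))"
    using center_stable_orbit[OF ig l10 neg] by blast
  define B where "B = \<bar>C1\<bar> * Q"
  have B: "B \<ge> 0" using Q by (simp add: B_def)
  \<comment> \<open>The entries ensure \<delta> \<le> 1, initial values below e1, and \<bar>a\<bar>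
    \<le> 1/2 along the orbits.\<close>
  define e0 where "e0 = Min {1, e1 / Q, 1 / (2 * N * (B + 1))}"
  have pos: "e1 / Q > 0" "1 / (2 * N * (B + 1)) > 0" using e1 Q N B by auto
  have e0: "e0 > 0" using pos by (simp add: e0_def)
  have e0le: "e0 \<le> 1" "e0 \<le> e1 / Q" "e0 \<le> 1 / (2 * N * (B + 1))" unfolding e0_def by (rule Min_le; simp)+
  have "\<exists>c>0. solvable_with_decay \<gamma> \<mu> \<kappa> M (M_zero P h e)
      (\<lambda>k \<delta> x. (\<delta> / (1 + \<delta> * x)) ^ Suc k + \<delta> * exp (- c * x))"
    if e: "0 < e" "e \<le> e0" for e
  proof -
    define A where "A = M_zero P h e"
    define \<delta> where "\<delta> p = norm (fst p + 1, snd p - 1)" for p :: "real \<times> real"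
    \<comment> \<open>\<open>algebraic_bootstrap\<close> asks that 4 c not exceed the damping rate
      of T.\<close>
    define c where "c = - l2 / 4"
    have c: "c > 0" using l2 by (simp add: c_def)
    have A\<delta>: "\<delta> p < e0" "U_hat P (fst p) (snd p) \<ge> h (\<Theta>_hat P (fst p) (snd p))" if "p \<in> A" for p
      using that e by (auto simp: A_def M_zero_def M_plus_def \<delta>_def)
    have \<delta>0: "\<delta> p \<ge> 0" for p by (simp add: \<delta>_def)
    have den: "1 + \<delta> p * x \<ge> 1" if "x \<ge> 0" for p x using \<delta>0[of p] that by simp
    have Zle: "\<delta> p / (1 + \<delta> p * x) \<le> \<delta> p" if "x \<ge> 0" for p x
      using frac_le[OF \<delta>0[of p] order_refl zero_less_one den[OF that, of p]] by simp
    define R where "R p U T \<longleftrightarrow> U 0 = U_hat P (fst p) (snd p) \<and> T 0 = \<Theta>_hat P (fst p) (snd p) \<and> continuous_on {0..} U \<and> continuous_on {0..} T \<and>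
      (\<forall>x\<ge>0. flow 0 0 0 l2 U T x \<and> \<bar>U x\<bar> + \<bar>T x\<bar> \<le> B * (\<delta> p / (1 + \<delta> p * x)))" for p U T
    have "\<exists>U T. R p U T" if p: "p \<in> A" for p
    proof -
      define d0 where "d0 = \<bar>U_hat P (fst p) (snd p)\<bar> + \<bar>\<Theta>_hat P (fst p) (snd p)\<bar>"
      have d0: "0 \<le> d0" "d0 \<le> Q * \<delta> p" using hat_le[of "fst p" "snd p"] by (auto simp: d0_def \<delta>_def)
      have "Q * \<delta> p < Q * e0" using A\<delta>(1)[OF p] Q by (intro mult_strict_left_mono) auto
      also have "\<dots> \<le> e1" using e0le(2) Q by (simp add: le_divide_eq mult.commute)
      finally have "d0 < e1" using d0 by simp
      then obtain U T where UT: "U 0 = U_hat P (fst p) (snd p)" "T 0 = \<Theta>_hat P (fst p) (snd p)" "continuous_on {0..} U" "continuous_on {0..} T"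
        "\<And>x. x \<ge> 0 \<Longrightarrow> flow 0 0 0 l2 U T x" "\<And>x. x \<ge> 0 \<Longrightarrow> \<bar>U x\<bar> + \<bar>T x\<bar> \<le> C1 * (d0 / (1 + d0 * x))"
        using C1[of "U_hat P (fst p) (snd p)" "\<Theta>_hat P (fst p) (snd p)"] A\<delta>(2)[OF p] unfolding d0_def by blast
      have "C1 * (d0 / (1 + d0 * x)) \<le> B * (\<delta> p / (1 + \<delta> p * x))" if x: "x \<ge> 0" for x
      proof -
        \<comment> \<open>t / (1 + t x) increases with t, and Q \<ge> 1 may be dropped from the
          denominator.\<close>
        have "d0 / (1 + d0 * x) \<le> Q * \<delta> p / (1 + \<delta> p * x)"
        proof -
          have "1 * (d0 * (\<delta> p * x)) \<le> Q * (d0 * (\<delta> p * x))" using Q d0 \<delta>0[of p] x by (intro mult_right_mono) auto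
          then have "d0 * (1 + \<delta> p * x) \<le> Q * \<delta> p * (1 + d0 * x)" using d0 by (simp add: algebra_simps)
          moreover have "1 + d0 * x > 0" using d0 x by (intro add_pos_nonneg) auto
          ultimately show ?thesis using den[OF x, of p] by (simp add: divide_le_eq le_divide_eq mult_ac frac_le_eq)
        qed
        moreover have "0 \<le> d0 / (1 + d0 * x)" using d0 x by simp
        ultimately have "C1 * (d0 / (1 + d0 * x)) \<le> \<bar>C1\<bar> * (Q * \<delta> p / (1 + \<delta> p * x))" by (intro mult_mono) auto
        then show ?thesis by (simp add: B_def mult.assoc)
      qed
      then have "R p U T" unfolding R_def using UT by (auto intro: order_trans)
      then show ?thesis by blast
    qed
    then obtain U T where R: "\<And>p. p \<in> A \<Longrightarrow> R p (U p) (T p)" by metis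
    then have UT: "\<And>p. p \<in> A \<Longrightarrow> U p 0 = U_hat P (fst p) (snd p)" "\<And>p. p \<in> A \<Longrightarrow> T p 0 = \<Theta>_hat P (fst p) (snd p)"
      "\<And>p. p \<in> A \<Longrightarrow> continuous_on {0..} (U p)" "\<And>p. p \<in> A \<Longrightarrow> continuous_on {0..} (T p)"
      "\<And>p x. p \<in> A \<Longrightarrow> x \<ge> 0 \<Longrightarrow> flow 0 0 0 l2 (U p) (T p) x"
      "\<And>p x. p \<in> A \<Longrightarrow> x \<ge> 0 \<Longrightarrow> \<bar>U p x\<bar> + \<bar>T p x\<bar> \<le> B * (\<delta> p / (1 + \<delta> p * x))"
      unfolding R_def by blast+
    define a where "a p x = P$1$1 * U p x + P$1$2 * T p x" for p x
    define b where "b p x = P$2$1 * U p x + P$2$2 * T p x" for p x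
    define s where "s p x = (P$1$1 + P$2$1) * U p x + (P$1$2 + P$2$2) * T p x" for p x
    have half: "a p x \<le> 1/2" if p: "p \<in> A" and x: "x \<ge> 0" for p x
    proof -
      have "\<delta> p / (1 + \<delta> p * x) \<le> \<delta> p" by (rule Zle[OF x])
      then have "B * (\<delta> p / (1 + \<delta> p * x)) \<le> B * \<delta> p" using B by (rule mult_left_mono)
      also have "\<dots> \<le> (B + 1) * e0" using A\<delta>(1)[OF p] B \<delta>0[of p] by (intro mult_mono) auto
      finally have 1: "\<bar>U p x\<bar> + \<bar>T p x\<bar> \<le> (B + 1) * e0" using UT(6)[OF p x] by simp
      have "\<bar>a p x\<bar> \<le> N * ((B + 1) * e0)" unfolding a_def using 1 by (intro coords_le) auto
      also have "\<dots> \<le> 1/2"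
      proof -
        have "2 * N * (B + 1) > 0" using N B by simp
        then have "e0 * (2 * N * (B + 1)) \<le> 1" using e0le(3) by (subst (asm) le_divide_eq) auto
        then show ?thesis by (simp add: mult_ac)
      qed
      finally show ?thesis by linarith
    qed
    interpret decay_weights A \<delta> "\<lambda>p x. \<delta> p / (1 + \<delta> p * x)" c
    proof unfold_locales
      fix p x assume p: "p \<in> A"
      show "0 \<le> \<delta> p" by (rule \<delta>0)
      show "\<delta> p \<le> 1" using A\<delta>(1)[OF p] e0le(1) by simp
      assume x: "(x::real) > 0"
      show "0 \<le> \<delta> p / (1 + \<delta> p * x)" using den[OF less_imp_le[OF x], of p] \<delta>0[of p] x by simp
      show "\<delta> p / (1 + \<delta> p * x) \<le> \<delta> p" using x by (intro Zle) simp
    qed (rule c)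
    have fl: "(U p has_real_derivative F1 (U p x) (T p x)) (at x)" "(T p has_real_derivative l2 * T p x + F2 (U p x) (T p x)) (at x)"
      if p: "p \<in> A" and x: "x > 0" for p x
    proof -
      have "at x within {0..} = at x" using x by (intro at_within_interior) auto
      then show "(U p has_real_derivative F1 (U p x) (T p x)) (at x)" "(T p has_real_derivative l2 * T p x + F2 (U p x) (T p x)) (at x)"
        using UT(5)[OF p, of x] x by (auto simp: flow_def)
    qed
    have UT0: "cls 0 1 U" "cls 0 1 T"
    proof -
      have "\<bar>U p x\<bar> \<le> B * W 1 p x" "\<bar>T p x\<bar> \<le> B * W 1 p x" if p: "p \<in> A" and x: "x > 0" for p x
      proof -
        have "B * (\<delta> p / (1 + \<delta> p * x)) \<le> B * W 1 p x"
          using B e01(1)[OF p x] by (intro mult_left_mono) (auto simp: W_def)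
        then show "\<bar>U p x\<bar> \<le> B * W 1 p x" "\<bar>T p x\<bar> \<le> B * W 1 p x"
          using UT(6)[OF p, of x] x by linarith+
      qed
      then show "cls 0 1 U" "cls 0 1 T" unfolding cls.simps by blast+
    qed
    have boot: "cls k 1 U \<and> cls k 1 T \<and> cls k 1 (\<lambda>p x. a p x / (1 - a p x))" for k
    proof (rule algebraic_bootstrap[where l="- l2" and s=s])
      show "4 * c \<le> - l2" by (simp add: c_def)
      show "\<And>p x. a p x = P$1$1 * U p x + P$1$2 * T p x" by (simp add: a_def)
      show "\<And>p x. s p x = (P$1$1 + P$2$1) * U p x + (P$1$2 + P$2$2) * T p x" by (simp add: s_def)
      show "(U p has_real_derivative quad (matrix_inv P$1$1 / (\<mu> * M\<^sup>2 * \<gamma>)) (matrix_inv P$1$2 / (2 * \<kappa>)) (a p x) (s p x)) (at x)"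
        if "p \<in> A" "x > 0" for p x using fl(1)[OF that] by (simp add: F1_def a_def s_def)
      show "(T p has_real_derivative - (- l2) * T p x + quad (matrix_inv P$2$1 / (\<mu> * M\<^sup>2 * \<gamma>)) (matrix_inv P$2$2 / (2 * \<kappa>)) (a p x) (s p x)) (at x)"
        if "p \<in> A" "x > 0" for p x using fl(2)[OF that] by (simp add: F2_def a_def s_def)
    qed (use half UT0 in \<open>auto simp: less_imp_le simp del: cls.simps\<close>)
    then have cls_ab: "cls k 1 a" "cls k 1 b" "cls k 1 (\<lambda>p x. a p x / (1 - a p x))" for k
      unfolding a_def[abs_def] b_def[abs_def] by (auto intro!: cls_lin)
    have orb: "orbit \<gamma> \<mu> \<kappa> M (a p) (b p)" if p: "p \<in> A" for p
      unfolding a_def[abs_def] b_def[abs_def]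
    proof (rule orbit_of_flow[OF UT(3)[OF p] UT(4)[OF p]])
      fix x :: real assume x: "x \<ge> 0"
      show "flow l1 0 0 l2 (U p) (T p) x" using UT(5)[OF p x] by (simp only: l10)
      show "ubar (U p x) (T p x) < 1" using half[OF p x] by (simp add: a_def)
    qed
    have Z0: "((\<lambda>x. \<delta> p / (1 + \<delta> p * x)) \<longlongrightarrow> 0) at_top" for p
    proof (cases "\<delta> p = 0")
      case False
      then have "\<delta> p > 0" using \<delta>0[of p] by simp
      then have "filterlim (\<lambda>x. 1 + \<delta> p * x) at_top at_top"
        by (intro filterlim_tendsto_add_at_top[OF tendsto_const] filterlim_tendsto_pos_mult_at_top[OF tendsto_const _ filterlim_ident])
      then show ?thesis by (intro real_tendsto_divide_at_top[OF tendsto_const])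
    qed simp
    have ini: "a p 0 - 1 = fst p" "b p 0 + 1 = snd p" if "p \<in> A" for p
      using hat_inverse[of "fst p" "snd p"] UT(1,2)[OF that] by (simp_all add: a_def b_def)
    obtain C where C: "\<forall>k. C k > 0" "\<forall>p\<in>A. \<exists>\<rho> u \<theta>. unique_stationary_solution \<gamma> \<mu> \<kappa> M (a p 0 - 1) (b p 0 + 1) \<rho> u \<theta> \<and>
       (\<forall>k. \<forall>x>0. norm (perturbation_deriv k \<rho> u \<theta> x) \<le> C k * W (Suc k) p x)"
      using unique_solutions_with_decay[OF par orb Z0 cls_ab] by blast
    have WS: "W (Suc k) p x = (\<delta> p / (1 + \<delta> p * x)) ^ Suc k + \<delta> p * exp (- c * x)" for k p x by (simp add: W_def)
    have "solvable_with_decay \<gamma> \<mu> \<kappa> M A (\<lambda>k \<delta> x. (\<delta> / (1 + \<delta> * x)) ^ Suc k + \<delta> * exp (- c * x))"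
      unfolding solvable_with_decay_def \<delta>_def[symmetric] using C ini unfolding WS by (intro exI[of _ C]) simp
    then show ?thesis using c unfolding A_def by blast
  qed
  then show ?thesis using e0 by blast
qed

end

section \<open>The three regimes put together\<close>

theorem proposition1p1:
  fixes \<gamma> \<mu> \<kappa> M :: real and P :: "real^2^2"
  assumes "\<gamma> > 1" and "\<mu> > 0" and "\<kappa> > 0" and "M > 0"
    and "M \<le> 1 \<Longrightarrow> eigenvector_matrix \<gamma> \<mu> \<kappa> M P"
  shows "\<exists>\<epsilon>0>0. \<exists>r h.
    (M \<le> 1 \<longrightarrow>
       local_stable_manifold \<gamma> \<mu> \<kappa> M P r h \<and>
       (\<forall>(u, \<theta>)\<in>M_plus \<epsilon>0. \<bar>\<Theta>_hat P u \<theta>\<bar> < r)) \<and>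
    (M > 1 \<longrightarrow>
       (\<exists>c>0. \<exists>C. (\<forall>k. C k > 0) \<and>
         (\<forall>ub \<theta>b \<delta>. ub < 0 \<and> \<theta>b > 0 \<and> (ub, \<theta>b) \<in> M_plus \<epsilon>0 \<and> \<delta> = norm (ub + 1, \<theta>b - 1) \<longrightarrow>
           (\<exists>\<rho> u \<theta>. unique_stationary_solution \<gamma> \<mu> \<kappa> M ub \<theta>b \<rho> u \<theta> \<and>
             (\<forall>k. \<forall>x>0. norm (perturbation_deriv k \<rho> u \<theta> x) \<le> C k * \<delta> * exp (- c * x)))))) \<and>
    (M = 1 \<longrightarrow>
       (\<exists>c>0. \<exists>C. (\<forall>k. C k > 0) \<and>
         (\<forall>ub \<theta>b \<delta>. ub < 0 \<and> \<theta>b > 0 \<and> (ub, \<theta>b) \<in> M_zero P h \<epsilon>0 \<and> \<delta> = norm (ub + 1, \<theta>b - 1) \<longrightarrow>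
           (\<exists>\<rho> u \<theta>. unique_stationary_solution \<gamma> \<mu> \<kappa> M ub \<theta>b \<rho> u \<theta> \<and>
             (\<forall>k. \<forall>x>0. norm (perturbation_deriv k \<rho> u \<theta> x)
                \<le> C k * (\<delta> ^ (k + 1) / (1 + \<delta> * x) ^ (k + 1)) + C k * \<delta> * exp (- c * x)))))) \<and>
    (M < 1 \<longrightarrow>
       (\<exists>c>0. \<exists>C. (\<forall>k. C k > 0) \<and>
         (\<forall>ub \<theta>b \<delta>. ub < 0 \<and> \<theta>b > 0 \<and> (ub, \<theta>b) \<in> M_minus P h \<epsilon>0 \<and> \<delta> = norm (ub + 1, \<theta>b - 1) \<longrightarrow>
           (\<exists>\<rho> u \<theta>. unique_stationary_solution \<gamma> \<mu> \<kappa> M ub \<theta>b \<rho> u \<theta> \<and>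
             (\<forall>k. \<forall>x>0. norm (perturbation_deriv k \<rho> u \<theta> x) \<le> C k * \<delta> * exp (- c * x))))))"
proof (cases "M > 1")
  case True
  obtain e c B where ec: "e > 0" "c > 0" and ex: "\<And>a0 b0. norm (a0, b0) < e \<Longrightarrow> (\<exists>a b. orbit \<gamma> \<mu> \<kappa> M a b \<and> a 0 = a0 \<and> b 0 = b0 \<and>
    (\<forall>x\<ge>0. a x \<le> 1/2 \<and> norm (a x, b x) \<le> B * (norm (a0, b0) * exp (- c * x))))"
    using supersonic_orbit[OF assms(1-3) True] by blast
  define \<epsilon>0 where "\<epsilon>0 = min e 1"
  have "solvable_with_decay \<gamma> \<mu> \<kappa> M (M_plus \<epsilon>0) (\<lambda>k \<delta> x. \<delta> * exp (- c * x))"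
  proof (rule exponential_family[OF assms(1-4) ec(2), where B=B])
    fix p assume p: "p \<in> M_plus \<epsilon>0"
    then show "norm (fst p + 1, snd p - 1) \<le> 1" by (auto simp: M_plus_def \<epsilon>0_def)
    have "norm (fst p + 1, snd p - 1) < e" using p by (auto simp: M_plus_def \<epsilon>0_def)
    then obtain a b where ab: "orbit \<gamma> \<mu> \<kappa> M a b" "a 0 = fst p + 1" "b 0 = snd p - 1"
      "\<And>x. x \<ge> 0 \<Longrightarrow> a x \<le> 1/2 \<and> norm (a x, b x) \<le> B * (norm (fst p + 1, snd p - 1) * exp (- c * x))"
      using ex by blast
    have "\<bar>a x\<bar> \<le> norm (a x, b x)" "\<bar>b x\<bar> \<le> norm (a x, b x)" for x
      using norm_fst_le[of "a x" "b x"] norm_snd_le[of "b x" "a x"] by auto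
    then show "\<exists>a b. orbit \<gamma> \<mu> \<kappa> M a b \<and> a 0 = fst p + 1 \<and> b 0 = snd p - 1 \<and>
      (\<forall>x\<ge>0. a x \<le> 1/2 \<and> \<bar>a x\<bar> \<le> B * (norm (fst p + 1, snd p - 1) * exp (- c * x)) \<and> \<bar>b x\<bar> \<le> B * (norm (fst p + 1, snd p - 1) * exp (- c * x)))"
      using ab by (intro exI[of _ a] exI[of _ b]) (meson order_trans)
  qed
  note exponential = solvable_with_decayE[OF this, folded mult.assoc]
  have super: "\<exists>c>0. \<exists>C. (\<forall>k. C k > 0) \<and>
         (\<forall>ub \<theta>b \<delta>. ub < 0 \<and> \<theta>b > 0 \<and> (ub, \<theta>b) \<in> M_plus \<epsilon>0 \<and> \<delta> = norm (ub + 1, \<theta>b - 1) \<longrightarrow>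
           (\<exists>\<rho> u \<theta>. unique_stationary_solution \<gamma> \<mu> \<kappa> M ub \<theta>b \<rho> u \<theta> \<and>
             (\<forall>k. \<forall>x>0. norm (perturbation_deriv k \<rho> u \<theta> x) \<le> C k * \<delta> * exp (- c * x))))"
    by (rule exponential) (use ec(2) in blast)
  have "\<epsilon>0 > 0" using ec by (simp add: \<epsilon>0_def)
  show ?thesis
  \<comment> \<open>For M > 1 all clauses that mention r and h are vacuous, so these witnesses stay
    unspecified.\<close>
  proof (intro exI conjI)
    show "\<epsilon>0 > 0" by fact
  qed (use True super in auto)
next
  case False
  then have M: "M \<le> 1" by simp
  have ev: "eigenvector_matrix \<gamma> \<mu> \<kappa> M P" using assms(5) M by simp
  obtain l1 l2 where l: "0 \<le> l1" "l2 < 0" "M = 1 \<Longrightarrow> l1 = 0" and eig: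
    "1 / \<mu> * (1 / (M\<^sup>2 * \<gamma>) - 1) * P$1$1 + 1 / (\<mu> * M\<^sup>2 * \<gamma>) * P$2$1 = l1 * P$1$1"
    "1 / (\<kappa> * M\<^sup>2 * \<gamma>) * P$1$1 + - c_v \<gamma> / (\<kappa> * M\<^sup>2) * P$2$1 = l1 * P$2$1"
    "1 / \<mu> * (1 / (M\<^sup>2 * \<gamma>) - 1) * P$1$2 + 1 / (\<mu> * M\<^sup>2 * \<gamma>) * P$2$2 = l2 * P$1$2"
    "1 / (\<kappa> * M\<^sup>2 * \<gamma>) * P$1$2 + - c_v \<gamma> / (\<kappa> * M\<^sup>2) * P$2$2 = l2 * P$2$2"
    using eigen_data[OF assms(1-4) M ev] by blast
  interpret diagonal_system l1 l2 \<gamma> \<mu> \<kappa> M P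
    by unfold_locales (use l assms(1-4) ev eig in \<open>auto simp: eigenvector_matrix_def\<close>)
  obtain r C h h' where ig: "invariant_graph r C h h'" using invariant_graph_exists by blast
  have r: "r > 0" using ig by (simp add: invariant_graph_def)
  \<comment> \<open>Only M = 1 asserts anything here; for M < 1 the radius 1 is supplied, so that
    both cases share one choice of \<epsilon>0.\<close>
  define G where "G e \<longleftrightarrow> (\<exists>c>0. solvable_with_decay \<gamma> \<mu> \<kappa> M (M_zero P h e)
      (\<lambda>k \<delta> x. (\<delta> / (1 + \<delta> * x)) ^ Suc k + \<delta> * exp (- c * x)))" for e
  have "\<exists>e0>0. M = 1 \<longrightarrow> (\<forall>e. 0 < e \<longrightarrow> e \<le> e0 \<longrightarrow> G e)"
  proof (cases "M = 1")
    case True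
    have P: "P$1$1 = -1" "P$2$1 = 1 - \<gamma>" "P$1$2 = \<kappa> * (1 - \<gamma>)" "P$2$2 = \<mu>"
      using ev True by (auto simp: eigenvector_matrix_def column_def vec_eq_iff forall_2)
    \<comment> \<open>d is minus the determinant of P. It clears the denominators of the inverse of
      P, whose entries are not computed otherwise.\<close>
    define d where "d = \<mu> + \<kappa> * (\<gamma> - 1)\<^sup>2"
    have d: "d > 0" using assms by (simp add: d_def add_pos_nonneg)
    define q11 where "q11 = matrix_inv P$1$1"
    define q12 where "q12 = matrix_inv P$1$2"
    define q21 where "q21 = matrix_inv P$2$1"
    define q22 where "q22 = matrix_inv P$2$2"
    have i: "- q11 + \<kappa> * (1 - \<gamma>) * q21 = 1" "- q12 + \<kappa> * (1 - \<gamma>) * q22 = 0"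
      "(1 - \<gamma>) * q11 + \<mu> * q21 = 0" "(1 - \<gamma>) * q12 + \<mu> * q22 = 1"
      using inverse_entries[OF inv] unfolding P q11_def q12_def q21_def q22_def by simp_all
    have "\<mu> * (- q11 + \<kappa> * (1 - \<gamma>) * q21) - \<kappa> * (1 - \<gamma>) * ((1 - \<gamma>) * q11 + \<mu> * q21) = - d * q11"
      by (simp add: d_def power2_eq_square algebra_simps)
    then have q11: "d * q11 = - \<mu>" unfolding i by simp
    have "\<mu> * (- q12 + \<kappa> * (1 - \<gamma>) * q22) - \<kappa> * (1 - \<gamma>) * ((1 - \<gamma>) * q12 + \<mu> * q22) = - d * q12"
      by (simp add: d_def power2_eq_square algebra_simps)
    then have q12: "d * q12 = \<kappa> * (1 - \<gamma>)" unfolding i by simp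
    \<comment> \<open>The coefficient of U^2 in U' equals -(\<gamma> + 1) / (2 d). It would change
      sign with the first column of P, so the prescribed scaling matters.\<close>
    have "d * (q11 / (\<mu> * M\<^sup>2 * \<gamma>) * P$1$1 * (P$1$1 + P$2$1) + q12 / (2 * \<kappa>) * (P$1$1)\<^sup>2)
      = (d * q11) / \<mu> + (d * q12) / (2 * \<kappa>)"
      using assms by (simp add: P True field_simps)
    also have "\<dots> = - (\<gamma> + 1) / 2" unfolding q11 q12 using assms by (simp add: field_simps)
    also have "\<dots> < 0" using assms by simp
    finally have "q11 / (\<mu> * M\<^sup>2 * \<gamma>) * P$1$1 * (P$1$1 + P$2$1) + q12 / (2 * \<kappa>) * (P$1$1)\<^sup>2 < 0"
      using d by (simp add: mult_less_0_iff)
    from transonic_family[OF ig l(3)[OF True] this[unfolded q11_def q12_def], folded G_def] show ?thesis by blast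
  qed (auto intro: exI[of _ 1])
  then obtain e0 where e0: "e0 > 0" and trans: "\<And>e. M = 1 \<Longrightarrow> 0 < e \<Longrightarrow> e \<le> e0 \<Longrightarrow> G e"
    by blast
  \<comment> \<open>r / Q keeps \<Theta>_hat inside the domain of h, the entry 1 gives \<delta>
    \<le> 1, and e0 is the transonic radius.\<close>
  define \<epsilon>0 where "\<epsilon>0 = min e0 (min 1 (r / Q))"
  have \<epsilon>0: "\<epsilon>0 > 0" "\<epsilon>0 \<le> e0" "\<epsilon>0 \<le> 1" "Q * \<epsilon>0 \<le> r"
  proof -
    show "\<epsilon>0 > 0" using e0 r Q by (simp add: \<epsilon>0_def)
    have "\<epsilon>0 \<le> r / Q" by (simp add: \<epsilon>0_def)
    then show "Q * \<epsilon>0 \<le> r" using Q by (simp add: le_divide_eq mult.commute)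
  qed (auto simp: \<epsilon>0_def)
  have man: "\<bar>\<Theta>_hat P u \<theta>\<bar> < r" if "(u, \<theta>) \<in> M_plus \<epsilon>0" for u \<theta>
  proof -
    have "\<bar>\<Theta>_hat P u \<theta>\<bar> \<le> Q * norm (u + 1, \<theta> - 1)" using hat_le[of u \<theta>] by linarith
    also have "\<dots> < Q * \<epsilon>0" using that Q by (intro mult_strict_left_mono) (auto simp: M_plus_def)
    finally show ?thesis using \<epsilon>0(4) by simp
  qed
  obtain cs where cs: "cs > 0" "solvable_with_decay \<gamma> \<mu> \<kappa> M (M_minus P h \<epsilon>0) (\<lambda>k \<delta> x. \<delta> * exp (- cs * x))"
    using stable_family[OF ig \<epsilon>0(1,3,4)] by blast
  have sub: "\<exists>c>0. \<exists>C. (\<forall>k. C k > 0) \<and>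
         (\<forall>ub \<theta>b \<delta>. ub < 0 \<and> \<theta>b > 0 \<and> (ub, \<theta>b) \<in> M_minus P h \<epsilon>0 \<and> \<delta> = norm (ub + 1, \<theta>b - 1) \<longrightarrow>
           (\<exists>\<rho> u \<theta>. unique_stationary_solution \<gamma> \<mu> \<kappa> M ub \<theta>b \<rho> u \<theta> \<and>
             (\<forall>k. \<forall>x>0. norm (perturbation_deriv k \<rho> u \<theta> x) \<le> C k * \<delta> * exp (- c * x))))"
    by (rule solvable_with_decayE[OF cs(2), folded mult.assoc]) (use cs(1) in blast)
  have tra: "\<exists>c>0. \<exists>C. (\<forall>k. C k > 0) \<and>
         (\<forall>ub \<theta>b \<delta>. ub < 0 \<and> \<theta>b > 0 \<and> (ub, \<theta>b) \<in> M_zero P h \<epsilon>0 \<and> \<delta> = norm (ub + 1, \<theta>b - 1) \<longrightarrow>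
           (\<exists>\<rho> u \<theta>. unique_stationary_solution \<gamma> \<mu> \<kappa> M ub \<theta>b \<rho> u \<theta> \<and>
             (\<forall>k. \<forall>x>0. norm (perturbation_deriv k \<rho> u \<theta> x)
                \<le> C k * (\<delta> ^ (k + 1) / (1 + \<delta> * x) ^ (k + 1)) + C k * \<delta> * exp (- c * x))))" if M1: "M = 1"
  proof -
    obtain c where c: "c > 0" "solvable_with_decay \<gamma> \<mu> \<kappa> M (M_zero P h \<epsilon>0)
      (\<lambda>k \<delta> x. (\<delta> / (1 + \<delta> * x)) ^ Suc k + \<delta> * exp (- c * x))"
      using trans[OF M1 \<epsilon>0(1,2)] unfolding G_def by blast
    have eq: "C * ((\<delta> / (1 + \<delta> * x)) ^ Suc k + \<delta> * exp (- c * x)) = C * (\<delta> ^ (k + 1) / (1 + \<delta> * x) ^ (k + 1)) + C * \<delta> * exp (- c * x)" for C k \<delta> x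
      by (simp only: power_divide Suc_eq_plus1 distrib_left mult.assoc)
    show ?thesis by (rule solvable_with_decayE[OF c(2), unfolded eq]) (use c(1) in blast)
  qed
  show ?thesis
  proof (rule exI[of _ \<epsilon>0], rule conjI[OF \<epsilon>0(1)], rule exI[of _ r], rule exI[of _ h], intro conjI impI)
    show "local_stable_manifold \<gamma> \<mu> \<kappa> M P r h" by (rule local_stable_manifold_graph[OF ig])
  qed (use man tra sub False in auto)
qed

end
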